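(* Assume (H1)–(H3). Then the quasi-static electroporoelasticity initial-boundary value problem admits at most one weak solution.
   Context: Let $\Omega\subset\mathbb R^3$ be an open, bounded, simply connected, convex domain with Lipschitz boundary and outward unit normal $\mathbf n$, and $T>0$. Let $\epsilon,\sigma,\mu,L,\lambda_c,G,\alpha,c_0,\kappa$ be positive constants. $(\cdot,\cdot)$ and $\|\cdot\|$ denote the $L^2(\Omega)$ (or $L^2(\Omega)^3$) inner product and norm. $\mathbf H(\mathrm{curl})=\{\mathbf v\in L^2(\Omega)^3:\nabla\times\mathbf v\in L^2(\Omega)^3\}$, $\mathbf H_0(\mathrm{curl})=\{\mathbf v\in\mathbf H(\mathrm{curl}):\mathbf v\times\mathbf n=0\text{ on }\partial\Omega\}$, $\mathbf H(\mathrm{div})=\{\mathbf v\in L^2(\Omega)^3:\nabla\cdot\mathbf v\in L^2(\Omega)\}$. The model is: $\epsilon\partial_t\mathbf E+\sigma\mathbf E-\nabla\times\mathbf H-L\nabla p=\mathbf j$, $\mu\partial_t\mathbf H+\nabla\times\mathbf E=0$, $-\lambda_c\nabla(\nabla\cdot\mathbf u)-G\Delta\mathbf u+\alpha\nabla p=0$, $\partial_t(c_0p+\alpha\nabla\cdot\mathbf u)-\kappa\Delta p+L\nabla\cdot\mathbf E=g$ on $[0,T]\times\Omega$, with initial data $(\mathbf E,\mathbf H,\mathbf u,p)(0)=(\mathbf E_0,\mathbf H_0,\mathbf u_0,p_0)$ and boundary conditions $\mathbf E\times\mathbf n=0$, $\mathbf u=0$, $p=0$ on $\partial\Omega$. Let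 $\bar{\mathbb S}=\mathbf H_0(\mathrm{curl})\times\mathbf H(\mathrm{curl})\times H^1_0(\Omega)^3\times H^1_0(\Omega)$ and $\bar{\mathbb H}=L^2(\Omega)^3\times L^2(\Omega)^3\times L^2(\Omega)^3\times L^2(\Omega)$. A weak solution is $(\mathbf E,\mathbf H,\mathbf u,p)\in L^2(0,T;\bar{\mathbb S})\cap H^1(0,T;\bar{\mathbb H})$ satisfying the initial conditions and, for all $t\in[0,T]$ and all $(\mathbf D,\mathbf B,\mathbf v,q)\in\bar{\mathbb S}$: $(\epsilon\partial_t\mathbf E,\mathbf D)+(\sigma\mathbf E,\mathbf D)-(\nabla\times\mathbf H,\mathbf D)-(L\nabla p,\mathbf D)=(\mathbf j,\mathbf D)$; $(\mu\partial_t\mathbf H,\mathbf B)+(\nabla\times\mathbf E,\mathbf B)=0$; $(\lambda_c\nabla\cdot\mathbf u,\nabla\cdot\mathbf v)+(G\nabla\mathbf u,\nabla\mathbf v)-(p,\alpha\nabla\cdot\mathbf v)=0$; $(\partial_t(c_0p+\alpha\nabla\cdot\mathbf u),q)+(\kappa\nabla p,\nabla q)-(L\mathbf E,\nabla q)=(g,q)$. Hypotheses: (H1) $0<L<\sqrt{\sigma\kappa}$; (H2) $\mathbf j\in H^1(0,T;L^2(\Omega)^3)$, $g\in H^1(0,T;L^2(\Omega))$; (H3) $\mathbf E_0\in\mathbf H_0(\mathrm{curl})\cap\mathbf H(\mathrm{div})$, $\mathbf H_0\in\mathbf H(\mathrm{curl})$, $p_0\in H^2(\Omega)\cap H^1_0(\Omega)$.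 *)

theory Defs
  imports "HOL-Analysis.Analysis"
begin

type_synonym vec3 = "real^3"

definition lipschitz_boundary :: "vec3 set \<Rightarrow> bool" where
  "lipschitz_boundary \<Omega> \<longleftrightarrow>
     (\<forall>x\<in>frontier \<Omega>. \<exists>r>0. \<exists>(Q::real^3^3) (\<gamma>::real \<times> real \<Rightarrow> real) C.
        orthogonal_matrix Q \<and> C-lipschitz_on UNIV \<gamma> \<and>
        \<Omega> \<inter> ball x r = {y \<in> ball x r. (Q *v y)$3 < \<gamma> ((Q *v y)$1, (Q *v y)$2)})"

definition pd :: "3 \<Rightarrow> (vec3 \<Rightarrow> 'b::real_normed_vector) \<Rightarrow> vec3 \<Rightarrow> 'b" where
  "pd i f x = frechet_derivative f (at x) (axis i 1)"

definition smooth :: "(vec3 \<Rightarrow> 'b::real_normed_vector) \<Rightarrow> bool" where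
  "smooth f \<longleftrightarrow> (\<forall>is x. foldr pd is f differentiable (at x))"

definition test_fun :: "vec3 set \<Rightarrow> (vec3 \<Rightarrow> 'b::real_normed_vector) \<Rightarrow> bool" where
  "test_fun \<Omega> \<phi> \<longleftrightarrow> smooth \<phi> \<and> compact (closure {x. \<phi> x \<noteq> 0}) \<and> closure {x. \<phi> x \<noteq> 0} \<subseteq> \<Omega>"

definition cgrad :: "(vec3 \<Rightarrow> real) \<Rightarrow> vec3 \<Rightarrow> vec3" where
  "cgrad \<phi> x = (\<chi> i. pd i \<phi> x)"

definition ccurl :: "(vec3 \<Rightarrow> vec3) \<Rightarrow> vec3 \<Rightarrow> vec3" where
  "ccurl \<phi> x = vector [pd 2 \<phi> x $ 3 - pd 3 \<phi> x $ 2,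
                       pd 3 \<phi> x $ 1 - pd 1 \<phi> x $ 3,
                       pd 1 \<phi> x $ 2 - pd 2 \<phi> x $ 1]"

definition L2 :: "vec3 set \<Rightarrow> (vec3 \<Rightarrow> 'b::euclidean_space) \<Rightarrow> bool" where
  "L2 \<Omega> f \<longleftrightarrow> set_borel_measurable lebesgue \<Omega> f \<and>
                set_integrable lebesgue \<Omega> (\<lambda>x. (norm (f x))\<^sup>2)"

definition ip :: "vec3 set \<Rightarrow> (vec3 \<Rightarrow> 'b::euclidean_space) \<Rightarrow> (vec3 \<Rightarrow> 'b) \<Rightarrow> real" where
  "ip \<Omega> f g = set_lebesgue_integral lebesgue \<Omega> (\<lambda>x. inner (f x) (g x))"

definition weak_grad :: "vec3 set \<Rightarrow> (vec3 \<Rightarrow> real) \<Rightarrow> (vec3 \<Rightarrow> vec3) \<Rightarrow> bool" where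
  "weak_grad \<Omega> q Gq \<longleftrightarrow> (\<forall>\<phi>::vec3 \<Rightarrow> real. test_fun \<Omega> \<phi> \<longrightarrow> (\<forall>i.
      set_lebesgue_integral lebesgue \<Omega> (\<lambda>x. q x * pd i \<phi> x) =
      - set_lebesgue_integral lebesgue \<Omega> (\<lambda>x. Gq x $ i * \<phi> x)))"

definition weak_curl :: "vec3 set \<Rightarrow> (vec3 \<Rightarrow> vec3) \<Rightarrow> (vec3 \<Rightarrow> vec3) \<Rightarrow> bool" where
  "weak_curl \<Omega> B cB \<longleftrightarrow> (\<forall>\<phi>::vec3 \<Rightarrow> vec3. test_fun \<Omega> \<phi> \<longrightarrow>
      set_lebesgue_integral lebesgue \<Omega> (\<lambda>x. inner (B x) (ccurl \<phi> x)) =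
      set_lebesgue_integral lebesgue \<Omega> (\<lambda>x. inner (cB x) (\<phi> x)))"

definition weak_div :: "vec3 set \<Rightarrow> (vec3 \<Rightarrow> vec3) \<Rightarrow> (vec3 \<Rightarrow> real) \<Rightarrow> bool" where
  "weak_div \<Omega> D d \<longleftrightarrow> (\<forall>\<phi>::vec3 \<Rightarrow> real. test_fun \<Omega> \<phi> \<longrightarrow>
      set_lebesgue_integral lebesgue \<Omega> (\<lambda>x. inner (D x) (cgrad \<phi> x)) =
      - set_lebesgue_integral lebesgue \<Omega> (\<lambda>x. d x * \<phi> x))"

definition H1 :: "vec3 set \<Rightarrow> (vec3 \<Rightarrow> real) \<Rightarrow> (vec3 \<Rightarrow> vec3) \<Rightarrow> bool" where
  "H1 \<Omega> q Gq \<longleftrightarrow> L2 \<Omega> q \<and> L2 \<Omega> Gq \<and> weak_grad \<Omega> q Gq"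

definition H1_0 :: "vec3 set \<Rightarrow> (vec3 \<Rightarrow> real) \<Rightarrow> (vec3 \<Rightarrow> vec3) \<Rightarrow> bool" where
  "H1_0 \<Omega> q Gq \<longleftrightarrow> H1 \<Omega> q Gq \<and>
     (\<exists>\<phi>s::nat \<Rightarrow> vec3 \<Rightarrow> real. (\<forall>n. test_fun \<Omega> (\<phi>s n)) \<and>
        (\<lambda>n. set_lebesgue_integral lebesgue \<Omega>
               (\<lambda>x. (\<phi>s n x - q x)\<^sup>2 + (norm (cgrad (\<phi>s n) x - Gq x))\<^sup>2)) \<longlonglongrightarrow> 0)"

text \<open>v in H^1_0(\<Omega>)^3 with weak gradient Dv, (Dv x)$i$j = d_j v_i\<close>
definition H1_0v :: "vec3 set \<Rightarrow> (vec3 \<Rightarrow> vec3) \<Rightarrow> (vec3 \<Rightarrow> real^3^3) \<Rightarrow> bool" where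
  "H1_0v \<Omega> v Dv \<longleftrightarrow> (\<forall>i. H1_0 \<Omega> (\<lambda>x. v x $ i) (\<lambda>x. Dv x $ i))"

definition mdiv :: "real^3^3 \<Rightarrow> real" where
  "mdiv M = (\<Sum>i\<in>UNIV. M $ i $ i)"

definition H2 :: "vec3 set \<Rightarrow> (vec3 \<Rightarrow> real) \<Rightarrow> bool" where
  "H2 \<Omega> q \<longleftrightarrow> (\<exists>Gq. H1 \<Omega> q Gq \<and> (\<forall>i. \<exists>Hi. H1 \<Omega> (\<lambda>x. Gq x $ i) Hi))"

definition Hcurl :: "vec3 set \<Rightarrow> (vec3 \<Rightarrow> vec3) \<Rightarrow> (vec3 \<Rightarrow> vec3) \<Rightarrow> bool" where
  "Hcurl \<Omega> B cB \<longleftrightarrow> L2 \<Omega> B \<and> L2 \<Omega> cB \<and> weak_curl \<Omega> B cB"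

text \<open>D in H_0(curl) (closure of test fields in the H(curl) norm, i.e. D x n = 0) with weak curl cD\<close>
definition H0curl :: "vec3 set \<Rightarrow> (vec3 \<Rightarrow> vec3) \<Rightarrow> (vec3 \<Rightarrow> vec3) \<Rightarrow> bool" where
  "H0curl \<Omega> D cD \<longleftrightarrow> Hcurl \<Omega> D cD \<and>
     (\<exists>\<phi>s::nat \<Rightarrow> vec3 \<Rightarrow> vec3. (\<forall>n. test_fun \<Omega> (\<phi>s n)) \<and>
        (\<lambda>n. set_lebesgue_integral lebesgue \<Omega>
               (\<lambda>x. (norm (\<phi>s n x - D x))\<^sup>2 + (norm (ccurl (\<phi>s n) x - cD x))\<^sup>2)) \<longlonglongrightarrow> 0)"

definition Hdiv :: "vec3 set \<Rightarrow> (vec3 \<Rightarrow> vec3) \<Rightarrow> bool" where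
  "Hdiv \<Omega> D \<longleftrightarrow> L2 \<Omega> D \<and> (\<exists>d. L2 \<Omega> d \<and> weak_div \<Omega> D d)"

text \<open>L^2(0,T; L^2(\<Omega>)) identified with L^2((0,T) x \<Omega>)\<close>
definition L2T :: "vec3 set \<Rightarrow> real \<Rightarrow> (real \<Rightarrow> vec3 \<Rightarrow> 'b::euclidean_space) \<Rightarrow> bool" where
  "L2T \<Omega> T f \<longleftrightarrow>
     set_borel_measurable lebesgue ({0<..<T} \<times> \<Omega>) (\<lambda>z. f (fst z) (snd z)) \<and>
     set_integrable lebesgue ({0<..<T} \<times> \<Omega>) (\<lambda>z. (norm (f (fst z) (snd z)))\<^sup>2)"

definition time_prim :: "vec3 set \<Rightarrow> real \<Rightarrow> (real \<Rightarrow> vec3 \<Rightarrow> 'b::euclidean_space)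
    \<Rightarrow> (vec3 \<Rightarrow> 'b) \<Rightarrow> (real \<Rightarrow> vec3 \<Rightarrow> 'b) \<Rightarrow> bool" where
  "time_prim \<Omega> T f f0 ft \<longleftrightarrow>
     (AE z in lebesgue. z \<in> {0<..<T} \<times> \<Omega> \<longrightarrow>
        f (fst z) (snd z) = f0 (snd z) + set_lebesgue_integral lebesgue {0..fst z} (\<lambda>s. ft s (snd z)))"

definition H1T :: "vec3 set \<Rightarrow> real \<Rightarrow> (real \<Rightarrow> vec3 \<Rightarrow> 'b::euclidean_space) \<Rightarrow> bool" where
  "H1T \<Omega> T f \<longleftrightarrow> L2T \<Omega> T f \<and>
     (\<exists>f0 ft. L2 \<Omega> f0 \<and> L2T \<Omega> T ft \<and> time_prim \<Omega> T f f0 ft)"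

definition weak_solution ::
  "vec3 set \<Rightarrow> real \<Rightarrow> real \<Rightarrow> real \<Rightarrow> real \<Rightarrow> real \<Rightarrow> real \<Rightarrow> real \<Rightarrow> real \<Rightarrow> real \<Rightarrow> real
   \<Rightarrow> (real \<Rightarrow> vec3 \<Rightarrow> vec3) \<Rightarrow> (real \<Rightarrow> vec3 \<Rightarrow> real)
   \<Rightarrow> (vec3 \<Rightarrow> vec3) \<Rightarrow> (vec3 \<Rightarrow> vec3) \<Rightarrow> (vec3 \<Rightarrow> vec3) \<Rightarrow> (vec3 \<Rightarrow> real)
   \<Rightarrow> (real \<Rightarrow> vec3 \<Rightarrow> vec3) \<Rightarrow> (real \<Rightarrow> vec3 \<Rightarrow> vec3) \<Rightarrow> (real \<Rightarrow> vec3 \<Rightarrow> vec3) \<Rightarrow> (real \<Rightarrow> vec3 \<Rightarrow> real)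
   \<Rightarrow> bool" where
  "weak_solution \<Omega> T eps sig mu L lam G alpha c0 kappa j g E0 H0 u0 p0 E H u p \<longleftrightarrow>
    (\<exists>Et Ht ut pt cE cH Du Gp.
      \<comment> \<open>membership in L^2(0,T;S) \<inter> H^1(0,T;H), with initial conditions\<close>
      L2T \<Omega> T E \<and> L2T \<Omega> T H \<and> L2T \<Omega> T u \<and> L2T \<Omega> T p \<and>
      L2T \<Omega> T cE \<and> L2T \<Omega> T cH \<and> L2T \<Omega> T Du \<and> L2T \<Omega> T Gp \<and>
      L2T \<Omega> T Et \<and> L2T \<Omega> T Ht \<and> L2T \<Omega> T ut \<and> L2T \<Omega> T pt \<and>
      (AE t in lebesgue. t \<in> {0<..<T} \<longrightarrow>
         H0curl \<Omega> (E t) (cE t) \<and> Hcurl \<Omega> (H t) (cH t) \<and>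
         H1_0v \<Omega> (u t) (Du t) \<and> H1_0 \<Omega> (p t) (Gp t)) \<and>
      time_prim \<Omega> T E E0 Et \<and> time_prim \<Omega> T H H0 Ht \<and>
      time_prim \<Omega> T u u0 ut \<and> time_prim \<Omega> T p p0 pt \<and>
      \<comment> \<open>variational equations\<close>
      (AE t in lebesgue. t \<in> {0<..<T} \<longrightarrow>
         (\<forall>D cD. H0curl \<Omega> D cD \<longrightarrow>
            eps * ip \<Omega> (Et t) D + sig * ip \<Omega> (E t) D - ip \<Omega> (cH t) D - L * ip \<Omega> (Gp t) D
              = ip \<Omega> (j t) D) \<and>
         (\<forall>B cB. Hcurl \<Omega> B cB \<longrightarrow>
            mu * ip \<Omega> (Ht t) B + ip \<Omega> (cE t) B = 0) \<and>
         (\<forall>v Dv. H1_0v \<Omega> v Dv \<longrightarrow>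
            lam * ip \<Omega> (\<lambda>x. mdiv (Du t x)) (\<lambda>x. mdiv (Dv x)) + G * ip \<Omega> (Du t) Dv
              - alpha * ip \<Omega> (p t) (\<lambda>x. mdiv (Dv x)) = 0) \<and>
         (\<forall>q Gq. H1_0 \<Omega> q Gq \<longrightarrow>
            c0 * ip \<Omega> (pt t) q - alpha * ip \<Omega> (ut t) Gq + kappa * ip \<Omega> (Gp t) Gq
              - L * ip \<Omega> (E t) Gq = ip \<Omega> (g t) q)))"

end

(* Uniqueness by an energy estimate for time-integrated fields, which needs no time derivative of
   the displacement u beyond L^2. The difference of two solutions solves the homogeneous problem.
   Test the equations at time t with the solution at time s, and integrate over 0 < t < r. Since
   E(r) is the integral of E_t over (0,r), and likewise for H, u and p, adding the four equations gives
     K(r,s) + (integral over 0 < t < r of N(t,s) + Z(t,s)) = 0,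
   where
     K = eps (E,E) + mu (H,H) + c0 (p,p) + lam (div u, div u) + G (Du,Du),
     N = sig (E,E) + kappa (grad p, grad p) - L (grad p,E) - L (E, grad p),
   all arguments being taken at the two times, and Z(t,s) = (curl E(t), H(s)) - (H(t), curl E(s)).
   Integrated over 0 < t,s < r, the antisymmetric kernel Z vanishes, and N contributes a nonnegative
   quantity because L^2 < sig kappa. Hence the integral of K(r,s) over 0 < s < r is nonpositive, and
   by symmetry so is the integral of K over 0 < r,s < tau. The latter is a sum of squared norms of
   time integrals over (0,tau), so E = H = p = 0; the elasticity equation then yields Du = 0 and u = 0.
   Only Fubini's theorem is used, no Bochner integration in function spaces. *)
theory Submission
  imports Defs
begin

section \<open>Square-integrable functions\<close>

text \<open>The usual energy estimate tests the elasticity equation with \<open>ut\<close> or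
  differentiates that equation in time. Neither is possible here: \<open>ut\<close> is only square
  integrable, so it is no admissible test field, and nothing is known about a time derivative of
  \<open>Du\<close>. Freezing the test time s removes the obstacle. The coupling - \<alpha> (ut(t),
  grad p(s)) of the pressure equation, integrated in t, becomes - \<alpha> (u(r), grad p(s)) =
  \<alpha> (div u(r), p(s)), and the elasticity equation at time s, tested with u(r), turns this
  into the elastic part of K(r,s). So elasticity is the one equation that is used at a single time
  and not integrated, and this is what makes K symmetric. A frozen test time also replaces the chain
  rule for squared norms and continuity in time by primitives. The price is that each identity holds
  only for almost every pair of times, so null sets in time, in space and in space-time have to be
  related to each other. Boundary conditions are encoded by approximating test functions; every
  integration by parts is therefore a limit of inner products.\<close>

lemma L2_iff:
  "L2 \<Omega> f \<longleftrightarrow> (\<lambda>x. indicator \<Omega> x *\<^sub>R f x) \<in> borel_measurable lebesgue \<and>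
     integrable lebesgue (\<lambda>x. (norm (indicator \<Omega> x *\<^sub>R f x))\<^sup>2)"
proof -
  have "(\<lambda>x. indicator \<Omega> x *\<^sub>R (norm (f x))\<^sup>2) = (\<lambda>x. (norm (indicator \<Omega> x *\<^sub>R f x))\<^sup>2)"
    by (auto simp: indicator_def fun_eq_iff)
  then show ?thesis
    unfolding L2_def set_borel_measurable_def set_integrable_def by simp
qed

lemma inner_le_norm_squares: "\<bar>inner a b\<bar> \<le> (norm a)\<^sup>2 + (norm (b::'a::real_inner))\<^sup>2"
  using Cauchy_Schwarz_ineq2[of a b] sum_squares_bound[of "norm a" "norm b"]
    mult_nonneg_nonneg[OF norm_ge_zero norm_ge_zero, of a b] by linarith

text \<open>The parallelogram law with the square of the sum dropped. It dominates differences, as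
  \<open>inner_le_norm_squares\<close> dominates products.\<close>

lemma norm_diff_square_le: "(norm (a - b))\<^sup>2 \<le> 2 * (norm a)\<^sup>2 + 2 * (norm (b::'a::real_inner))\<^sup>2"
proof -
  have "(norm (a - b))\<^sup>2 + (norm (a + b))\<^sup>2 = 2 * (norm a)\<^sup>2 + 2 * (norm b)\<^sup>2"
    by (simp add: power2_norm_eq_inner inner_simps inner_commute)
  then show ?thesis using zero_le_power2[of "norm (a + b)"] by linarith
qed

lemma integrable_inner_if_square_integrable:
  fixes f g :: "'a \<Rightarrow> 'b::euclidean_space"
  assumes [measurable]: "f \<in> borel_measurable M" "g \<in> borel_measurable M"
    and "integrable M (\<lambda>x. (norm (f x))\<^sup>2)" "integrable M (\<lambda>x. (norm (g x))\<^sup>2)"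
  shows "integrable M (\<lambda>x. inner (f x) (g x))"
proof (rule Bochner_Integration.integrable_bound)
  show "integrable M (\<lambda>x. (norm (f x))\<^sup>2 + (norm (g x))\<^sup>2)"
    using assms by simp
qed (use inner_le_norm_squares in auto)

lemma set_integrable_inner:
  assumes "L2 \<Omega> f" "L2 \<Omega> g"
  shows "set_integrable lebesgue \<Omega> (\<lambda>x. inner (f x) (g x))"
proof -
  have "(\<lambda>x. indicator \<Omega> x *\<^sub>R inner (f x) (g x)) =
      (\<lambda>x. inner (indicator \<Omega> x *\<^sub>R f x) (indicator \<Omega> x *\<^sub>R g x))"
    by (auto simp: indicator_def fun_eq_iff)
  then show ?thesis
    using assms unfolding set_integrable_def L2_iff
    by (simp only:) (intro integrable_inner_if_square_integrable; blast)
qed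

lemma L2_diff:
  assumes "L2 \<Omega> f" "L2 \<Omega> g"
  shows "L2 \<Omega> (\<lambda>x. f x - g x)"
proof -
  define F G where "F x = indicator \<Omega> x *\<^sub>R f x" and "G x = indicator \<Omega> x *\<^sub>R g x" for x
  have F: "F \<in> borel_measurable lebesgue" "integrable lebesgue (\<lambda>x. (norm (F x))\<^sup>2)"
    and G: "G \<in> borel_measurable lebesgue" "integrable lebesgue (\<lambda>x. (norm (G x))\<^sup>2)"
    using assms by (simp_all add: L2_iff F_def[abs_def] G_def[abs_def])
  have "integrable lebesgue (\<lambda>x. (norm (F x - G x))\<^sup>2)"
  proof (rule Bochner_Integration.integrable_bound)
    show "integrable lebesgue (\<lambda>x. 2 * (norm (F x))\<^sup>2 + 2 * (norm (G x))\<^sup>2)"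
      using F G by simp
    show "(\<lambda>x. (norm (F x - G x))\<^sup>2) \<in> borel_measurable lebesgue"
      using F(1) G(1) by measurable
  qed (use norm_diff_square_le in \<open>auto intro!: AE_I2\<close>)
  moreover have "(\<lambda>x. F x - G x) \<in> borel_measurable lebesgue"
    using F(1) G(1) by (rule borel_measurable_diff)
  ultimately show ?thesis
    by (simp add: L2_iff F_def G_def scaleR_diff_right)
qed

lemma L2_bounded_linear:
  assumes f: "L2 \<Omega> f" and h: "bounded_linear h"
  shows "L2 \<Omega> (\<lambda>x. h (f x))"
proof -
  interpret h: bounded_linear h by (rule h)
  define F where "F x = indicator \<Omega> x *\<^sub>R f x" for x
  have F: "F \<in> borel_measurable lebesgue" "integrable lebesgue (\<lambda>x. (norm (F x))\<^sup>2)"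
    using f by (simp_all add: L2_iff F_def[abs_def])
  obtain K where K: "\<And>x. norm (h x) \<le> norm x * K" using h.bounded by blast
  have m: "(\<lambda>x. h (F x)) \<in> borel_measurable lebesgue"
    by (rule measurable_compose[OF F(1) borel_measurable_continuous_onI])
       (rule h.continuous_on[OF continuous_on_id])
  have "integrable lebesgue (\<lambda>x. (norm (h (F x)))\<^sup>2)"
  proof (rule Bochner_Integration.integrable_bound)
    show "integrable lebesgue (\<lambda>x. K\<^sup>2 * (norm (F x))\<^sup>2)"
      using F by simp
    show "(\<lambda>x. (norm (h (F x)))\<^sup>2) \<in> borel_measurable lebesgue"
      using m by measurable
    have "(norm (h x))\<^sup>2 \<le> K\<^sup>2 * (norm x)\<^sup>2" for x
      using power_mono[OF K[of x], of 2] by (simp add: power_mult_distrib mult.commute)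
    then show "AE x in lebesgue. norm ((norm (h (F x)))\<^sup>2) \<le> norm (K\<^sup>2 * (norm (F x))\<^sup>2)"
      by (auto intro!: AE_I2)
  qed
  then show ?thesis
    using m by (simp add: L2_iff F_def h.scaleR)
qed

lemma L2_sum:
  assumes "finite I" "\<And>i. i \<in> I \<Longrightarrow> L2 \<Omega> (f i)"
  shows "L2 \<Omega> (\<lambda>x. \<Sum>i\<in>I. f i x)"
  using assms
proof (induction I)
  case empty
  show ?case by (simp add: L2_iff)
next
  case (insert i I)
  have "L2 \<Omega> (\<lambda>x. f i x - (- 1) *\<^sub>R (\<Sum>i\<in>I. f i x))"
    using insert by (intro L2_diff L2_bounded_linear[OF _ bounded_linear_scaleR_right]) auto
  then show ?case using insert by simp
qed

lemma L2_vec_nth: "L2 \<Omega> f \<Longrightarrow> L2 \<Omega> (\<lambda>x. f x $ i)"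
  for f :: "vec3 \<Rightarrow> 'b::euclidean_space ^ 'n"
  using L2_bounded_linear[OF _ bounded_linear_vec_nth] .

lemma bounded_linear_axis: "bounded_linear (axis i :: 'a::real_normed_vector \<Rightarrow> 'a ^ 'n)"
proof (rule bounded_linear_intro)
  show "axis i (x + y) = axis i x + (axis i y :: 'a ^ 'n)" for x y
    by (simp add: axis_def vec_eq_iff)
  show "axis i (r *\<^sub>R x) = r *\<^sub>R (axis i x :: 'a ^ 'n)" for r x
    by (simp add: axis_def vec_eq_iff)
  show "norm (axis i x :: 'a ^ 'n) \<le> norm x * 1" for x
    by (simp add: norm_vec_def L2_set_def axis_def if_distrib[of norm] if_distrib[of "\<lambda>x. x\<^sup>2"] cong: if_cong)
qed

lemma vec_eq_sum_axis: "(f :: 'a::real_normed_vector ^ 'n) = (\<Sum>i\<in>UNIV. axis i (f $ i))"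
proof -
  have "(\<Sum>i\<in>UNIV. axis i (f $ i)) $ j = f $ j" for j
    by (simp add: axis_def sum.delta)
  then show ?thesis by (simp add: vec_eq_iff)
qed

text \<open>A field is the finite sum of its components, each placed by the bounded linear map
  \<open>axis i\<close>.\<close>

lemma L2_vec:
  fixes f :: "vec3 \<Rightarrow> 'b::euclidean_space ^ 'n"
  assumes "\<And>i. L2 \<Omega> (\<lambda>x. f x $ i)"
  shows "L2 \<Omega> f"
proof -
  have "L2 \<Omega> (\<lambda>x. \<Sum>i\<in>UNIV. axis i (f x $ i))"
    using assms by (intro L2_sum L2_bounded_linear[OF _ bounded_linear_axis]) auto
  then show ?thesis by (simp flip: vec_eq_sum_axis)
qed

lemma bounded_linear_mdiv: "bounded_linear mdiv"
  unfolding mdiv_def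
  by (rule bounded_linear_sum[OF bounded_linear_compose[OF bounded_linear_vec_nth bounded_linear_vec_nth]])

section \<open>The inner product of square-integrable functions\<close>

lemma ip_commute: "ip \<Omega> f g = ip \<Omega> g f"
  by (simp add: ip_def inner_commute)

lemma ip_diff_right:
  assumes "L2 \<Omega> f" "L2 \<Omega> g" "L2 \<Omega> h"
  shows "ip \<Omega> h (\<lambda>x. f x - g x) = ip \<Omega> h f - ip \<Omega> h g"
  unfolding ip_def inner_diff_right
  by (intro set_integral_diff(2) set_integrable_inner assms)

lemma ip_diff_left:
  assumes "L2 \<Omega> f" "L2 \<Omega> g" "L2 \<Omega> h"
  shows "ip \<Omega> (\<lambda>x. f x - g x) h = ip \<Omega> f h - ip \<Omega> g h"
  using ip_diff_right[OF assms] by (simp add: ip_commute)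

lemma ip_scaleR_right: "ip \<Omega> h (\<lambda>x. c *\<^sub>R f x) = c * ip \<Omega> h f"
  unfolding ip_def by simp

lemma ip_self_nonneg: "ip \<Omega> f f \<ge> 0"
  unfolding ip_def set_lebesgue_integral_def by (intro integral_nonneg_AE AE_I2) simp

lemma ip_vec:
  fixes f g :: "vec3 \<Rightarrow> 'b::euclidean_space ^ 'n"
  assumes "L2 \<Omega> f" "L2 \<Omega> g"
  shows "ip \<Omega> f g = (\<Sum>i\<in>UNIV. ip \<Omega> (\<lambda>x. f x $ i) (\<lambda>x. g x $ i))"
proof -
  have "set_integrable lebesgue \<Omega> (\<lambda>x. inner (f x $ i) (g x $ i))" for i
    using assms by (intro set_integrable_inner L2_vec_nth)
  then have "(LINT x|lebesgue. (\<Sum>i\<in>UNIV. indicator \<Omega> x *\<^sub>R inner (f x $ i) (g x $ i))) =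
      (\<Sum>i\<in>UNIV. LINT x|lebesgue. indicator \<Omega> x *\<^sub>R inner (f x $ i) (g x $ i))"
    unfolding set_integrable_def by (rule Bochner_Integration.integral_sum)
  then show ?thesis
    unfolding ip_def set_lebesgue_integral_def inner_vec_def scaleR_sum_right .
qed

text \<open>A quadratic polynomial in t without negative values. Functions are not identified almost
  everywhere, so \<open>ip\<close> is only a semi-inner product and the degenerate case needs an
  argument of its own.\<close>

lemma ip_Cauchy_Schwarz:
  assumes f: "L2 \<Omega> f" and g: "L2 \<Omega> g"
  shows "(ip \<Omega> f g)\<^sup>2 \<le> ip \<Omega> f f * ip \<Omega> g g"
proof -
  define a b c where "a = ip \<Omega> f f" and "b = ip \<Omega> f g" and "c = ip \<Omega> g g"
  have q: "a - 2 * t * b + t\<^sup>2 * c \<ge> 0" for t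
  proof -
    have tg: "L2 \<Omega> (\<lambda>x. t *\<^sub>R g x)"
      using g by (rule L2_bounded_linear[OF _ bounded_linear_scaleR_right])
    have "0 \<le> ip \<Omega> (\<lambda>x. f x - t *\<^sub>R g x) (\<lambda>x. f x - t *\<^sub>R g x)"
      by (rule ip_self_nonneg)
    also have "\<dots> = a - t * b - t * (b - t * c)"
      unfolding ip_diff_left[OF f tg L2_diff[OF f tg]] ip_diff_right[OF f tg f] ip_diff_right[OF f tg tg]
        ip_scaleR_right ip_commute[of \<Omega> "\<lambda>x. t *\<^sub>R g x" f] ip_commute[of \<Omega> "\<lambda>x. t *\<^sub>R g x" g]
      by (simp add: a_def b_def c_def ip_commute[of \<Omega> g f] ip_scaleR_right algebra_simps)
    finally show ?thesis by (simp add: algebra_simps power2_eq_square)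
  qed
  have "c \<ge> 0" unfolding c_def by (rule ip_self_nonneg)
  show ?thesis
  proof (cases "c = 0")
    case True
    have "b = 0"
    proof (rule ccontr)
      assume "b \<noteq> 0"
      \<comment> \<open>With c = 0 the polynomial is linear, and at this t its value is -1.\<close>
      with True q[of "(a + 1) / (2 * b)"] show False by simp
    qed
    then show ?thesis using True by (simp add: a_def b_def c_def)
  next
    case False
    then have "c > 0" using \<open>c \<ge> 0\<close> by simp
    \<comment> \<open>The minimum of the polynomial is attained at b / c.\<close>
    with q[of "b / c"] have "b\<^sup>2 \<le> a * c"
      by (simp add: field_simps power2_eq_square)
    then show ?thesis by (simp add: a_def b_def c_def)
  qed
qed

section \<open>Strong convergence and limits of inner products\<close>

lemma tendsto_0_sandwich:
  fixes a b :: "nat \<Rightarrow> real"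
  assumes "b \<longlonglongrightarrow> 0" "\<And>n. 0 \<le> a n" "\<And>n. a n \<le> b n"
  shows "a \<longlonglongrightarrow> 0"
  by (rule tendsto_sandwich[of "\<lambda>_. 0" a sequentially b]) (use assms in auto)

definition L2_tendsto :: "vec3 set \<Rightarrow> (nat \<Rightarrow> vec3 \<Rightarrow> 'b::euclidean_space) \<Rightarrow> (vec3 \<Rightarrow> 'b) \<Rightarrow> bool" where
  "L2_tendsto \<Omega> F f \<longleftrightarrow> (\<lambda>n. ip \<Omega> (\<lambda>x. F n x - f x) (\<lambda>x. F n x - f x)) \<longlonglongrightarrow> 0"

text \<open>Strong convergence implies weak convergence, by Cauchy-Schwarz. Every integration by
  parts below passes from test functions to the limit through this.\<close>

lemma ip_tendsto:
  assumes h: "L2 \<Omega> h" and F: "\<And>n. L2 \<Omega> (F n)" and f: "L2 \<Omega> f" and lim: "L2_tendsto \<Omega> F f"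
  shows "(\<lambda>n. ip \<Omega> h (F n)) \<longlonglongrightarrow> ip \<Omega> h f"
proof -
  define d where "d n x = F n x - f x" for n x
  have d: "L2 \<Omega> (d n)" for n unfolding d_def[abs_def] using F f by (rule L2_diff)
  have "(\<lambda>n. ip \<Omega> h h * ip \<Omega> (d n) (d n)) \<longlonglongrightarrow> 0"
    using lim by (intro tendsto_mult_right_zero) (simp add: L2_tendsto_def d_def[abs_def])
  then have "(\<lambda>n. (ip \<Omega> h (d n))\<^sup>2) \<longlonglongrightarrow> 0"
    by (rule tendsto_0_sandwich) (use ip_Cauchy_Schwarz[OF h d] in auto)
  then have "(\<lambda>n. ip \<Omega> h (d n)) \<longlonglongrightarrow> 0"
    by (simp add: tendsto_power_zero power_tendsto_0_iff)
  then show ?thesis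
    unfolding d_def[abs_def] by (subst (asm) ip_diff_right[OF F f h]) (simp add: LIM_zero_iff)
qed

lemma L2_tendsto_diff:
  assumes "\<And>n. L2 \<Omega> (F n)" "L2 \<Omega> f" "L2_tendsto \<Omega> F f"
    and "\<And>n. L2 \<Omega> (G n)" "L2 \<Omega> g" "L2_tendsto \<Omega> G g"
  shows "L2_tendsto \<Omega> (\<lambda>n x. F n x - G n x) (\<lambda>x. f x - g x)"
proof -
  define a b where "a n x = F n x - f x" and "b n x = G n x - g x" for n x
  have ab: "L2 \<Omega> (a n)" "L2 \<Omega> (b n)" for n
    using assms by (auto simp: a_def[abs_def] b_def[abs_def] intro!: L2_diff)
  have eq: "F n x - G n x - (f x - g x) = a n x - b n x" for n x
    by (simp add: a_def b_def)
  have le: "ip \<Omega> (\<lambda>x. a n x - b n x) (\<lambda>x. a n x - b n x) \<le> 2 * ip \<Omega> (a n) (a n) + 2 * ip \<Omega> (b n) (b n)" for n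
  proof -
    have s: "set_integrable lebesgue \<Omega> (\<lambda>x. 2 * inner (a n x) (a n x))"
        "set_integrable lebesgue \<Omega> (\<lambda>x. 2 * inner (b n x) (b n x))"
      using set_integrable_inner[OF ab(1) ab(1)] set_integrable_inner[OF ab(2) ab(2)] by simp_all
    have "ip \<Omega> (\<lambda>x. a n x - b n x) (\<lambda>x. a n x - b n x) \<le>
        (LINT x:\<Omega>|lebesgue. 2 * inner (a n x) (a n x) + 2 * inner (b n x) (b n x))"
      unfolding ip_def
    proof (rule set_integral_mono)
      show "set_integrable lebesgue \<Omega> (\<lambda>x. inner (a n x - b n x) (a n x - b n x))"
        using ab by (intro set_integrable_inner L2_diff)
      show "inner (a n x - b n x) (a n x - b n x) \<le> 2 * inner (a n x) (a n x) + 2 * inner (b n x) (b n x)" for x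
        using norm_diff_square_le[of "a n x" "b n x"] by (simp add: power2_norm_eq_inner)
      show "set_integrable lebesgue \<Omega> (\<lambda>x. 2 * inner (a n x) (a n x) + 2 * inner (b n x) (b n x))"
        using s by (rule set_integral_add)
    qed
    also have "\<dots> = 2 * ip \<Omega> (a n) (a n) + 2 * ip \<Omega> (b n) (b n)"
      unfolding ip_def set_integral_add(2)[OF s] by simp
    finally show ?thesis .
  qed
  have "(\<lambda>n. 2 * ip \<Omega> (a n) (a n) + 2 * ip \<Omega> (b n) (b n)) \<longlonglongrightarrow> 2 * 0 + 2 * 0"
    using assms(3,6) unfolding L2_tendsto_def
    by (intro tendsto_intros) (simp_all add: a_def[abs_def] b_def[abs_def])
  then show ?thesis
    unfolding L2_tendsto_def eq
    by (intro tendsto_0_sandwich[OF _ _ le] ip_self_nonneg) simp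
qed

lemma L2_tendsto_vec_nth:
  fixes F :: "nat \<Rightarrow> vec3 \<Rightarrow> 'b::euclidean_space ^ 'n"
  assumes "\<And>n. L2 \<Omega> (F n)" "L2 \<Omega> f" "L2_tendsto \<Omega> F f"
  shows "L2_tendsto \<Omega> (\<lambda>n x. F n x $ i) (\<lambda>x. f x $ i)"
proof -
  have d: "L2 \<Omega> (\<lambda>x. F n x - f x)" for n using assms by (intro L2_diff)
  have "ip \<Omega> (\<lambda>x. F n x $ i - f x $ i) (\<lambda>x. F n x $ i - f x $ i)
      \<le> ip \<Omega> (\<lambda>x. F n x - f x) (\<lambda>x. F n x - f x)" for n
    unfolding ip_vec[OF d d, of n n] vector_minus_component
    by (rule member_le_sum) (auto simp: ip_self_nonneg)
  with assms(3) show ?thesis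
    unfolding L2_tendsto_def
    by (rule tendsto_0_sandwich[OF _ ip_self_nonneg])
qed

text \<open>A sum of nonnegative sequences tends to 0 exactly if both do. This splits convergence in
  the graph norms used for \<open>H1_0\<close> and \<open>H0curl\<close> into convergence of the
  function and of its derivative.\<close>

lemma integral_sum_squares_tendsto_0_iff:
  fixes F :: "nat \<Rightarrow> vec3 \<Rightarrow> 'a::euclidean_space" and G :: "nat \<Rightarrow> vec3 \<Rightarrow> 'b::euclidean_space"
  assumes F: "\<And>n. L2 \<Omega> (F n)" "L2 \<Omega> f" and G: "\<And>n. L2 \<Omega> (G n)" "L2 \<Omega> g"
  shows "((\<lambda>n. LINT x:\<Omega>|lebesgue. (norm (F n x - f x))\<^sup>2 + (norm (G n x - g x))\<^sup>2) \<longlonglongrightarrow> 0) \<longleftrightarrow>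
    L2_tendsto \<Omega> F f \<and> L2_tendsto \<Omega> G g"
proof -
  define a b where "a n = ip \<Omega> (\<lambda>x. F n x - f x) (\<lambda>x. F n x - f x)"
    and "b n = ip \<Omega> (\<lambda>x. G n x - g x) (\<lambda>x. G n x - g x)" for n
  have "(LINT x:\<Omega>|lebesgue. (norm (F n x - f x))\<^sup>2 + (norm (G n x - g x))\<^sup>2) = a n + b n" for n
    unfolding a_def b_def ip_def power2_norm_eq_inner
    by (rule set_integral_add(2)) (intro set_integrable_inner L2_diff F G)+
  moreover have nn: "a n \<ge> 0" "b n \<ge> 0" for n by (simp_all add: a_def b_def ip_self_nonneg)
  moreover have "a \<longlonglongrightarrow> 0 \<and> b \<longlonglongrightarrow> 0" if "(\<lambda>n. a n + b n) \<longlonglongrightarrow> 0"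
    using nn by (auto intro!: tendsto_0_sandwich[OF that])
  moreover have "(\<lambda>n. a n + b n) \<longlonglongrightarrow> 0" if "a \<longlonglongrightarrow> 0" "b \<longlonglongrightarrow> 0"
    using tendsto_add[OF that] by simp
  ultimately show ?thesis
    unfolding L2_tendsto_def a_def[symmetric] b_def[symmetric] by auto
qed

section \<open>Test functions\<close>

lemma smooth_differentiable: "smooth f \<Longrightarrow> f differentiable (at x)"
  unfolding smooth_def by (metis foldr_Nil id_apply)

lemma smooth_pd: "smooth f \<Longrightarrow> smooth (pd i f)"
  unfolding smooth_def
proof (intro allI)
  fix "is" x assume "\<forall>is x. foldr pd is f differentiable at x"
  \<comment> \<open>\<open>foldr\<close> applies the last list entry first, so the innermost
    derivative is appended at the end.\<close>
  then have "foldr pd (is @ [i]) f differentiable at x" by blast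
  then show "foldr pd is (pd i f) differentiable at x" by simp
qed

lemma pd_eqI: "(f has_derivative f') (at x) \<Longrightarrow> pd i f x = f' (axis i 1)"
  unfolding pd_def using frechet_derivative_at by metis

lemma smooth_has_derivative:
  "smooth f \<Longrightarrow> (f has_derivative frechet_derivative f (at x)) (at x)"
  using smooth_differentiable frechet_derivative_works by blast

lemma pd_diff:
  assumes "smooth f" "smooth g"
  shows "pd i (\<lambda>x. f x - g x) = (\<lambda>x. pd i f x - pd i g x)"
proof
  fix x
  show "pd i (\<lambda>x. f x - g x) x = pd i f x - pd i g x"
    using pd_eqI[OF has_derivative_diff[OF smooth_has_derivative[OF assms(1)] smooth_has_derivative[OF assms(2)]]]
    by (simp add: pd_def)
qed

text \<open>Smooth functions form the greatest class of differentiable functions closed under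
  \<open>pd\<close>. To prove smoothness it thus suffices to name a closed class, with no formula
  for iterated derivatives.\<close>

lemma smooth_coinduct:
  assumes "P f" "\<And>f x. P f \<Longrightarrow> f differentiable (at x)" "\<And>f i. P f \<Longrightarrow> P (pd i f)"
  shows "smooth f"
proof -
  have "P (foldr pd is f)" for "is"
    by (induction "is") (use assms in auto)
  then show ?thesis unfolding smooth_def using assms(2) by blast
qed

lemma smooth_diff:
  assumes "smooth f" "smooth g"
  shows "smooth (\<lambda>x. f x - g x)"
proof (rule smooth_coinduct[where P = "\<lambda>h. \<exists>f g. smooth f \<and> smooth g \<and> h = (\<lambda>x. f x - g x)"])
  fix h :: "vec3 \<Rightarrow> 'a" and x i
  assume "\<exists>f g. smooth f \<and> smooth g \<and> h = (\<lambda>x. f x - g x)"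
  then obtain f g where fg: "smooth f" "smooth g" and h: "h = (\<lambda>x. f x - g x)" by blast
  show "h differentiable at x"
    unfolding h using fg by (intro differentiable_diff smooth_differentiable)
  show "\<exists>f g. smooth f \<and> smooth g \<and> pd i h = (\<lambda>x. f x - g x)"
    unfolding h pd_diff[OF fg] using fg smooth_pd by blast
qed (use assms in blast)

lemma smooth_zero: "smooth (\<lambda>_. 0 :: 'b::real_normed_vector)"
proof (rule smooth_coinduct[where P = "\<lambda>h. h = (\<lambda>_. 0)"])
  fix h :: "vec3 \<Rightarrow> 'b" and i assume h: "h = (\<lambda>_. 0)"
  show "pd i h = (\<lambda>_. 0)"
    unfolding h by (rule ext) (rule pd_eqI[OF has_derivative_const])
qed auto

text \<open>Subtracting \<open>b\<close> makes the class of these functions closed under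
  \<open>pd\<close>: the extra term of the product rule is absorbed into the new \<open>b\<close>.
  This is the class needed for \<open>smooth_coinduct\<close>.\<close>

lemma pd_coord_mult:
  fixes a b :: "vec3 \<Rightarrow> real"
  assumes "smooth a" "smooth b"
  shows "pd i (\<lambda>x. x $ k * a x - b x) = (\<lambda>x. x $ k * pd i a x - (pd i b x - (if i = k then a x else 0)))"
proof
  fix x
  have "((\<lambda>x. x $ k * a x - b x) has_derivative
      (\<lambda>h. (x $ k * frechet_derivative a (at x) h + h $ k * a x) - frechet_derivative b (at x) h)) (at x)"
    by (intro has_derivative_diff has_derivative_mult smooth_has_derivative assms
        bounded_linear_imp_has_derivative bounded_linear_vec_nth)
  from pd_eqI[OF this, of i]
  show "pd i (\<lambda>x. x $ k * a x - b x) x = x $ k * pd i a x - (pd i b x - (if i = k then a x else 0))"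
    by (simp add: pd_def axis_def algebra_simps)
qed

lemma smooth_coord_mult:
  fixes a :: "vec3 \<Rightarrow> real"
  assumes "smooth a"
  shows "smooth (\<lambda>x. x $ k * a x)"
proof (rule smooth_coinduct[where P = "\<lambda>h. \<exists>a b. smooth a \<and> smooth b \<and> h = (\<lambda>x. x $ k * a x - b x)"])
  fix h :: "vec3 \<Rightarrow> real" and x i
  assume "\<exists>a b. smooth a \<and> smooth b \<and> h = (\<lambda>x. x $ k * a x - b x)"
  then obtain a b where ab: "smooth a" "smooth b" and h: "h = (\<lambda>x. x $ k * a x - b x)" by blast
  show "h differentiable at x"
    unfolding h using ab
    by (intro differentiable_diff differentiable_mult smooth_differentiable
        linear_imp_differentiable bounded_linear.linear[OF bounded_linear_vec_nth])
  have "smooth (\<lambda>x. pd i b x - (if i = k then a x else 0))"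
    by (cases "i = k") (auto intro!: smooth_diff smooth_pd ab smooth_zero)
  then show "\<exists>a b. smooth a \<and> smooth b \<and> pd i h = (\<lambda>x. x $ k * a x - b x)"
    unfolding h pd_coord_mult[OF ab] using ab smooth_pd by blast
next
  show "\<exists>a' b. smooth a' \<and> smooth b \<and> (\<lambda>x. x $ k * a x) = (\<lambda>x. x $ k * a' x - b x)"
    using assms smooth_zero by (intro exI[of _ a] exI[of _ "\<lambda>_. 0"]) simp
qed

section \<open>Supports of test functions\<close>

lemma compact_closure_if_subset_compact:
  fixes S :: "'a::heine_borel set"
  assumes "compact K" "closure S \<subseteq> K"
  shows "compact (closure S)"
  using bounded_subset[OF compact_imp_bounded[OF assms(1)]] closure_subset[of S] assms(2)
  by (simp add: compact_closure)

lemma test_fun_support_subset: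
  assumes "test_fun \<Omega> f" "smooth g" "{x. g x \<noteq> 0} \<subseteq> closure {x. f x \<noteq> 0}"
  shows "test_fun \<Omega> g"
proof -
  have "closure {x. g x \<noteq> 0} \<subseteq> closure {x. f x \<noteq> 0}"
    using assms(3) by (simp add: closure_minimal)
  moreover have "compact (closure {x. f x \<noteq> 0})" "closure {x. f x \<noteq> 0} \<subseteq> \<Omega>"
    using assms(1) by (auto simp: test_fun_def)
  ultimately show ?thesis
    unfolding test_fun_def using assms(2) compact_closure_if_subset_compact by blast
qed

lemma pd_eq_0_outside_support:
  assumes "x \<notin> closure {x. f x \<noteq> 0}"
  shows "pd i f x = 0"
proof -
  have "((\<lambda>_. 0) has_derivative (\<lambda>_. 0)) (at x)" by (rule has_derivative_const)
  then have "(f has_derivative (\<lambda>_. 0)) (at x)"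
  proof (rule has_derivative_transform_within_open)
    show "open (- closure {x. f x \<noteq> 0})" "x \<in> - closure {x. f x \<noteq> 0}" using assms by auto
    show "0 = f y" if "y \<in> - closure {x. f x \<noteq> 0}" for y
      using that closure_subset[of "{x. f x \<noteq> 0}"] by auto
  qed
  then show ?thesis by (rule pd_eqI)
qed

lemma test_fun_pd:
  assumes f: "test_fun \<Omega> f"
  shows "test_fun \<Omega> (pd i f)"
proof (rule test_fun_support_subset[OF f])
  show "smooth (pd i f)" using f by (simp add: test_fun_def smooth_pd)
  show "{x. pd i f x \<noteq> 0} \<subseteq> closure {x. f x \<noteq> 0}"
    using pd_eq_0_outside_support[of _ f i] by blast
qed

lemma test_fun_coord_mult:
  fixes f :: "vec3 \<Rightarrow> real"
  assumes f: "test_fun \<Omega> f"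
  shows "test_fun \<Omega> (\<lambda>x. x $ k * f x)"
proof (rule test_fun_support_subset[OF f])
  show "smooth (\<lambda>x. x $ k * f x)" using f by (simp add: test_fun_def smooth_coord_mult)
  show "{x. x $ k * f x \<noteq> 0} \<subseteq> closure {x. f x \<noteq> 0}"
    by (rule subset_trans[OF _ closure_subset]) auto
qed

lemma test_fun_diff:
  assumes "test_fun \<Omega> f" "test_fun \<Omega> g"
  shows "test_fun \<Omega> (\<lambda>x. f x - g x)"
proof -
  have "{x. f x - g x \<noteq> 0} \<subseteq> {x. f x \<noteq> 0} \<union> {x. g x \<noteq> 0}" by auto
  then have "closure {x. f x - g x \<noteq> 0} \<subseteq> closure {x. f x \<noteq> 0} \<union> closure {x. g x \<noteq> 0}"
    unfolding closure_Un[symmetric] by (rule closure_mono)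
  moreover have "compact (closure {x. f x \<noteq> 0} \<union> closure {x. g x \<noteq> 0})"
      "closure {x. f x \<noteq> 0} \<union> closure {x. g x \<noteq> 0} \<subseteq> \<Omega>"
    using assms by (auto simp: test_fun_def)
  moreover have "smooth (\<lambda>x. f x - g x)"
    using assms by (auto simp: test_fun_def intro: smooth_diff)
  ultimately show ?thesis
    unfolding test_fun_def using compact_closure_if_subset_compact by blast
qed

section \<open>Square integrability of test functions\<close>

lemma smooth_continuous_on: "smooth f \<Longrightarrow> continuous_on A f"
  by (intro continuous_at_imp_continuous_on ballI differentiable_imp_continuous_within smooth_differentiable)

lemma L2_bounded:
  fixes f :: "vec3 \<Rightarrow> 'b::euclidean_space"
  assumes \<Omega>: "open \<Omega>" "bounded \<Omega>" and f: "f \<in> borel_measurable lebesgue" and K: "\<And>x. x \<in> \<Omega> \<Longrightarrow> norm (f x) \<le> K"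
  shows "L2 \<Omega> f"
proof -
  have [measurable]: "\<Omega> \<in> sets lebesgue" using \<Omega> by auto
  have m: "(\<lambda>x. indicator \<Omega> x *\<^sub>R f x) \<in> borel_measurable lebesgue"
    using f by measurable
  have "integrable lebesgue (\<lambda>x. (norm (indicator \<Omega> x *\<^sub>R f x))\<^sup>2)"
  proof (rule Bochner_Integration.integrable_bound)
    have "\<Omega> \<in> lmeasurable" using \<Omega> by (simp add: lmeasurable_open)
    then show "integrable lebesgue (\<lambda>x. K\<^sup>2 * indicator \<Omega> x :: real)"
      by (intro integrable_mult_right integrable_real_indicator) (auto simp: fmeasurable_def)
    have "(norm (f x))\<^sup>2 \<le> K\<^sup>2" if "x \<in> \<Omega>" for x
      using K[OF that] by (simp add: power_mono)
    then show "AE x in lebesgue. norm ((norm (indicator \<Omega> x *\<^sub>R f x))\<^sup>2) \<le> norm (K\<^sup>2 * indicator \<Omega> x :: real)"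
      by (intro AE_I2) (auto simp: indicator_def)
    show "(\<lambda>x. (norm (indicator \<Omega> x *\<^sub>R f x))\<^sup>2) \<in> borel_measurable lebesgue"
      using m by measurable
  qed
  with m show ?thesis by (simp add: L2_iff)
qed

lemma L2_test_fun:
  fixes f :: "vec3 \<Rightarrow> 'b::euclidean_space"
  assumes \<Omega>: "open \<Omega>" "bounded \<Omega>" and f: "test_fun \<Omega> f"
  shows "L2 \<Omega> f"
proof -
  have c: "continuous_on UNIV f" using f by (auto simp: test_fun_def intro: smooth_continuous_on)
  have "compact (f ` closure {x. f x \<noteq> 0})"
    using f c by (intro compact_continuous_image) (auto simp: test_fun_def intro: continuous_on_subset)
  then have "bounded (f ` closure {x. f x \<noteq> 0})"
    by (rule compact_imp_bounded)
  then obtain K where K: "\<forall>x\<in>closure {x. f x \<noteq> 0}. norm (f x) \<le> K"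
    unfolding bounded_iff ball_simps by (elim exE)
  \<comment> \<open>If the support is empty, \<open>K\<close> may be negative; the maximum also
    covers the points where \<open>f\<close> vanishes.\<close>
  have "norm (f x) \<le> max K 0" for x
  proof (cases "f x = 0")
    case False
    then have "x \<in> closure {x. f x \<noteq> 0}" by (auto intro!: subsetD[OF closure_subset])
    then show ?thesis using K by (simp add: le_max_iff_disj)
  qed simp
  moreover have "f \<in> borel_measurable lebesgue"
    using measurable_completion[of f lborel borel] borel_measurable_continuous_onI[OF c] by simp
  ultimately show ?thesis using \<Omega> by (intro L2_bounded)
qed

lemma L2_cgrad:
  assumes "open \<Omega>" "bounded \<Omega>" "test_fun \<Omega> f"
  shows "L2 \<Omega> (cgrad f)"
  unfolding cgrad_def[abs_def] using assms by (intro L2_vec) (simp add: L2_test_fun test_fun_pd)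

lemma L2_ccurl:
  assumes "open \<Omega>" "bounded \<Omega>" "test_fun \<Omega> f"
  shows "L2 \<Omega> (ccurl f)"
proof (rule L2_vec)
  fix i :: 3
  have "L2 \<Omega> (\<lambda>x. pd j f x $ k - pd l f x $ m)" for j k l m
    using assms by (intro L2_diff L2_vec_nth L2_test_fun test_fun_pd)
  then show "L2 \<Omega> (\<lambda>x. ccurl f x $ i)"
    using exhaust_3[of i] by (auto simp: ccurl_def)
qed

lemma cgrad_diff:
  "smooth f \<Longrightarrow> smooth g \<Longrightarrow> cgrad (\<lambda>x. f x - g x) = (\<lambda>x. cgrad f x - cgrad g x)"
  by (auto simp: cgrad_def vec_eq_iff pd_diff)

lemma ccurl_diff:
  "smooth f \<Longrightarrow> smooth g \<Longrightarrow> ccurl (\<lambda>x. f x - g x) = (\<lambda>x. ccurl f x - ccurl g x)"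
  by (auto simp: ccurl_def vec_eq_iff pd_diff forall_3)

section \<open>The function spaces\<close>

lemma weak_grad_ip:
  assumes "weak_grad \<Omega> q Gq" "test_fun \<Omega> \<phi>"
  shows "ip \<Omega> q (pd i \<phi>) = - ip \<Omega> (\<lambda>x. Gq x $ i) \<phi>"
  using assms by (simp add: weak_grad_def ip_def)

lemma weak_curl_ip:
  assumes "weak_curl \<Omega> B cB" "test_fun \<Omega> \<phi>"
  shows "ip \<Omega> B (ccurl \<phi>) = ip \<Omega> cB \<phi>"
  using assms by (simp add: weak_curl_def ip_def)

text \<open>The integral in the definition can be split because test functions and their gradients
  are square integrable on a bounded open set.\<close>

lemma H1_0_iff:
  assumes "open \<Omega>" "bounded \<Omega>"
  shows "H1_0 \<Omega> q Gq \<longleftrightarrow> H1 \<Omega> q Gq \<and> (\<exists>\<phi>s. (\<forall>n. test_fun \<Omega> (\<phi>s n)) \<and>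
     L2_tendsto \<Omega> \<phi>s q \<and> L2_tendsto \<Omega> (\<lambda>n. cgrad (\<phi>s n)) Gq)"
  unfolding H1_0_def
proof (intro conj_cong refl ex_cong1)
  fix \<phi>s :: "nat \<Rightarrow> vec3 \<Rightarrow> real"
  assume "H1 \<Omega> q Gq" "\<forall>n. test_fun \<Omega> (\<phi>s n)"
  then show "((\<lambda>n. LINT x:\<Omega>|lebesgue. (\<phi>s n x - q x)\<^sup>2 + (norm (cgrad (\<phi>s n) x - Gq x))\<^sup>2) \<longlonglongrightarrow> 0) \<longleftrightarrow>
      L2_tendsto \<Omega> \<phi>s q \<and> L2_tendsto \<Omega> (\<lambda>n. cgrad (\<phi>s n)) Gq"
    using integral_sum_squares_tendsto_0_iff[of \<Omega> \<phi>s q "\<lambda>n. cgrad (\<phi>s n)" Gq] assms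
    by (simp add: L2_test_fun L2_cgrad H1_def)
qed

lemma H0curl_iff:
  assumes "open \<Omega>" "bounded \<Omega>"
  shows "H0curl \<Omega> D cD \<longleftrightarrow> Hcurl \<Omega> D cD \<and> (\<exists>\<phi>s. (\<forall>n. test_fun \<Omega> (\<phi>s n)) \<and>
     L2_tendsto \<Omega> \<phi>s D \<and> L2_tendsto \<Omega> (\<lambda>n. ccurl (\<phi>s n)) cD)"
  unfolding H0curl_def
proof (intro conj_cong refl ex_cong1)
  fix \<phi>s :: "nat \<Rightarrow> vec3 \<Rightarrow> vec3"
  assume "Hcurl \<Omega> D cD" "\<forall>n. test_fun \<Omega> (\<phi>s n)"
  then show "((\<lambda>n. LINT x:\<Omega>|lebesgue. (norm (\<phi>s n x - D x))\<^sup>2 + (norm (ccurl (\<phi>s n) x - cD x))\<^sup>2) \<longlonglongrightarrow> 0) \<longleftrightarrow>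
      L2_tendsto \<Omega> \<phi>s D \<and> L2_tendsto \<Omega> (\<lambda>n. ccurl (\<phi>s n)) cD"
    using integral_sum_squares_tendsto_0_iff[of \<Omega> \<phi>s D "\<lambda>n. ccurl (\<phi>s n)" cD] assms
    by (simp add: L2_test_fun L2_ccurl Hcurl_def)
qed

section \<open>Subtraction in the function spaces\<close>

lemma H1_diff:
  assumes \<Omega>: "open \<Omega>" "bounded \<Omega>" and q: "H1 \<Omega> q Gq" and r: "H1 \<Omega> r Gr"
  shows "H1 \<Omega> (\<lambda>x. q x - r x) (\<lambda>x. Gq x - Gr x)"
proof -
  note L = q[unfolded H1_def] r[unfolded H1_def]
  have "weak_grad \<Omega> (\<lambda>x. q x - r x) (\<lambda>x. Gq x - Gr x)"
    unfolding weak_grad_def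
  proof (intro allI impI)
    fix \<phi> :: "vec3 \<Rightarrow> real" and i assume \<phi>: "test_fun \<Omega> \<phi>"
    have l: "L2 \<Omega> \<phi>" "L2 \<Omega> (pd i \<phi>)" using \<Omega> \<phi> by (auto intro: L2_test_fun test_fun_pd)
    have "ip \<Omega> (\<lambda>x. q x - r x) (pd i \<phi>) = - ip \<Omega> (\<lambda>x. Gq x $ i - Gr x $ i) \<phi>"
      using L l weak_grad_ip[OF _ \<phi>, of q Gq i] weak_grad_ip[OF _ \<phi>, of r Gr i]
      by (simp add: ip_diff_left L2_vec_nth)
    then show "(LINT x:\<Omega>|lebesgue. (q x - r x) * pd i \<phi> x) =
        - (LINT x:\<Omega>|lebesgue. (Gq x - Gr x) $ i * \<phi> x)"
      by (simp add: ip_def)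
  qed
  then show ?thesis using L by (simp add: H1_def L2_diff)
qed

lemma H1_0_diff:
  assumes \<Omega>: "open \<Omega>" "bounded \<Omega>" and q: "H1_0 \<Omega> q Gq" and r: "H1_0 \<Omega> r Gr"
  shows "H1_0 \<Omega> (\<lambda>x. q x - r x) (\<lambda>x. Gq x - Gr x)"
proof -
  obtain \<phi> \<psi> where \<phi>: "H1 \<Omega> q Gq" "\<And>n. test_fun \<Omega> (\<phi> n)" "L2_tendsto \<Omega> \<phi> q" "L2_tendsto \<Omega> (\<lambda>n. cgrad (\<phi> n)) Gq"
    and \<psi>: "H1 \<Omega> r Gr" "\<And>n. test_fun \<Omega> (\<psi> n)" "L2_tendsto \<Omega> \<psi> r" "L2_tendsto \<Omega> (\<lambda>n. cgrad (\<psi> n)) Gr"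
    using q r unfolding H1_0_iff[OF \<Omega>] by blast
  have L: "L2 \<Omega> (\<phi> n)" "L2 \<Omega> (\<psi> n)" "L2 \<Omega> (cgrad (\<phi> n))" "L2 \<Omega> (cgrad (\<psi> n))" for n
    using \<Omega> \<phi>(2) \<psi>(2) by (auto intro: L2_test_fun L2_cgrad)
  have L': "L2 \<Omega> q" "L2 \<Omega> r" "L2 \<Omega> Gq" "L2 \<Omega> Gr" using \<phi>(1) \<psi>(1) by (auto simp: H1_def)
  have "cgrad (\<lambda>x. \<phi> n x - \<psi> n x) = (\<lambda>x. cgrad (\<phi> n) x - cgrad (\<psi> n) x)" for n
    using \<phi>(2) \<psi>(2) by (intro cgrad_diff) (auto simp: test_fun_def)
  then show ?thesis
    unfolding H1_0_iff[OF \<Omega>] using L L' \<phi> \<psi> \<Omega>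
    by (intro conjI H1_diff exI[of _ "\<lambda>n x. \<phi> n x - \<psi> n x"])
       (auto intro!: test_fun_diff L2_tendsto_diff)
qed

lemma H1_0v_diff:
  assumes "open \<Omega>" "bounded \<Omega>" "H1_0v \<Omega> v Dv" "H1_0v \<Omega> w Dw"
  shows "H1_0v \<Omega> (\<lambda>x. v x - w x) (\<lambda>x. Dv x - Dw x)"
  using assms H1_0_diff[OF assms(1,2)] by (simp add: H1_0v_def)

lemma Hcurl_diff:
  assumes \<Omega>: "open \<Omega>" "bounded \<Omega>" and B: "Hcurl \<Omega> B cB" and D: "Hcurl \<Omega> D cD"
  shows "Hcurl \<Omega> (\<lambda>x. B x - D x) (\<lambda>x. cB x - cD x)"
proof -
  note L = B[unfolded Hcurl_def] D[unfolded Hcurl_def]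
  have "weak_curl \<Omega> (\<lambda>x. B x - D x) (\<lambda>x. cB x - cD x)"
    unfolding weak_curl_def ip_def[symmetric]
  proof (intro allI impI)
    fix \<phi> :: "vec3 \<Rightarrow> vec3" assume \<phi>: "test_fun \<Omega> \<phi>"
    have l: "L2 \<Omega> \<phi>" "L2 \<Omega> (ccurl \<phi>)" using \<Omega> \<phi> by (auto intro: L2_test_fun L2_ccurl)
    show "ip \<Omega> (\<lambda>x. B x - D x) (ccurl \<phi>) = ip \<Omega> (\<lambda>x. cB x - cD x) \<phi>"
      using L l weak_curl_ip[OF _ \<phi>, of B cB] weak_curl_ip[OF _ \<phi>, of D cD]
      by (simp add: ip_diff_left)
  qed
  then show ?thesis using L by (simp add: Hcurl_def L2_diff)
qed

lemma H0curl_diff: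
  assumes \<Omega>: "open \<Omega>" "bounded \<Omega>" and B: "H0curl \<Omega> B cB" and D: "H0curl \<Omega> D cD"
  shows "H0curl \<Omega> (\<lambda>x. B x - D x) (\<lambda>x. cB x - cD x)"
proof -
  obtain \<phi> \<psi> where \<phi>: "Hcurl \<Omega> B cB" "\<And>n. test_fun \<Omega> (\<phi> n)" "L2_tendsto \<Omega> \<phi> B" "L2_tendsto \<Omega> (\<lambda>n. ccurl (\<phi> n)) cB"
    and \<psi>: "Hcurl \<Omega> D cD" "\<And>n. test_fun \<Omega> (\<psi> n)" "L2_tendsto \<Omega> \<psi> D" "L2_tendsto \<Omega> (\<lambda>n. ccurl (\<psi> n)) cD"
    using B D unfolding H0curl_iff[OF \<Omega>] by blast
  have L: "L2 \<Omega> (\<phi> n)" "L2 \<Omega> (\<psi> n)" "L2 \<Omega> (ccurl (\<phi> n))" "L2 \<Omega> (ccurl (\<psi> n))" for n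
    using \<Omega> \<phi>(2) \<psi>(2) by (auto intro: L2_test_fun L2_ccurl)
  have L': "L2 \<Omega> B" "L2 \<Omega> D" "L2 \<Omega> cB" "L2 \<Omega> cD" using \<phi>(1) \<psi>(1) by (auto simp: Hcurl_def)
  have "ccurl (\<lambda>x. \<phi> n x - \<psi> n x) = (\<lambda>x. ccurl (\<phi> n) x - ccurl (\<psi> n) x)" for n
    using \<phi>(2) \<psi>(2) by (intro ccurl_diff) (auto simp: test_fun_def)
  then show ?thesis
    unfolding H0curl_iff[OF \<Omega>] using L L' \<phi> \<psi> \<Omega>
    by (intro conjI Hcurl_diff exI[of _ "\<lambda>n x. \<phi> n x - \<psi> n x"])
       (auto intro!: test_fun_diff L2_tendsto_diff)
qed

lemma ip_curl_commute:
  assumes \<Omega>: "open \<Omega>" "bounded \<Omega>" and D: "H0curl \<Omega> D cD" and B: "Hcurl \<Omega> B cB"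
  shows "ip \<Omega> cB D = ip \<Omega> B cD"
proof -
  obtain \<phi> where \<phi>: "Hcurl \<Omega> D cD" "\<And>n. test_fun \<Omega> (\<phi> n)" "L2_tendsto \<Omega> \<phi> D" "L2_tendsto \<Omega> (\<lambda>n. ccurl (\<phi> n)) cD"
    using D unfolding H0curl_iff[OF \<Omega>] by blast
  have L: "L2 \<Omega> B" "L2 \<Omega> cB" "L2 \<Omega> D" "L2 \<Omega> cD" using \<phi>(1) B by (auto simp: Hcurl_def)
  have "(\<lambda>n. ip \<Omega> cB (\<phi> n)) \<longlonglongrightarrow> ip \<Omega> cB D"
    by (rule ip_tendsto[OF L(2) L2_test_fun[OF \<Omega> \<phi>(2)] L(3) \<phi>(3)])
  moreover have "(\<lambda>n. ip \<Omega> B (ccurl (\<phi> n))) \<longlonglongrightarrow> ip \<Omega> B cD"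
    by (rule ip_tendsto[OF L(1) L2_ccurl[OF \<Omega> \<phi>(2)] L(4) \<phi>(4)])
  moreover have "ip \<Omega> B (ccurl (\<phi> n)) = ip \<Omega> cB (\<phi> n)" for n
    using B \<phi>(2) by (intro weak_curl_ip) (auto simp: Hcurl_def)
  ultimately show ?thesis by (simp add: LIMSEQ_unique)
qed

text \<open>The same limit argument for one partial derivative; here \<open>q\<close> carries the
  boundary condition.\<close>

lemma ip_weak_grad:
  assumes \<Omega>: "open \<Omega>" "bounded \<Omega>" and v: "H1 \<Omega> v Gv" and q: "H1_0 \<Omega> q Gq"
  shows "ip \<Omega> v (\<lambda>x. Gq x $ i) = - ip \<Omega> (\<lambda>x. Gv x $ i) q"
proof -
  obtain \<phi> where \<phi>: "H1 \<Omega> q Gq" "\<And>n. test_fun \<Omega> (\<phi> n)" "L2_tendsto \<Omega> \<phi> q" "L2_tendsto \<Omega> (\<lambda>n. cgrad (\<phi> n)) Gq"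
    using q unfolding H1_0_iff[OF \<Omega>] by blast
  have L: "L2 \<Omega> v" "L2 \<Omega> (\<lambda>x. Gv x $ i)" "L2 \<Omega> q" "L2 \<Omega> Gq" "L2 \<Omega> (\<lambda>x. Gq x $ i)"
    using \<phi>(1) v by (auto simp: H1_def intro!: L2_vec_nth)
  have "L2_tendsto \<Omega> (\<lambda>n x. cgrad (\<phi> n) x $ i) (\<lambda>x. Gq x $ i)"
    by (rule L2_tendsto_vec_nth[OF L2_cgrad[OF \<Omega> \<phi>(2)] L(4) \<phi>(4)])
  then have "L2_tendsto \<Omega> (\<lambda>n. pd i (\<phi> n)) (\<lambda>x. Gq x $ i)"
    by (simp add: cgrad_def)
  then have "(\<lambda>n. ip \<Omega> v (pd i (\<phi> n))) \<longlonglongrightarrow> ip \<Omega> v (\<lambda>x. Gq x $ i)"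
    by (rule ip_tendsto[OF L(1) L2_test_fun[OF \<Omega> test_fun_pd[OF \<phi>(2)]] L(5)])
  moreover have "(\<lambda>n. - ip \<Omega> (\<lambda>x. Gv x $ i) (\<phi> n)) \<longlonglongrightarrow> - ip \<Omega> (\<lambda>x. Gv x $ i) q"
    by (rule tendsto_minus[OF ip_tendsto[OF L(2) L2_test_fun[OF \<Omega> \<phi>(2)] L(3) \<phi>(3)]])
  moreover have "ip \<Omega> v (pd i (\<phi> n)) = - ip \<Omega> (\<lambda>x. Gv x $ i) (\<phi> n)" for n
    using v \<phi>(2) by (intro weak_grad_ip) (auto simp: H1_def)
  ultimately show ?thesis by (simp add: LIMSEQ_unique)
qed

lemma H1_0v_L2:
  assumes "H1_0v \<Omega> v Dv"
  shows "L2 \<Omega> v" "L2 \<Omega> Dv"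
  using assms by (auto simp: H1_0v_def H1_0_def H1_def intro: L2_vec)

text \<open>The link between the two poroelastic equations: the pressure equation couples through u
  and grad p, elasticity through div u and p.\<close>

lemma ip_div_grad:
  assumes \<Omega>: "open \<Omega>" "bounded \<Omega>" and v: "H1_0v \<Omega> v Dv" and q: "H1_0 \<Omega> q Gq"
  shows "ip \<Omega> v Gq = - ip \<Omega> (\<lambda>x. mdiv (Dv x)) q"
proof -
  have L: "L2 \<Omega> v" "L2 \<Omega> Dv" "L2 \<Omega> q" "L2 \<Omega> Gq"
    using H1_0v_L2[OF v] q by (auto simp: H1_0_def H1_def)
  have "ip \<Omega> v Gq = (\<Sum>i\<in>UNIV. ip \<Omega> (\<lambda>x. v x $ i) (\<lambda>x. Gq x $ i))"
    using L by (intro ip_vec)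
  also have "\<dots> = (\<Sum>i\<in>UNIV. - ip \<Omega> (\<lambda>x. Dv x $ i $ i) q)"
    using v by (intro sum.cong refl ip_weak_grad[OF \<Omega> _ q]) (auto simp: H1_0v_def H1_0_def)
  also have "\<dots> = - (\<Sum>i\<in>UNIV. ip \<Omega> (\<lambda>x. Dv x $ i $ i) q)"
    by (rule sum_negf)
  also have "(\<Sum>i\<in>UNIV. ip \<Omega> (\<lambda>x. Dv x $ i $ i) q) = ip \<Omega> (\<lambda>x. mdiv (Dv x)) q"
  proof -
    have "set_integrable lebesgue \<Omega> (\<lambda>x. inner (Dv x $ i $ i) (q x))" for i
      using L by (intro set_integrable_inner L2_vec_nth)
    then have "(LINT x|lebesgue. (\<Sum>i\<in>UNIV. indicator \<Omega> x *\<^sub>R inner (Dv x $ i $ i) (q x))) =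
        (\<Sum>i\<in>UNIV. LINT x|lebesgue. indicator \<Omega> x *\<^sub>R inner (Dv x $ i $ i) (q x))"
      unfolding set_integrable_def by (rule Bochner_Integration.integral_sum)
    then show ?thesis
      unfolding ip_def set_lebesgue_integral_def mdiv_def inner_sum_left scaleR_sum_right by simp
  qed
  finally show ?thesis .
qed

section \<open>Vanishing norms and vanishing gradients\<close>

lemma ip_self_eq_0_iff:
  assumes "L2 \<Omega> f"
  shows "ip \<Omega> f f = 0 \<longleftrightarrow> (AE x in lebesgue. x \<in> \<Omega> \<longrightarrow> f x = 0)"
proof -
  have "integrable lebesgue (\<lambda>x. indicator \<Omega> x *\<^sub>R inner (f x) (f x))"
    using set_integrable_inner[OF assms assms] by (simp add: set_integrable_def)
  then have "ip \<Omega> f f = 0 \<longleftrightarrow> (AE x in lebesgue. indicator \<Omega> x *\<^sub>R inner (f x) (f x) = 0)"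
    unfolding ip_def set_lebesgue_integral_def by (intro integral_nonneg_eq_0_iff_AE AE_I2) auto
  also have "\<dots> \<longleftrightarrow> (AE x in lebesgue. x \<in> \<Omega> \<longrightarrow> f x = 0)"
    by (intro AE_cong) (auto simp: indicator_def)
  finally show ?thesis .
qed

lemma ip_AE_0: "(AE x in lebesgue. x \<in> \<Omega> \<longrightarrow> f x = 0) \<Longrightarrow> ip \<Omega> f g = 0"
  unfolding ip_def set_lebesgue_integral_def
  by (rule integral_eq_zero_AE) (auto simp: indicator_def)

text \<open>Testing the weak gradient of \<open>q\<close> with \<open>x\<^sub>1 \<phi>\<^sub>n\<close>, where \<open>\<phi>\<^sub>n \<rightarrow> q\<close> in \<open>H\<^sup>1\<close>, gives \<open>\<parallel>q\<parallel>\<^sup>2 = 0\<close>,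
  which replaces Poincare's inequality.\<close>

lemma H1_0_gradient_zero:
  assumes \<Omega>: "open \<Omega>" "bounded \<Omega>" and q: "H1_0 \<Omega> q Gq"
    and G0: "AE x in lebesgue. x \<in> \<Omega> \<longrightarrow> Gq x = 0"
  shows "AE x in lebesgue. x \<in> \<Omega> \<longrightarrow> q x = 0"
proof -
  obtain \<phi> where \<phi>: "H1 \<Omega> q Gq" "\<And>n. test_fun \<Omega> (\<phi> n)" "L2_tendsto \<Omega> \<phi> q" "L2_tendsto \<Omega> (\<lambda>n. cgrad (\<phi> n)) Gq"
    using q unfolding H1_0_iff[OF \<Omega>] by blast
  have L: "L2 \<Omega> q" "L2 \<Omega> Gq" "L2 \<Omega> (\<lambda>x. Gq x $ 1)"
    using \<phi>(1) by (auto simp: H1_def intro!: L2_vec_nth)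
  obtain R where R: "\<And>x. x \<in> \<Omega> \<Longrightarrow> norm x \<le> R" using \<Omega>(2) unfolding bounded_iff by blast
  \<comment> \<open>The product rule leaves the term \<open>x $ 1 * pd 1 (\<phi> n) x\<close>.
    Moving the coordinate onto \<open>q\<close> gives a fixed function to which
    \<open>ip_tendsto\<close> applies; boundedness of \<Omega> keeps it square integrable.\<close>
  define h where "h x = x $ 1 * q x" for x :: vec3
  have hL: "L2 \<Omega> h"
  proof -
    define Q where "Q x = indicator \<Omega> x *\<^sub>R q x" for x
    have Q: "Q \<in> borel_measurable lebesgue" "integrable lebesgue (\<lambda>x. (norm (Q x))\<^sup>2)"
      using L(1) by (simp_all add: L2_iff Q_def[abs_def])
    have "(\<lambda>x::vec3. x $ 1) \<in> borel_measurable lebesgue"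
      using measurable_completion[of "\<lambda>x::vec3. x $ 1" lborel borel]
        borel_measurable_continuous_onI[OF continuous_on_component[OF continuous_on_id]] by simp
    then have m: "(\<lambda>x. x $ 1 * Q x) \<in> borel_measurable lebesgue"
      using Q(1) by (rule borel_measurable_times)
    have "integrable lebesgue (\<lambda>x. (norm (x $ 1 * Q x))\<^sup>2)"
    proof (rule Bochner_Integration.integrable_bound)
      show "integrable lebesgue (\<lambda>x. R\<^sup>2 * (norm (Q x))\<^sup>2)" using Q(2) by simp
      show "(\<lambda>x. (norm (x $ 1 * Q x))\<^sup>2) \<in> borel_measurable lebesgue" using m by measurable
      have "(x $ 1 * Q x)\<^sup>2 \<le> R\<^sup>2 * (Q x)\<^sup>2" for x
      proof (cases "x \<in> \<Omega>")
        case True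
        then have "\<bar>x $ 1\<bar> \<le> R" using R component_le_norm_cart order_trans by blast
        then have "(x $ 1)\<^sup>2 \<le> R\<^sup>2" using abs_le_square_iff[of "x $ 1" R] by simp
        then show ?thesis by (simp add: power_mult_distrib mult_right_mono)
      qed (simp add: Q_def)
      then show "AE x in lebesgue. norm ((norm (x $ 1 * Q x))\<^sup>2) \<le> norm (R\<^sup>2 * (norm (Q x))\<^sup>2)"
        by (intro AE_I2) simp
    qed
    moreover have "indicator \<Omega> x *\<^sub>R h x = x $ 1 * Q x" for x
      by (simp add: h_def Q_def)
    ultimately show ?thesis unfolding L2_iff using m by simp
  qed
  \<comment> \<open>The left side tends to the squared norm of \<open>q\<close>. The right side
    tends to 0, as \<open>pd 1 (\<phi> n)\<close> tends to a component of the vanishing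
    gradient.\<close>
  have eq: "ip \<Omega> q (\<phi> n) = - ip \<Omega> h (pd 1 (\<phi> n))" for n
  proof -
    have l: "L2 \<Omega> (\<phi> n)" "L2 \<Omega> (pd 1 (\<phi> n))" using \<Omega> \<phi>(2) by (auto intro: L2_test_fun test_fun_pd)
    have "smooth (\<phi> n)" using \<phi>(2) by (simp add: test_fun_def)
    from pd_coord_mult[OF this smooth_zero, of 1 1]
    have p: "pd 1 (\<lambda>x. x $ 1 * \<phi> n x) = (\<lambda>x. x $ 1 * pd 1 (\<phi> n) x + \<phi> n x)"
      by (simp add: pd_eqI[OF has_derivative_const])
    have "ip \<Omega> q (pd 1 (\<lambda>x. x $ 1 * \<phi> n x)) = - ip \<Omega> (\<lambda>x. Gq x $ 1) (\<lambda>x. x $ 1 * \<phi> n x)"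
      using \<phi>(1,2) by (intro weak_grad_ip test_fun_coord_mult) (auto simp: H1_def)
    also have "\<dots> = 0"
      using G0 by (subst ip_AE_0) auto
    finally have "(LINT x:\<Omega>|lebesgue. inner (h x) (pd 1 (\<phi> n) x) + inner (q x) (\<phi> n x)) = 0"
      by (simp add: p ip_def h_def algebra_simps)
    then have "ip \<Omega> h (pd 1 (\<phi> n)) + ip \<Omega> q (\<phi> n) = 0"
      unfolding ip_def set_integral_add(2)[OF set_integrable_inner[OF hL l(2)] set_integrable_inner[OF L(1) l(1)]] .
    then show ?thesis by simp
  qed
  have "L2_tendsto \<Omega> (\<lambda>n x. cgrad (\<phi> n) x $ 1) (\<lambda>x. Gq x $ 1)"
    by (rule L2_tendsto_vec_nth[OF L2_cgrad[OF \<Omega> \<phi>(2)] L(2) \<phi>(4)])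
  then have "L2_tendsto \<Omega> (\<lambda>n. pd 1 (\<phi> n)) (\<lambda>x. Gq x $ 1)"
    by (simp add: cgrad_def)
  then have "(\<lambda>n. ip \<Omega> h (pd 1 (\<phi> n))) \<longlonglongrightarrow> ip \<Omega> h (\<lambda>x. Gq x $ 1)"
    by (rule ip_tendsto[OF hL L2_test_fun[OF \<Omega> test_fun_pd[OF \<phi>(2)]] L(3)])
  moreover have "ip \<Omega> h (\<lambda>x. Gq x $ 1) = 0"
    using G0 by (subst ip_commute, subst ip_AE_0) auto
  moreover have "(\<lambda>n. ip \<Omega> q (\<phi> n)) \<longlonglongrightarrow> ip \<Omega> q q"
    by (rule ip_tendsto[OF L(1) L2_test_fun[OF \<Omega> \<phi>(2)] L(1) \<phi>(3)])
  ultimately have "ip \<Omega> q q = 0"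
    unfolding eq using LIMSEQ_unique tendsto_minus by fastforce
  then show ?thesis using ip_self_eq_0_iff[OF L(1)] by simp
qed

section \<open>Space-time kernels\<close>

text \<open>Vanishing outside the time interval is required at every point and not only almost
  everywhere. Estimates may then insert the indicator of an interval of finite length, which turns
  square integrability into integrability in time.\<close>

definition sqint :: "real \<Rightarrow> (real \<times> vec3 \<Rightarrow> 'b::euclidean_space) \<Rightarrow> bool" where
  "sqint T F \<longleftrightarrow> F \<in> borel_measurable (lborel \<Otimes>\<^sub>M lborel) \<and>
     integrable (lborel \<Otimes>\<^sub>M lborel) (\<lambda>z. (norm (F z))\<^sup>2) \<and> (\<forall>t x. t \<notin> {0<..<T} \<longrightarrow> F (t, x) = 0)"

text \<open>The spatial inner product at two different times. \<Omega> does not occur because the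
  representatives inserted here vanish almost everywhere off it.\<close>

definition ker :: "(real \<times> vec3 \<Rightarrow> 'b::euclidean_space) \<Rightarrow> (real \<times> vec3 \<Rightarrow> 'b) \<Rightarrow> real \<Rightarrow> real \<Rightarrow> real" where
  "ker F G t s = (LINT x|lborel. inner (F (t, x)) (G (s, x)))"

lemma ker_commute: "ker F G t s = ker G F s t"
  by (simp add: ker_def inner_commute)

lemma sqint_measurable [measurable_dest]: "sqint T F \<Longrightarrow> F \<in> borel_measurable (lborel \<Otimes>\<^sub>M lborel)"
  by (simp add: sqint_def)

text \<open>A function of one time and space, extended constantly to the other time in (0,T): by
  Tonelli its integral is only multiplied by the length of the interval.\<close>

lemma sqint_triple_bound:
  fixes f :: "real \<times> vec3 \<Rightarrow> real"
  assumes f: "integrable (lborel \<Otimes>\<^sub>M lborel) f" and nn: "\<And>z. f z \<ge> 0"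
  shows "integrable ((lborel \<Otimes>\<^sub>M lborel) \<Otimes>\<^sub>M lborel) (\<lambda>((t, s), x). f (t, x) * indicator {0<..<T::real} s)" (is ?A)
    and "integrable ((lborel \<Otimes>\<^sub>M lborel) \<Otimes>\<^sub>M lborel) (\<lambda>((t, s), x). f (s, x) * indicator {0<..<T::real} t)" (is ?B)
proof -
  note [measurable] = borel_measurable_integrable[OF f]
  have fin: "(\<integral>\<^sup>+z. ennreal (f z) \<partial>(lborel \<Otimes>\<^sub>M lborel)) < \<infinity>"
    using f nn by (simp add: integrable_iff_bounded)
  have fub: "(\<integral>\<^sup>+z. ennreal (f z) \<partial>(lborel \<Otimes>\<^sub>M lborel)) = (\<integral>\<^sup>+t. \<integral>\<^sup>+x. ennreal (f (t, x)) \<partial>lborel \<partial>lborel)"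
    by (rule lborel.nn_integral_fst[symmetric]) measurable
  have T: "emeasure lborel {0<..<T::real} < \<infinity>"
    by (cases "0 \<le> T") auto
  have "(\<integral>\<^sup>+z. ennreal (case z of ((t, s), x) \<Rightarrow> f (t, x) * indicator {0<..<T::real} s) \<partial>((lborel \<Otimes>\<^sub>M lborel) \<Otimes>\<^sub>M lborel)) =
      (\<integral>\<^sup>+t. \<integral>\<^sup>+s. \<integral>\<^sup>+x. ennreal (f (t, x)) * indicator {0<..<T} s \<partial>lborel \<partial>lborel \<partial>lborel)"
    by (subst lborel.nn_integral_fst[symmetric], measurable, subst lborel.nn_integral_fst[symmetric], measurable)
      (auto intro!: nn_integral_cong simp: indicator_def)
  also have "\<dots> = (\<integral>\<^sup>+t. (\<integral>\<^sup>+x. ennreal (f (t, x)) \<partial>lborel) \<partial>lborel) * emeasure lborel {0<..<T::real}"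
    by (simp add: nn_integral_multc nn_integral_cmult)
  finally show ?A
    using fin T nn unfolding fub by (intro integrableI_bounded) (auto simp: ennreal_mult_less_top split_beta')
  have "(\<integral>\<^sup>+z. ennreal (case z of ((t, s), x) \<Rightarrow> f (s, x) * indicator {0<..<T::real} t) \<partial>((lborel \<Otimes>\<^sub>M lborel) \<Otimes>\<^sub>M lborel)) =
      (\<integral>\<^sup>+t. \<integral>\<^sup>+s. \<integral>\<^sup>+x. ennreal (f (s, x)) * indicator {0<..<T} t \<partial>lborel \<partial>lborel \<partial>lborel)"
    by (subst lborel.nn_integral_fst[symmetric], measurable, subst lborel.nn_integral_fst[symmetric], measurable)
      (auto intro!: nn_integral_cong simp: indicator_def)
  also have "\<dots> = (\<integral>\<^sup>+t. (\<integral>\<^sup>+x. ennreal (f (t, x)) \<partial>lborel) \<partial>lborel) * emeasure lborel {0<..<T::real}"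
    by (simp add: nn_integral_multc nn_integral_cmult)
  finally show ?B
    using fin T nn unfolding fub by (intro integrableI_bounded) (auto simp: ennreal_mult_less_top split_beta')
qed

text \<open>The product is dominated by the two squares, and each square may be cut off in the other
  time since the product vanishes there anyway. This legitimates the Fubini arguments over pairs of
  times.\<close>

lemma integrable_triple:
  assumes F: "sqint T F" and G: "sqint T G"
  shows "integrable ((lborel \<Otimes>\<^sub>M lborel) \<Otimes>\<^sub>M lborel) (\<lambda>((t, s), x). inner (F (t, x)) (G (s, x)))"
proof (rule Bochner_Integration.integrable_bound)
  note [measurable] = sqint_measurable[OF F] sqint_measurable[OF G]
  show "integrable ((lborel \<Otimes>\<^sub>M lborel) \<Otimes>\<^sub>M lborel)
      (\<lambda>z. (\<lambda>((t, s), x). (norm (F (t, x)))\<^sup>2 * indicator {0<..<T} s) z +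
        (\<lambda>((t, s), x). (norm (G (s, x)))\<^sup>2 * indicator {0<..<T} t) z)"
    using F G by (intro Bochner_Integration.integrable_add sqint_triple_bound) (auto simp: sqint_def)
  have "(\<lambda>z. inner (F (fst (fst z), snd z)) (G (snd (fst z), snd z))) \<in> borel_measurable ((lborel \<Otimes>\<^sub>M lborel) \<Otimes>\<^sub>M lborel)"
    by measurable
  then show "(\<lambda>((t, s), x). inner (F (t, x)) (G (s, x))) \<in> borel_measurable ((lborel \<Otimes>\<^sub>M lborel) \<Otimes>\<^sub>M lborel)"
    by (simp add: split_beta')
  have "norm (inner (F (t, x)) (G (s, x))) \<le>
      norm ((norm (F (t, x)))\<^sup>2 * indicator {0<..<T} s + (norm (G (s, x)))\<^sup>2 * indicator {0<..<T} t)" for t s x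
  proof (cases "t \<in> {0<..<T} \<and> s \<in> {0<..<T}")
    case True
    then show ?thesis using inner_le_norm_squares[of "F (t, x)" "G (s, x)"] by simp
  next
    case False
    then have "F (t, x) = 0 \<or> G (s, x) = 0" using F G by (auto simp: sqint_def)
    then show ?thesis by auto
  qed
  then show "AE z in ((lborel \<Otimes>\<^sub>M lborel) \<Otimes>\<^sub>M lborel). norm ((\<lambda>((t, s), x). inner (F (t, x)) (G (s, x))) z)
      \<le> norm ((\<lambda>((t, s), x). (norm (F (t, x)))\<^sup>2 * indicator {0<..<T} s) z +
        (\<lambda>((t, s), x). (norm (G (s, x)))\<^sup>2 * indicator {0<..<T} t) z)"
    by (intro AE_I2) (simp add: split_beta')
qed

section \<open>Fubini for two times and one space variable\<close>

interpretation lborel_triple: pair_sigma_finite "lborel \<Otimes>\<^sub>M lborel :: (real \<times> real) measure" "lborel :: vec3 measure" ..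

lemma integrable_ker:
  assumes "sqint T F" "sqint T G"
  shows "integrable (lborel \<Otimes>\<^sub>M lborel) (\<lambda>(t, s). ker F G t s)"
  using lborel_triple.integrable_fst'[OF integrable_triple[OF assms]] by (simp add: ker_def split_beta')

text \<open>A norm is at most 1 plus its square, and the 1 is needed only on the bounded time
  interval.\<close>

lemma AE_integrable_slice:
  assumes F: "sqint T F"
  shows "AE x in lborel. integrable lborel (\<lambda>t. F (t, x))"
proof -
  note [measurable] = sqint_measurable[OF F]
  have "integrable (lborel \<Otimes>\<^sub>M lborel) (\<lambda>(t, x). (norm (F (t, x)))\<^sup>2)"
    using F by (simp add: sqint_def split_beta')
  from lborel_pair.AE_integrable_snd[OF this] show ?thesis
  proof eventually_elim
    case (elim x)
    show ?case
    proof (rule Bochner_Integration.integrable_bound)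
      show "integrable lborel (\<lambda>t. indicator {0<..<T} t + (norm (F (t, x)))\<^sup>2)"
        using elim by (cases "0 \<le> T") (auto intro!: Bochner_Integration.integrable_add integrable_real_indicator)
      have "norm (F (t, x)) \<le> norm (indicator {0<..<T} t + (norm (F (t, x)))\<^sup>2)" for t
      proof (cases "t \<in> {0<..<T}")
        case True
        have "2 * norm (F (t, x)) \<le> 1 + (norm (F (t, x)))\<^sup>2"
          using sum_squares_bound[of 1 "norm (F (t, x))"] by simp
        then have "norm (F (t, x)) \<le> 1 + (norm (F (t, x)))\<^sup>2"
          using norm_ge_zero[of "F (t, x)"] by linarith
        then show ?thesis using True by simp
      next
        case False
        then show ?thesis using F by (simp add: sqint_def)
      qed
      then show "AE t in lborel. norm (F (t, x)) \<le> norm (indicator {0<..<T} t + (norm (F (t, x)))\<^sup>2)"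
        by simp
    qed measurable
  qed
qed

definition tint :: "real \<Rightarrow> (real \<times> vec3 \<Rightarrow> 'b::euclidean_space) \<Rightarrow> vec3 \<Rightarrow> 'b" where
  "tint r F x = (LINT t|lborel. indicator {0..r} t *\<^sub>R F (t, x))"

lemma tint_measurable:
  assumes "sqint T F"
  shows "tint r F \<in> borel_measurable lborel"
proof -
  note [measurable] = sqint_measurable[OF assms]
  show ?thesis unfolding tint_def by measurable
qed

text \<open>Fubini: with the space variable outermost, the integral over the square of times factors
  into two time integrals. For \<open>F = G\<close> the result is a squared norm, so such kernels
  are positive definite; for \<open>F\<close> and \<open>G\<close> exchanged it is the same number,
  which makes antisymmetric combinations cancel.\<close>

lemma
  assumes F: "sqint T F" and G: "sqint T G"
  shows integrable_inner_tint: "integrable lborel (\<lambda>x. inner (tint r F x) (tint r G x))"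
    and integral_square_ker: "(LINT z|(lborel \<Otimes>\<^sub>M lborel). indicator ({0..r} \<times> {0..r}) z * ker F G (fst z) (snd z)) =
      (LINT x|lborel. inner (tint r F x) (tint r G x))"
proof -
  note [measurable] = sqint_measurable[OF F] sqint_measurable[OF G] tint_measurable[OF F] tint_measurable[OF G]
  define h where "h = (\<lambda>z::real \<times> real. \<lambda>x. indicator ({0..r} \<times> {0..r}) z * inner (F (fst z, x)) (G (snd z, x)))"
  have h: "integrable ((lborel \<Otimes>\<^sub>M lborel) \<Otimes>\<^sub>M lborel) (case_prod h)"
  proof (rule Bochner_Integration.integrable_bound[OF integrable_triple[OF F G]])
    show "case_prod h \<in> borel_measurable ((lborel \<Otimes>\<^sub>M lborel) \<Otimes>\<^sub>M lborel)"
      unfolding h_def by measurable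
  qed (auto simp: h_def indicator_def)
  \<comment> \<open>Only almost every x has integrable time slices, and only there can the time
    integrals be pulled out of the inner product.\<close>
  have eq: "AE x in lborel. (LINT z|(lborel \<Otimes>\<^sub>M lborel). h z x) = inner (tint r F x) (tint r G x)"
    using AE_integrable_slice[OF F] AE_integrable_slice[OF G] lborel_triple.AE_integrable_snd[OF h]
  proof eventually_elim
    case (elim x)
    have G': "integrable lborel (\<lambda>s. indicator {0..r} s *\<^sub>R G (s, x))"
      using elim(2) by (intro integrable_mult_indicator) auto
    have F': "integrable lborel (\<lambda>t. indicator {0..r} t *\<^sub>R F (t, x))"
      using elim(1) by (intro integrable_mult_indicator) auto
    have "(LINT z|(lborel \<Otimes>\<^sub>M lborel). h z x) = (LINT t|lborel. LINT s|lborel. h (t, s) x)"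
      using lborel_pair.integral_fst'[OF elim(3)] by simp
    also have "\<dots> = (LINT t|lborel. inner (indicator {0..r} t *\<^sub>R F (t, x)) (tint r G x))"
    proof (rule Bochner_Integration.integral_cong[OF refl])
      fix t
      have "(LINT s|lborel. h (t, s) x) =
          (LINT s|lborel. inner (indicator {0..r} t *\<^sub>R F (t, x)) (indicator {0..r} s *\<^sub>R G (s, x)))"
        by (intro Bochner_Integration.integral_cong[OF refl]) (auto simp: h_def indicator_def)
      also have "\<dots> = inner (indicator {0..r} t *\<^sub>R F (t, x)) (tint r G x)"
        unfolding tint_def by (rule integral_inner_right) (rule G')
      finally show "(LINT s|lborel. h (t, s) x) = inner (indicator {0..r} t *\<^sub>R F (t, x)) (tint r G x)" .
    qed
    also have "\<dots> = inner (tint r F x) (tint r G x)"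
      unfolding tint_def[of r F] by (rule integral_inner_left) (rule F')
    finally show ?case .
  qed
  have m: "(\<lambda>x. inner (tint r F x) (tint r G x)) \<in> borel_measurable lborel" by measurable
  have i: "integrable lborel (\<lambda>x. LINT z|(lborel \<Otimes>\<^sub>M lborel). h z x)"
    by (rule lborel_triple.integrable_snd[OF h])
  show "integrable lborel (\<lambda>x. inner (tint r F x) (tint r G x))"
    using integrable_cong_AE[OF borel_measurable_integrable[OF i] m eq] i by simp
  have "(LINT z|(lborel \<Otimes>\<^sub>M lborel). indicator ({0..r} \<times> {0..r}) z * ker F G (fst z) (snd z)) =
      (LINT z|(lborel \<Otimes>\<^sub>M lborel). LINT x|lborel. h z x)"
    unfolding ker_def h_def by simp
  also have "\<dots> = (LINT x|lborel. LINT z|(lborel \<Otimes>\<^sub>M lborel). h z x)"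
    by (rule lborel_triple.Fubini_integral[OF h, symmetric])
  also have "\<dots> = (LINT x|lborel. inner (tint r F x) (tint r G x))"
    by (rule integral_cong_AE[OF borel_measurable_integrable[OF i] m eq])
  finally show "(LINT z|(lborel \<Otimes>\<^sub>M lborel). indicator ({0..r} \<times> {0..r}) z * ker F G (fst z) (snd z)) =
      (LINT x|lborel. inner (tint r F x) (tint r G x))" .
qed

lemma AE_square_integrable_slice:
  assumes "sqint T F"
  shows "AE t in lborel. integrable lborel (\<lambda>x. (norm (F (t, x)))\<^sup>2)"
  using lborel_pair.AE_integrable_fst'[of "\<lambda>z. (norm (F z))\<^sup>2"] assms by (simp add: sqint_def)

text \<open>The primitive is inserted in the first factor while s stays fixed, so that an equation
  for \<open>F'\<close> can be integrated in t against a single test function. Square integrability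
  of the slice of \<open>G\<close> at this s justifies exchanging the integrals.\<close>

lemma ker_primitive:
  assumes F: "sqint T F" and F': "sqint T F'" and G: "sqint T G"
    and r: "AE x in lborel. F (r, x) = tint r F' x"
    and s: "integrable lborel (\<lambda>x. (norm (G (s, x)))\<^sup>2)"
  shows "ker F G r s = (LINT t|lborel. indicator {0..r} t * ker F' G t s)"
proof -
  note [measurable] = sqint_measurable[OF F] sqint_measurable[OF F'] sqint_measurable[OF G] tint_measurable[OF F']
  define h where "h t x = indicator {0..r} t * inner (F' (t, x)) (G (s, x))" for t x
  \<comment> \<open>At fixed s this majorant is constant in t on (0,T), hence integrable over
    space-time.\<close>
  have gi: "integrable (lborel \<Otimes>\<^sub>M lborel) (\<lambda>(t, x). indicator {0<..<T} t * (norm (G (s, x)))\<^sup>2)"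
  proof (rule lborel_pair.Fubini_integrable)
    show "integrable lborel (\<lambda>t. LINT x|lborel. norm ((\<lambda>(t, x). indicator {0<..<T} t * (norm (G (s, x)))\<^sup>2) (t, x)))"
      by (cases "0 \<le> T") (auto intro!: integrable_mult_left integrable_real_indicator)
    show "AE t in lborel. integrable lborel (\<lambda>x. (\<lambda>(t, x). indicator {0<..<T} t * (norm (G (s, x)))\<^sup>2) (t, x))"
      using s by simp
  qed measurable
  have h: "integrable (lborel \<Otimes>\<^sub>M lborel) (case_prod h)"
  proof (rule Bochner_Integration.integrable_bound)
    show "integrable (lborel \<Otimes>\<^sub>M lborel) (\<lambda>z. (norm (F' z))\<^sup>2 + (\<lambda>(t, x). indicator {0<..<T} t * (norm (G (s, x)))\<^sup>2) z)"
      using F' gi by (intro Bochner_Integration.integrable_add) (auto simp: sqint_def)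
    show "case_prod h \<in> borel_measurable (lborel \<Otimes>\<^sub>M lborel)" unfolding h_def by measurable
    have "norm (h t x) \<le> (norm (F' (t, x)))\<^sup>2 + indicator {0<..<T} t * (norm (G (s, x)))\<^sup>2" for t x
    proof (cases "t \<in> {0<..<T}")
      case True
      then show ?thesis using inner_le_norm_squares[of "F' (t, x)" "G (s, x)"]
        by (auto simp: h_def indicator_def)
    next
      case False
      then show ?thesis using F' by (simp add: sqint_def h_def)
    qed
    then show "AE z in (lborel \<Otimes>\<^sub>M lborel). norm (case_prod h z) \<le>
        norm ((norm (F' z))\<^sup>2 + (\<lambda>(t, x). indicator {0<..<T} t * (norm (G (s, x)))\<^sup>2) z)"
      by (intro AE_I2) (auto simp: split_beta')
  qed
  have "ker F G r s = (LINT x|lborel. LINT t|lborel. h t x)"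
    unfolding ker_def
  proof (rule integral_cong_AE)
    show "(\<lambda>x. LINT t|lborel. h t x) \<in> borel_measurable lborel"
      using borel_measurable_integrable[OF lborel_pair.integrable_snd[OF h]] .
    show "AE x in lborel. inner (F (r, x)) (G (s, x)) = (LINT t|lborel. h t x)"
      using r AE_integrable_slice[OF F']
    proof eventually_elim
      case (elim x)
      have "integrable lborel (\<lambda>t. indicator {0..r} t *\<^sub>R F' (t, x))"
        using elim(2) by (intro integrable_mult_indicator) auto
      then have "inner (tint r F' x) (G (s, x)) = (LINT t|lborel. inner (indicator {0..r} t *\<^sub>R F' (t, x)) (G (s, x)))"
        unfolding tint_def by (intro integral_inner_left[symmetric])
      then show ?case using elim(1) by (simp add: h_def)
    qed
  qed measurable
  also have "\<dots> = (LINT t|lborel. LINT x|lborel. h t x)"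
    by (rule lborel_pair.Fubini_integral[OF h])
  also have "\<dots> = (LINT t|lborel. indicator {0..r} t * ker F' G t s)"
    by (simp add: h_def ker_def)
  finally show ?thesis .
qed

text \<open>Integrating \<open>rel\<close> over s up to the same r makes the domain of
  \<open>M\<close> a square, where \<open>pos\<close> applies. For \<open>K\<close> this covers only
  the triangle s < r; symmetry of \<open>K\<close> supplies its mirror image.\<close>

lemma symmetric_kernel_energy:
  fixes K M :: "real \<times> real \<Rightarrow> real"
  assumes K: "integrable (lborel \<Otimes>\<^sub>M lborel) K" and M: "integrable (lborel \<Otimes>\<^sub>M lborel) M"
    and sym: "\<And>r s. K (r, s) = K (s, r)"
    and rel: "AE r in lborel. r \<in> {0<..<T} \<longrightarrow> (AE s in lborel. s \<in> {0<..<T} \<longrightarrow>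
        K (r, s) + (LINT t|lborel. indicator {0..r} t * M (t, s)) = 0)"
    and pos: "\<And>r. r \<in> {0<..<T} \<Longrightarrow> 0 \<le> (LINT z|(lborel \<Otimes>\<^sub>M lborel). indicator ({0..r} \<times> {0..r}) z * M z)"
    and \<tau>: "\<tau> \<in> {0<..T}"
  shows "(LINT z|(lborel \<Otimes>\<^sub>M lborel). indicator ({0..\<tau>} \<times> {0..\<tau>}) z * K z) \<le> 0"
proof -
  note [measurable] = borel_measurable_integrable[OF K] borel_measurable_integrable[OF M]
  \<comment> \<open>The end points 0 and T are null sets, and discarding them puts r into the open
    interval on which \<open>rel\<close> speaks.\<close>
  have step: "AE r in lborel. r \<in> {0..\<tau>} \<longrightarrow> (LINT s|lborel. indicator {0..r} s * K (r, s)) \<le> 0"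
    using rel AE_lborel_singleton[of 0] AE_lborel_singleton[of T]
  proof eventually_elim
    case (elim r)
    show ?case
    proof
      assume "r \<in> {0..\<tau>}"
      with elim \<tau> have r: "r \<in> {0<..<T}" by auto
      define m where "m t s = indicator ({0..r} \<times> {0..r}) (t, s) * M (t, s)" for t s
      have m: "integrable (lborel \<Otimes>\<^sub>M lborel) (case_prod m)"
      proof (rule Bochner_Integration.integrable_bound[OF M])
        show "case_prod m \<in> borel_measurable (lborel \<Otimes>\<^sub>M lborel)" unfolding m_def by measurable
      qed (auto simp: m_def indicator_def)
      have mi: "integrable lborel (\<lambda>s. LINT t|lborel. m t s)"
        by (rule lborel_pair.integrable_snd[OF m])
      have "(LINT s|lborel. indicator {0..r} s * K (r, s)) = (LINT s|lborel. - (LINT t|lborel. m t s))"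
      proof (rule integral_cong_AE)
        show "(\<lambda>s. - (LINT t|lborel. m t s)) \<in> borel_measurable lborel"
          using borel_measurable_integrable[OF mi] by measurable
        have "AE s in lborel. s \<in> {0<..<T} \<longrightarrow> K (r, s) + (LINT t|lborel. indicator {0..r} t * M (t, s)) = 0"
          using elim r by blast
        then show "AE s in lborel. indicator {0..r} s * K (r, s) = - (LINT t|lborel. m t s)"
          using AE_lborel_singleton[of 0]
        proof eventually_elim
          case (elim s)
          show ?case
          proof (cases "s \<in> {0..r}")
            case True
            with elim r have "K (r, s) + (LINT t|lborel. indicator {0..r} t * M (t, s)) = 0" by auto
            moreover have "m t s = indicator {0..r} t * M (t, s)" for t
              using True by (auto simp: m_def indicator_def)
            ultimately show ?thesis using True by simp
          next
            case False
            then have "m t s = 0" for t by (auto simp: m_def)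
            then show ?thesis using False by simp
          qed
        qed
      qed measurable
      also have "\<dots> = - (LINT z|(lborel \<Otimes>\<^sub>M lborel). case_prod m z)"
        using lborel_pair.integral_snd[OF m] by simp
      also have "(LINT z|(lborel \<Otimes>\<^sub>M lborel). case_prod m z) =
          (LINT z|(lborel \<Otimes>\<^sub>M lborel). indicator ({0..r} \<times> {0..r}) z * M z)"
        by (simp add: m_def split_beta')
      finally show "(LINT s|lborel. indicator {0..r} s * K (r, s)) \<le> 0"
        using pos[OF r] by simp
    qed
  qed
  \<comment> \<open>\<open>A\<close> contains the diagonal and \<open>B\<close> does not;
    \<open>C\<close> is the mirror image of \<open>B\<close>. Thus \<open>A\<close> and
    \<open>C\<close> partition the square, and the integral over \<open>C\<close> is the one over
    \<open>B\<close>.\<close>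
  define A where "A = {z \<in> space (lborel \<Otimes>\<^sub>M lborel :: (real \<times> real) measure). 0 \<le> snd z \<and> snd z \<le> fst z \<and> fst z \<le> \<tau>}"
  define B where "B = {z \<in> space (lborel \<Otimes>\<^sub>M lborel :: (real \<times> real) measure). 0 \<le> snd z \<and> snd z < fst z \<and> fst z \<le> \<tau>}"
  define C where "C = {z \<in> space (lborel \<Otimes>\<^sub>M lborel :: (real \<times> real) measure). 0 \<le> fst z \<and> fst z < snd z \<and> snd z \<le> \<tau>}"
  have ABC [measurable]: "A \<in> sets (lborel \<Otimes>\<^sub>M lborel)" "B \<in> sets (lborel \<Otimes>\<^sub>M lborel)" "C \<in> sets (lborel \<Otimes>\<^sub>M lborel)"
    unfolding A_def B_def C_def by measurable
  have int: "integrable (lborel \<Otimes>\<^sub>M lborel) (\<lambda>z. indicator S z * K z)" if [measurable]: "S \<in> sets (lborel \<Otimes>\<^sub>M lborel)" for S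
    using integrable_mult_indicator[OF that K] by simp
  \<comment> \<open>One bound serves \<open>A\<close> and \<open>B\<close>: each vertical line meets
    the diagonal in a single point, so membership is prescribed only off the diagonal.\<close>
  have tri: "(LINT z|(lborel \<Otimes>\<^sub>M lborel). indicator S z * K z) \<le> 0"
    if S[measurable]: "S \<in> sets (lborel \<Otimes>\<^sub>M lborel)"
      and eq: "\<And>r s. s \<noteq> r \<Longrightarrow> (r, s) \<in> S \<longleftrightarrow> r \<in> {0..\<tau>} \<and> s \<in> {0..r}" for S
  proof -
    have "(LINT z|(lborel \<Otimes>\<^sub>M lborel). indicator S z * K z) =
        (LINT r|lborel. LINT s|lborel. indicator S (r, s) * K (r, s))"
      using lborel_pair.integral_fst'[OF int[OF S]] by simp
    also have "\<dots> \<le> 0"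
    proof -
      have "AE r in lborel. 0 \<le> - (LINT s|lborel. indicator S (r, s) * K (r, s))"
        using step
      proof eventually_elim
        case (elim r)
        have "(LINT s|lborel. indicator S (r, s) * K (r, s)) =
            (LINT s|lborel. indicator {0..\<tau>} r * (indicator {0..r} s * K (r, s)))"
        proof (rule integral_cong_AE)
          show "AE s in lborel. indicator S (r, s) * K (r, s) = indicator {0..\<tau>} r * (indicator {0..r} s * K (r, s))"
            using AE_lborel_singleton[of r] by eventually_elim (auto simp: indicator_def eq)
        qed measurable
        then show ?case using elim by (simp add: indicator_def)
      qed
      then have "0 \<le> (LINT r|lborel. - (LINT s|lborel. indicator S (r, s) * K (r, s)))"
        by (rule integral_nonneg_AE)
      then show ?thesis by simp
    qed
    finally show ?thesis .
  qed
  have "(LINT z|(lborel \<Otimes>\<^sub>M lborel). indicator C z * K z) = (LINT z|(lborel \<Otimes>\<^sub>M lborel). indicator B z * K z)"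
  proof -
    have "(LINT (r, s)|(lborel \<Otimes>\<^sub>M lborel). (\<lambda>z. indicator C z * K z) (s, r)) = (LINT z|(lborel \<Otimes>\<^sub>M lborel). indicator C z * K z)"
      by (rule lborel_pair.integral_product_swap) measurable
    moreover have "(\<lambda>(r, s). (\<lambda>z. indicator C z * K z) (s, r)) = (\<lambda>z. indicator B z * K z)"
      using sym by (auto simp: B_def C_def indicator_def fun_eq_iff space_pair_measure)
    ultimately show ?thesis by simp
  qed
  moreover have "(LINT z|(lborel \<Otimes>\<^sub>M lborel). indicator A z * K z) \<le> 0"
    by (rule tri[OF ABC(1)]) (auto simp: A_def space_pair_measure)
  moreover have "(LINT z|(lborel \<Otimes>\<^sub>M lborel). indicator B z * K z) \<le> 0"
    by (rule tri[OF ABC(2)]) (auto simp: B_def space_pair_measure)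
  moreover have "(LINT z|(lborel \<Otimes>\<^sub>M lborel). indicator ({0..\<tau>} \<times> {0..\<tau>}) z * K z) =
      (LINT z|(lborel \<Otimes>\<^sub>M lborel). indicator A z * K z + indicator C z * K z)"
    by (intro Bochner_Integration.integral_cong refl) (auto simp: A_def C_def indicator_def space_pair_measure)
  moreover have "\<dots> = (LINT z|(lborel \<Otimes>\<^sub>M lborel). indicator A z * K z) + (LINT z|(lborel \<Otimes>\<^sub>M lborel). indicator C z * K z)"
    by (rule Bochner_Integration.integral_add[OF int[OF ABC(1)] int[OF ABC(3)]])
  ultimately show ?thesis by linarith
qed

text \<open>Each closed half-line is a countable intersection of rational ones. A countable
  generator is needed because the exceptional null set in space depends on the end point.\<close>

lemma borel_eq_atMost_Rats: "borel = sigma UNIV ((\<lambda>q::real. {..q}) ` \<rat>)"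
proof (rule borel_eq_sigmaI1[OF borel_eq_atMost])
  fix X :: "real set" assume "X \<in> range (\<lambda>a. {..a})"
  then obtain a where X: "X = {..a}" by auto
  have "{..a} = (\<Inter>q\<in>\<rat> \<inter> {a<..}. {..q})"
  proof (intro equalityI subsetI INT_I)
    fix x assume "x \<in> (\<Inter>q\<in>\<rat> \<inter> {a<..}. {..q})"
    then have "\<And>q. q \<in> \<rat> \<Longrightarrow> a < q \<Longrightarrow> x \<le> q" by auto
    then show "x \<in> {..a}" using Rats_dense_in_real[of a x] by (auto simp: not_le[symmetric])
  qed auto
  also have "\<dots> \<in> sets (sigma UNIV ((\<lambda>q::real. {..q}) ` \<rat>))"
  proof (rule sets.countable_INT'')
    show "countable (\<rat> \<inter> {a<..})" by (rule countable_subset[OF _ countable_rat]) auto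
  qed (auto intro: sigma_sets_top)
  finally show "X \<in> sets (sigma UNIV ((\<lambda>q::real. {..q}) ` \<rat>))" unfolding X .
qed auto

text \<open>The Borel sets over which the integral vanishes form a Dynkin system containing an
  intersection-stable generator, so they are all Borel sets.\<close>

lemma AE_eq_0_if_integral_atMost_eq_0:
  fixes f :: "real \<Rightarrow> 'b::euclidean_space"
  assumes f: "integrable lborel f" and z: "\<And>q. q \<in> \<rat> \<Longrightarrow> (LINT t:{..q}|lborel. f t) = 0"
  shows "AE t in lborel. f t = 0"
proof (rule sigma_finite_measure.density_zero[OF sigma_finite_lborel f])
  have fS: "set_integrable lborel A f" if "A \<in> sets borel" for A
    using that f unfolding set_integrable_def by (intro integrable_mult_indicator) auto
  have sets: "sets borel = sigma_sets UNIV ((\<lambda>q::real. {..q}) ` \<rat>)"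
    by (subst borel_eq_atMost_Rats) simp
  \<comment> \<open>Complements need the integral over the whole line, which is the limit of
    half-lines with natural end points.\<close>
  have U: "(LINT t|lborel. f t) = 0"
  proof -
    have "(\<lambda>n. LINT t:{..real n}|lborel. f t) \<longlonglongrightarrow> (LINT t:(\<Union>n. {..real n})|lborel. f t)"
      by (rule set_integral_cont_up) (auto simp: incseq_def intro!: fS)
    moreover have "(\<Union>n. {..real n}) = UNIV" using real_arch_simple by auto
    moreover have "(LINT t:{..real n}|lborel. f t) = 0" for n by (rule z) auto
    ultimately show ?thesis
      by (simp add: LIMSEQ_const_iff set_lebesgue_integral_def)
  qed
  have int_stable: "Int_stable ((\<lambda>q::real. {..q}) ` \<rat>)"
    by (auto simp: Int_stable_def min_def)
  have pow: "(\<lambda>q::real. {..q}) ` \<rat> \<subseteq> Pow UNIV" by simp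
  fix A :: "real set" assume "A \<in> sets lborel"
  then have "A \<in> sigma_sets UNIV ((\<lambda>q::real. {..q}) ` \<rat>)" by (simp flip: sets)
  then show "(LINT t:A|lborel. f t) = 0"
  proof (induction rule: sigma_sets_induct_disjoint[OF int_stable pow, consumes 1, case_names basic empty compl union])
    case (basic A)
    then show ?case using z by auto
  next
    case empty
    show ?case by (simp add: set_lebesgue_integral_def)
  next
    case (compl A)
    then have A: "A \<in> sets borel" by (simp add: sets)
    have "(LINT t:UNIV - A|lborel. f t) + (LINT t:A|lborel. f t) = (LINT t:(UNIV - A) \<union> A|lborel. f t)"
      using A by (intro set_integral_Un[symmetric] fS) auto
    also have "(UNIV - A) \<union> A = UNIV" by auto
    finally show ?case using U compl by (simp add: set_lebesgue_integral_def)
  next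
    case (union A)
    then have A: "A i \<in> sets borel" for i by (auto simp: sets)
    have "(LINT t:(\<Union>i. A i)|lborel. f t) = (\<Sum>i. (LINT t:A i|lborel. f t))"
      using A union(1) by (intro lebesgue_integral_countable_add fS) (auto simp: disjoint_family_on_def)
    then show ?case using union by simp
  qed
qed

text \<open>For each r the hypothesis leaves its own null set of x. Over rational end points the
  union of these sets is still null, and at the remaining x the one-dimensional criterion
  applies.\<close>

lemma AE_eq_0_if_tint_eq_0:
  assumes F: "sqint T F" and z: "\<And>r. r \<in> {0<..T} \<Longrightarrow> AE x in lborel. tint r F x = 0"
  shows "AE x in lborel. AE t in lborel. F (t, x) = 0"
proof -
  note [measurable] = sqint_measurable[OF F]
  have F0: "F (t, x) = 0" if "t \<notin> {0<..<T}" for t x using that F by (simp add: sqint_def)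
  have "AE x in lborel. (LINT t:{..r}|lborel. F (t, x)) = 0" for r
  proof (cases "r > 0 \<and> T > 0")
    case True
    \<comment> \<open>As \<open>F\<close> vanishes outside (0,T), the half-line up to r is the
      interval from 0 to \<open>min r T\<close>; this may end at T itself, so \<open>z\<close> has
      to include r = T.\<close>
    have "indicator {..r} t *\<^sub>R F (t, x) = indicator {0..min r T} t *\<^sub>R F (t, x)" for t x
      using F0[of t x] by (auto simp: indicator_def)
    then have "(LINT t:{..r}|lborel. F (t, x)) = tint (min r T) F x" for x
      unfolding set_lebesgue_integral_def tint_def by (rule Bochner_Integration.integral_cong[OF refl])
    then show ?thesis using z[of "min r T"] True by simp
  next
    case False
    then have "indicator {..r} t *\<^sub>R F (t, x) = 0" for t x
      using F0[of t x] by (auto simp: indicator_def)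
    then show ?thesis
      unfolding set_lebesgue_integral_def by (simp only: integral_zero) simp
  qed
  then have "AE x in lborel. \<forall>r\<in>\<rat>. (LINT t:{..r}|lborel. F (t, x)) = 0"
    by (simp add: AE_ball_countable countable_rat)
  then show ?thesis
    using AE_integrable_slice[OF F]
    by eventually_elim (rule AE_eq_0_if_integral_atMost_eq_0, auto)
qed

section \<open>Borel representatives\<close>

text \<open>The preimages under \<open>f\<close> and \<open>g\<close> differ by subsets of a null
  set, which the completed measure contains.\<close>

lemma borel_measurable_lebesgue_AE:
  fixes f g :: "'a::euclidean_space \<Rightarrow> 'b::euclidean_space"
  assumes g: "g \<in> borel_measurable lborel" and eq: "AE x in lborel. f x = g x"
  shows "f \<in> borel_measurable lebesgue"
proof (rule measurableI)
  fix A :: "'b set" assume A: "A \<in> sets borel"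
  show "f -` A \<inter> space lebesgue \<in> sets lebesgue"
  proof (rule completion.in_sets_AE)
    show "g -` A \<inter> space lebesgue \<in> sets lebesgue"
      using measurable_completion[OF g] A by (rule measurable_sets)
    show "AE x in lebesgue. x \<in> g -` A \<inter> space lebesgue \<longleftrightarrow> x \<in> f -` A \<inter> space lebesgue"
      using AE_completion[OF eq] by eventually_elim auto
  qed simp
qed simp

text \<open>Reduces to the real-valued case in each coordinate; finitely many null sets are
  discarded.\<close>

lemma completion_ex_borel_measurable_euclidean:
  fixes g :: "'a \<Rightarrow> 'b::euclidean_space"
  assumes g: "g \<in> borel_measurable (completion M)"
  shows "\<exists>g'\<in>borel_measurable M. AE x in M. g x = g' x"
proof -
  have "\<exists>h\<in>borel_measurable M. AE x in M. inner (g x) b = h x" for b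
    by (intro completion_ex_borel_measurable_real borel_measurable_inner[OF g]) simp
  then obtain h where h: "\<And>b. h b \<in> borel_measurable M" "\<And>b. AE x in M. inner (g x) b = h b x"
    by metis
  have "AE x in M. \<forall>b\<in>Basis. inner (g x) b = h b x"
    using h(2) by (intro AE_finite_allI) auto
  then have "AE x in M. g x = (\<Sum>b\<in>Basis. h b x *\<^sub>R b)"
  proof eventually_elim
    case (elim x)
    have "g x = (\<Sum>b\<in>Basis. inner (g x) b *\<^sub>R b)" by (simp add: euclidean_representation)
    also have "\<dots> = (\<Sum>b\<in>Basis. h b x *\<^sub>R b)" using elim by (intro sum.cong) auto
    finally show ?case .
  qed
  moreover have "(\<lambda>x. \<Sum>b\<in>Basis. h b x *\<^sub>R b) \<in> borel_measurable M"
    using h(1) by measurable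
  ultimately show ?thesis by (intro bexI[of _ "\<lambda>x. \<Sum>b\<in>Basis. h b x *\<^sub>R b"])
qed

lemma integral_lebesgue_AE:
  fixes f g :: "'a::euclidean_space \<Rightarrow> 'b::euclidean_space"
  assumes g: "g \<in> borel_measurable lborel" and eq: "AE x in lborel. f x = g x"
  shows "integral\<^sup>L lebesgue f = integral\<^sup>L lborel g"
    and "integrable lebesgue f \<longleftrightarrow> integrable lborel g"
proof -
  note m = borel_measurable_lebesgue_AE[OF g eq] measurable_completion[OF g] AE_completion[OF eq]
  show "integral\<^sup>L lebesgue f = integral\<^sup>L lborel g"
    using integral_cong_AE[OF m] integral_completion[OF g] by simp
  show "integrable lebesgue f \<longleftrightarrow> integrable lborel g"
    using integrable_cong_AE[OF m] integrable_completion[OF g] by simp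
qed

text \<open>A Borel representative on all of space-time, vanishing off the cylinder. Time slices are taken of
  representatives, since slices of functions measurable for the completed product measure need not be measurable.\<close>

definition rep :: "vec3 set \<Rightarrow> real \<Rightarrow> (real \<Rightarrow> vec3 \<Rightarrow> 'b::euclidean_space) \<Rightarrow> (real \<times> vec3 \<Rightarrow> 'b) \<Rightarrow> bool" where
  "rep \<Omega> T f F \<longleftrightarrow> sqint T F \<and>
     (AE z in (lborel \<Otimes>\<^sub>M lborel). indicator ({0<..<T} \<times> \<Omega>) z *\<^sub>R f (fst z) (snd z) = F z)"

lemma L2T_iff_rep:
  fixes f :: "real \<Rightarrow> vec3 \<Rightarrow> 'b::euclidean_space"
  assumes \<Omega>: "open \<Omega>"
  shows "L2T \<Omega> T f \<longleftrightarrow> (\<exists>F. rep \<Omega> T f F)"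
proof -
  define S where "S = {0<..<T} \<times> \<Omega>"
  define g where "g z = indicator S z *\<^sub>R f (fst z) (snd z)" for z
  have S: "S \<in> sets lborel" using \<Omega> by (auto simp: S_def intro!: borel_open open_Times)
  have "(\<lambda>z. indicator S z *\<^sub>R (norm (f (fst z) (snd z)))\<^sup>2) = (\<lambda>z. (norm (g z))\<^sup>2)"
    by (auto simp: g_def indicator_def)
  then have L: "L2T \<Omega> T f \<longleftrightarrow> g \<in> borel_measurable lebesgue \<and> integrable lebesgue (\<lambda>z. (norm (g z))\<^sup>2)"
    unfolding L2T_def set_borel_measurable_def set_integrable_def S_def[symmetric] g_def[abs_def] by simp
  have R: "rep \<Omega> T f F \<longleftrightarrow> F \<in> borel_measurable lborel \<and> integrable lborel (\<lambda>z. (norm (F z))\<^sup>2) \<and>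
      (\<forall>t x. t \<notin> {0<..<T} \<longrightarrow> F (t, x) = 0) \<and> (AE z in lborel. g z = F z)" for F
    unfolding rep_def sqint_def lborel_prod g_def S_def by auto
  show ?thesis
  proof
    assume "L2T \<Omega> T f"
    then have g: "g \<in> borel_measurable lebesgue" "integrable lebesgue (\<lambda>z. (norm (g z))\<^sup>2)"
      unfolding L by auto
    from completion_ex_borel_measurable_euclidean[OF g(1)]
    obtain h where h: "h \<in> borel_measurable lborel" "AE z in lborel. g z = h z" by blast
    \<comment> \<open>\<open>h\<close> may still be nonzero on a null set off the cylinder; the
      factor restores exact vanishing there.\<close>
    define F where "F z = indicator S z *\<^sub>R h z" for z
    have F: "F \<in> borel_measurable lborel"
      unfolding F_def using S h(1) by measurable
    have eq: "AE z in lborel. g z = F z"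
      using h(2) by eventually_elim (auto simp: F_def g_def indicator_def)
    have "integrable lborel (\<lambda>z. (norm (F z))\<^sup>2)"
      using g(2) by (subst integral_lebesgue_AE(2)[symmetric, of _ "\<lambda>z. (norm (g z))\<^sup>2"])
        (use F eq in auto)
    then have "rep \<Omega> T f F"
      unfolding R using F eq by (auto simp: F_def S_def)
    then show "\<exists>F. rep \<Omega> T f F" by blast
  next
    assume "\<exists>F. rep \<Omega> T f F"
    then obtain F where F: "F \<in> borel_measurable lborel" "integrable lborel (\<lambda>z. (norm (F z))\<^sup>2)"
      and eq: "AE z in lborel. g z = F z" unfolding R by blast
    have "integrable lebesgue (\<lambda>z. (norm (g z))\<^sup>2)"
      using F eq by (subst integral_lebesgue_AE(2)[of "\<lambda>z. (norm (F z))\<^sup>2"]) auto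
    then show "L2T \<Omega> T f"
      unfolding L using borel_measurable_lebesgue_AE[OF F(1) eq] by blast
  qed
qed

lemma sqint_diff:
  assumes F: "sqint T F" and G: "sqint T G"
  shows "sqint T (\<lambda>z. F z - G z)"
proof -
  note [measurable] = sqint_measurable[OF F] sqint_measurable[OF G]
  have "integrable (lborel \<Otimes>\<^sub>M lborel) (\<lambda>z. (norm (F z - G z))\<^sup>2)"
  proof (rule Bochner_Integration.integrable_bound)
    show "integrable (lborel \<Otimes>\<^sub>M lborel) (\<lambda>z. 2 * (norm (F z))\<^sup>2 + 2 * (norm (G z))\<^sup>2)"
      using F G by (simp add: sqint_def)
  qed (use norm_diff_square_le in \<open>auto intro!: AE_I2\<close>)
  then show ?thesis using F G by (simp add: sqint_def)
qed

lemma rep_diff: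
  assumes "rep \<Omega> T f F" "rep \<Omega> T g G"
  shows "rep \<Omega> T (\<lambda>t x. f t x - g t x) (\<lambda>z. F z - G z)"
proof -
  have "AE z in (lborel \<Otimes>\<^sub>M lborel). indicator ({0<..<T} \<times> \<Omega>) z *\<^sub>R f (fst z) (snd z) = F z"
    "AE z in (lborel \<Otimes>\<^sub>M lborel). indicator ({0<..<T} \<times> \<Omega>) z *\<^sub>R g (fst z) (snd z) = G z"
    using assms by (auto simp: rep_def)
  then have "AE z in (lborel \<Otimes>\<^sub>M lborel).
      indicator ({0<..<T} \<times> \<Omega>) z *\<^sub>R (f (fst z) (snd z) - g (fst z) (snd z)) = F z - G z"
    by eventually_elim (simp add: scaleR_diff_right)
  moreover have "sqint T (\<lambda>z. F z - G z)"
    using assms by (intro sqint_diff) (auto simp: rep_def)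
  ultimately show ?thesis unfolding rep_def by blast
qed

lemma L2T_diff:
  assumes "open \<Omega>" "L2T \<Omega> T f" "L2T \<Omega> T g"
  shows "L2T \<Omega> T (\<lambda>t x. f t x - g t x)"
  using assms rep_diff unfolding L2T_iff_rep[OF assms(1)] by blast

lemma rep_mdiv:
  assumes "rep \<Omega> T D F"
  shows "rep \<Omega> T (\<lambda>t x. mdiv (D t x)) (\<lambda>z. mdiv (F z))"
proof -
  interpret m: bounded_linear mdiv by (rule bounded_linear_mdiv)
  note [measurable] = sqint_measurable[OF assms[unfolded rep_def, THEN conjunct1]]
  have [measurable]: "mdiv \<in> borel_measurable borel"
    by (rule borel_measurable_continuous_onI[OF m.continuous_on[OF continuous_on_id]])
  obtain K where K: "\<And>x. norm (mdiv x) \<le> norm x * K" using m.bounded by blast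
  have "integrable (lborel \<Otimes>\<^sub>M lborel) (\<lambda>z. (norm (mdiv (F z)))\<^sup>2)"
  proof (rule Bochner_Integration.integrable_bound)
    show "integrable (lborel \<Otimes>\<^sub>M lborel) (\<lambda>z. K\<^sup>2 * (norm (F z))\<^sup>2)"
      using assms by (simp add: rep_def sqint_def)
    have "(norm (mdiv x))\<^sup>2 \<le> K\<^sup>2 * (norm x)\<^sup>2" for x
      using power_mono[OF K[of x], of 2] by (simp add: power_mult_distrib mult.commute)
    then show "AE z in (lborel \<Otimes>\<^sub>M lborel). norm ((norm (mdiv (F z)))\<^sup>2) \<le> norm (K\<^sup>2 * (norm (F z))\<^sup>2)"
      by (intro AE_I2) simp
  qed measurable
  moreover have "AE z in (lborel \<Otimes>\<^sub>M lborel). indicator ({0<..<T} \<times> \<Omega>) z *\<^sub>R mdiv (D (fst z) (snd z)) = mdiv (F z)"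
    using assms[unfolded rep_def, THEN conjunct2] by eventually_elim (metis m.scaleR)
  moreover have "(\<lambda>z. mdiv (F z)) \<in> borel_measurable (lborel \<Otimes>\<^sub>M lborel)" by measurable
  ultimately show ?thesis using assms m.zero by (simp add: rep_def sqint_def)
qed

section \<open>Null sets in space-time and time integrals of representatives\<close>

text \<open>Space is quantified first here, because a primitive in time is formed at a fixed space
  point. Passing through the image measure under the swap also covers sets that are not
  measurable.\<close>

lemma AE_pair_swap:
  assumes "AE z in (lborel \<Otimes>\<^sub>M lborel :: ('a::euclidean_space \<times> 'b::euclidean_space) measure). P z"
  shows "AE y in lborel. AE x in lborel. P (x, y)"
proof -
  have "AE z in distr (lborel \<Otimes>\<^sub>M lborel) (lborel \<Otimes>\<^sub>M lborel) (\<lambda>(y::'b, x::'a). (x, y)). P z"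
    using assms by (subst (asm) lborel_pair.distr_pair_swap)
  then have "AE z in (lborel \<Otimes>\<^sub>M lborel). P ((\<lambda>(y::'b, x::'a). (x, y)) z)"
    by (intro AE_distrD[OF measurable_pair_swap']) simp
  from lborel_pair.AE_pair[OF this] show ?thesis by simp
qed

lemma AE_pair_snd:
  assumes "AE x in (lborel :: 'b::euclidean_space measure). P x"
  shows "AE z in (lborel \<Otimes>\<^sub>M lborel :: ('a::euclidean_space \<times> 'b) measure). P (snd z)"
proof -
  obtain N where N: "N \<in> null_sets lborel" "{x. \<not> P x} \<subseteq> N"
    using assms by (auto simp: eventually_ae_filter)
  have [measurable]: "N \<in> sets lborel" using N by auto
  have "AE z in (lborel \<Otimes>\<^sub>M lborel :: ('a \<times> 'b) measure). snd z \<notin> N"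
  proof (rule lborel_pair.AE_pair_measure)
    show "{z \<in> space (lborel \<Otimes>\<^sub>M lborel :: ('a \<times> 'b) measure). snd z \<notin> N} \<in> sets (lborel \<Otimes>\<^sub>M lborel)"
      by measurable
    show "AE t in lborel. AE x in lborel. snd (t::'a, x) \<notin> N"
      using AE_not_in[OF N(1)] by simp
  qed
  then show ?thesis by eventually_elim (use N(2) in auto)
qed

text \<open>The null set of x serves all r at once. The upper limit may therefore be the time
  coordinate of the space-time point under consideration, as in \<open>time_prim\<close>.\<close>

lemma rep_tint:
  assumes F: "rep \<Omega> T f F"
  shows "AE x in lborel. \<forall>r<T. set_integrable lebesgue {0..r} (\<lambda>s. indicator \<Omega> x *\<^sub>R f s x) \<and>
    (LINT s:{0..r}|lebesgue. indicator \<Omega> x *\<^sub>R f s x) = tint r F x"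
proof -
  have sq: "sqint T F" using F by (simp add: rep_def)
  note [measurable] = sqint_measurable[OF sq]
  have "AE x in lborel. AE s in lborel. indicator ({0<..<T} \<times> \<Omega>) (s, x) *\<^sub>R f s x = F (s, x)"
    using AE_pair_swap[OF F[unfolded rep_def, THEN conjunct2]] by simp
  then show ?thesis
    using AE_integrable_slice[OF sq]
  proof eventually_elim
    case (elim x)
    show ?case
    proof (intro allI impI)
      fix r assume "r < T"
      \<comment> \<open>At s = 0 the representative vanishes while \<open>f\<close> is arbitrary, so
        this point is discarded; r < T keeps the others inside the cylinder.\<close>
      have eq: "AE s in lborel. indicator {0..r} s *\<^sub>R (indicator \<Omega> x *\<^sub>R f s x) = indicator {0..r} s *\<^sub>R F (s, x)"
        using elim(1) AE_lborel_singleton[of 0]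
        by eventually_elim (use \<open>r < T\<close> in \<open>auto simp: indicator_def split: if_splits\<close>)
      have m: "(\<lambda>s. indicator {0..r} s *\<^sub>R F (s, x)) \<in> borel_measurable lborel" by measurable
      have i: "integrable lborel (\<lambda>s. indicator {0..r} s *\<^sub>R F (s, x))"
        using elim(2) by (intro integrable_mult_indicator) auto
      show "set_integrable lebesgue {0..r} (\<lambda>s. indicator \<Omega> x *\<^sub>R f s x) \<and>
          (LINT s:{0..r}|lebesgue. indicator \<Omega> x *\<^sub>R f s x) = tint r F x"
        using integral_lebesgue_AE[OF m eq] i
        unfolding set_integrable_def set_lebesgue_integral_def tint_def by blast
    qed
  qed
qed

text \<open>\<open>time_prim\<close> does not assert that its integrand is integrable, and integrals
  are subtractive only for integrable functions. The representatives provide integrability at almost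
  every space point.\<close>

lemma time_prim_diff:
  assumes \<Omega>: "open \<Omega>" and f: "time_prim \<Omega> T f f0 f'" "L2T \<Omega> T f'" and g: "time_prim \<Omega> T g f0 g'" "L2T \<Omega> T g'"
  shows "time_prim \<Omega> T (\<lambda>t x. f t x - g t x) (\<lambda>_. 0) (\<lambda>t x. f' t x - g' t x)"
proof -
  obtain F' G' where F: "rep \<Omega> T f' F'" and G: "rep \<Omega> T g' G'"
    using f(2) g(2) L2T_iff_rep[OF \<Omega>] by blast
  note ae = AE_pair_snd[OF rep_tint[OF F], where ?'a = real] AE_pair_snd[OF rep_tint[OF G], where ?'a = real]
  show ?thesis
    using f(1) g(1) ae[unfolded lborel_prod, THEN AE_completion] unfolding time_prim_def
  proof eventually_elim
    case (elim z)
    show ?case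
    proof
      assume z: "z \<in> {0<..<T} \<times> \<Omega>"
      then have "fst z < T" "indicator \<Omega> (snd z) = (1::real)" by auto
      with elim(3,4) have s: "set_integrable lebesgue {0..fst z} (\<lambda>s. f' s (snd z))"
        "set_integrable lebesgue {0..fst z} (\<lambda>s. g' s (snd z))" by auto
      show "f (fst z) (snd z) - g (fst z) (snd z) =
          0 + (LINT s:{0..fst z}|lebesgue. f' s (snd z) - g' s (snd z))"
        using elim(1,2) z by (simp add: set_integral_diff(2)[OF s])
    qed
  qed
qed

text \<open>Brings the initial condition into the form required by \<open>ker_primitive\<close>. Off
  \<Omega> both sides vanish, so the relation holds on the whole space.\<close>

lemma rep_primitive:
  assumes f: "time_prim \<Omega> T f (\<lambda>_. 0) f'" and F: "rep \<Omega> T f F" and F': "rep \<Omega> T f' F'"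
  shows "AE r in lborel. r \<in> {0<..<T} \<longrightarrow> (AE x in lborel. F (r, x) = tint r F' x)"
proof -
  have "AE z in (lborel \<Otimes>\<^sub>M lborel). z \<in> {0<..<T} \<times> \<Omega> \<longrightarrow>
      f (fst z) (snd z) = 0 + (LINT s:{0..fst z}|lebesgue. f' s (snd z))"
    using f unfolding time_prim_def lborel_prod AE_completion_iff .
  then have "AE z in (lborel \<Otimes>\<^sub>M lborel). fst z \<in> {0<..<T} \<longrightarrow> F z = tint (fst z) F' (snd z)"
    using F[unfolded rep_def, THEN conjunct2] AE_pair_snd[OF rep_tint[OF F'], where ?'a = real]
  proof eventually_elim
    case (elim z)
    show ?case
    proof
      assume z: "fst z \<in> {0<..<T}"
      then have t: "tint (fst z) F' (snd z) = (LINT s:{0..fst z}|lebesgue. indicator \<Omega> (snd z) *\<^sub>R f' s (snd z))"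
        using elim(3) by auto
      show "F z = tint (fst z) F' (snd z)"
      proof (cases "snd z \<in> \<Omega>")
        case True
        then have "z \<in> {0<..<T} \<times> \<Omega>" using z by (simp add: mem_Times_iff)
        then show ?thesis using elim(1,2) True t by simp
      next
        case False
        then have "z \<notin> {0<..<T} \<times> \<Omega>" by (simp add: mem_Times_iff)
        then show ?thesis using elim(2) False t by simp
      qed
    qed
  qed
  from lborel_pair.AE_pair[OF this] show ?thesis
    by eventually_elim auto
qed

text \<open>Compares a function of space alone with a representative frozen at one time, which is
  how statements about \<open>f t\<close> for a fixed t are transferred.\<close>

definition slice :: "vec3 set \<Rightarrow> (vec3 \<Rightarrow> 'b::euclidean_space) \<Rightarrow> (real \<times> vec3 \<Rightarrow> 'b) \<Rightarrow> real \<Rightarrow> bool" where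
  "slice \<Omega> h F t \<longleftrightarrow> (AE x in lborel. indicator \<Omega> x *\<^sub>R h x = F (t, x))"

lemma rep_slice:
  assumes "rep \<Omega> T f F"
  shows "AE t in lborel. t \<in> {0<..<T} \<longrightarrow> slice \<Omega> (f t) F t"
  using lborel_pair.AE_pair[OF assms[unfolded rep_def, THEN conjunct2]]
proof eventually_elim
  case (elim t)
  then show ?case by (auto simp: slice_def indicator_times)
qed

lemma L2_slice:
  assumes F: "sqint T F" and h: "slice \<Omega> h F t" and i: "integrable lborel (\<lambda>x. (norm (F (t, x)))\<^sup>2)"
  shows "L2 \<Omega> h"
proof -
  note [measurable] = sqint_measurable[OF F]
  have m: "(\<lambda>x. F (t, x)) \<in> borel_measurable lborel" by measurable
  have eq: "AE x in lborel. indicator \<Omega> x *\<^sub>R h x = F (t, x)" using h by (simp add: slice_def)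
  have "AE x in lborel. (norm (indicator \<Omega> x *\<^sub>R h x))\<^sup>2 = (norm (F (t, x)))\<^sup>2"
    using eq by eventually_elim simp
  from integral_lebesgue_AE(2)[OF _ this] have "integrable lebesgue (\<lambda>x. (norm (indicator \<Omega> x *\<^sub>R h x))\<^sup>2)"
    using i by simp
  then show ?thesis
    using borel_measurable_lebesgue_AE[OF m eq] by (simp only: L2_iff)
qed

lemma L2T_AE_L2:
  assumes "open \<Omega>" "L2T \<Omega> T f"
  shows "AE t in lborel. t \<in> {0<..<T} \<longrightarrow> L2 \<Omega> (f t)"
proof -
  obtain F where F: "rep \<Omega> T f F" using assms L2T_iff_rep by blast
  then have sq: "sqint T F" by (simp add: rep_def)
  show ?thesis
    using rep_slice[OF F] AE_square_integrable_slice[OF sq]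
    by eventually_elim (use L2_slice[OF sq] in blast)
qed

text \<open>The dictionary that turns the variational equations, written with \<open>ip\<close>,
  into identities between kernels.\<close>

lemma ip_slice:
  assumes F: "sqint T F" and h: "slice \<Omega> h F t" and G: "sqint T G" and k: "slice \<Omega> k G s"
  shows "ip \<Omega> h k = ker F G t s"
proof -
  note [measurable] = sqint_measurable[OF F] sqint_measurable[OF G]
  have m: "(\<lambda>x. inner (F (t, x)) (G (s, x))) \<in> borel_measurable lborel" by measurable
  have eq: "AE x in lborel. indicator \<Omega> x *\<^sub>R inner (h x) (k x) = inner (F (t, x)) (G (s, x))"
    using h[unfolded slice_def] k[unfolded slice_def]
  proof eventually_elim
    case (elim x)
    then show ?case by (simp add: elim[symmetric] indicator_def)
  qed
  show ?thesis
    unfolding ip_def ker_def set_lebesgue_integral_def by (rule integral_lebesgue_AE(1)[OF m eq])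
qed

section \<open>Uniqueness\<close>

lemma ip_zero_left: "ip \<Omega> (\<lambda>_. 0) f = 0"
  by (simp add: ip_def)

text \<open>The equations are linear, but \<open>ip\<close> is additive only on square-integrable
  functions, so membership of every field at almost every time is collected first.\<close>

lemma weak_solution_diff:
  assumes \<Omega>: "open \<Omega>" "bounded \<Omega>"
    and s1: "weak_solution \<Omega> T eps sig mu L lam G alpha c0 kappa j g E0 H0 u0 p0 E1 Ha u1 p1"
    and s2: "weak_solution \<Omega> T eps sig mu L lam G alpha c0 kappa j g E0 H0 u0 p0 E2 Hb u2 p2"
  shows "weak_solution \<Omega> T eps sig mu L lam G alpha c0 kappa (\<lambda>_ _. 0) (\<lambda>_ _. 0)
    (\<lambda>_. 0) (\<lambda>_. 0) (\<lambda>_. 0) (\<lambda>_. 0)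
    (\<lambda>t x. E1 t x - E2 t x) (\<lambda>t x. Ha t x - Hb t x) (\<lambda>t x. u1 t x - u2 t x) (\<lambda>t x. p1 t x - p2 t x)"
proof -
  from s1 obtain E1t H1t u1t p1t cE1 cH1 Du1 Gp1 where
    L1: "L2T \<Omega> T E1" "L2T \<Omega> T Ha" "L2T \<Omega> T u1" "L2T \<Omega> T p1"
      "L2T \<Omega> T cE1" "L2T \<Omega> T cH1" "L2T \<Omega> T Du1" "L2T \<Omega> T Gp1"
      "L2T \<Omega> T E1t" "L2T \<Omega> T H1t" "L2T \<Omega> T u1t" "L2T \<Omega> T p1t"
    and sp1: "AE t in lebesgue. t \<in> {0<..<T} \<longrightarrow>
         H0curl \<Omega> (E1 t) (cE1 t) \<and> Hcurl \<Omega> (Ha t) (cH1 t) \<and>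
         H1_0v \<Omega> (u1 t) (Du1 t) \<and> H1_0 \<Omega> (p1 t) (Gp1 t)"
    and tp1: "time_prim \<Omega> T E1 E0 E1t" "time_prim \<Omega> T Ha H0 H1t" "time_prim \<Omega> T u1 u0 u1t" "time_prim \<Omega> T p1 p0 p1t"
    and eq1: "AE t in lebesgue. t \<in> {0<..<T} \<longrightarrow>
         (\<forall>D cD. H0curl \<Omega> D cD \<longrightarrow>
            eps * ip \<Omega> (E1t t) D + sig * ip \<Omega> (E1 t) D - ip \<Omega> (cH1 t) D - L * ip \<Omega> (Gp1 t) D
              = ip \<Omega> (j t) D) \<and>
         (\<forall>B cB. Hcurl \<Omega> B cB \<longrightarrow>
            mu * ip \<Omega> (H1t t) B + ip \<Omega> (cE1 t) B = 0) \<and>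
         (\<forall>v Dv. H1_0v \<Omega> v Dv \<longrightarrow>
            lam * ip \<Omega> (\<lambda>x. mdiv (Du1 t x)) (\<lambda>x. mdiv (Dv x)) + G * ip \<Omega> (Du1 t) Dv
              - alpha * ip \<Omega> (p1 t) (\<lambda>x. mdiv (Dv x)) = 0) \<and>
         (\<forall>q Gq. H1_0 \<Omega> q Gq \<longrightarrow>
            c0 * ip \<Omega> (p1t t) q - alpha * ip \<Omega> (u1t t) Gq + kappa * ip \<Omega> (Gp1 t) Gq
              - L * ip \<Omega> (E1 t) Gq = ip \<Omega> (g t) q)"
    unfolding weak_solution_def by (elim exE conjE) (rule that; assumption)
  from s2 obtain E2t H2t u2t p2t cE2 cH2 Du2 Gp2 where
    L2: "L2T \<Omega> T E2" "L2T \<Omega> T Hb" "L2T \<Omega> T u2" "L2T \<Omega> T p2"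
      "L2T \<Omega> T cE2" "L2T \<Omega> T cH2" "L2T \<Omega> T Du2" "L2T \<Omega> T Gp2"
      "L2T \<Omega> T E2t" "L2T \<Omega> T H2t" "L2T \<Omega> T u2t" "L2T \<Omega> T p2t"
    and sp2: "AE t in lebesgue. t \<in> {0<..<T} \<longrightarrow>
         H0curl \<Omega> (E2 t) (cE2 t) \<and> Hcurl \<Omega> (Hb t) (cH2 t) \<and>
         H1_0v \<Omega> (u2 t) (Du2 t) \<and> H1_0 \<Omega> (p2 t) (Gp2 t)"
    and tp2: "time_prim \<Omega> T E2 E0 E2t" "time_prim \<Omega> T Hb H0 H2t" "time_prim \<Omega> T u2 u0 u2t" "time_prim \<Omega> T p2 p0 p2t"
    and eq2: "AE t in lebesgue. t \<in> {0<..<T} \<longrightarrow>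
         (\<forall>D cD. H0curl \<Omega> D cD \<longrightarrow>
            eps * ip \<Omega> (E2t t) D + sig * ip \<Omega> (E2 t) D - ip \<Omega> (cH2 t) D - L * ip \<Omega> (Gp2 t) D
              = ip \<Omega> (j t) D) \<and>
         (\<forall>B cB. Hcurl \<Omega> B cB \<longrightarrow>
            mu * ip \<Omega> (H2t t) B + ip \<Omega> (cE2 t) B = 0) \<and>
         (\<forall>v Dv. H1_0v \<Omega> v Dv \<longrightarrow>
            lam * ip \<Omega> (\<lambda>x. mdiv (Du2 t x)) (\<lambda>x. mdiv (Dv x)) + G * ip \<Omega> (Du2 t) Dv
              - alpha * ip \<Omega> (p2 t) (\<lambda>x. mdiv (Dv x)) = 0) \<and>
         (\<forall>q Gq. H1_0 \<Omega> q Gq \<longrightarrow>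
            c0 * ip \<Omega> (p2t t) q - alpha * ip \<Omega> (u2t t) Gq + kappa * ip \<Omega> (Gp2 t) Gq
              - L * ip \<Omega> (E2 t) Gq = ip \<Omega> (g t) q)"
    unfolding weak_solution_def by (elim exE conjE) (rule that; assumption)
  note ae = L2T_AE_L2[OF \<Omega>(1), THEN AE_completion]
  have sp: "AE t in lebesgue. t \<in> {0<..<T} \<longrightarrow>
      H0curl \<Omega> (\<lambda>x. E1 t x - E2 t x) (\<lambda>x. cE1 t x - cE2 t x) \<and>
      Hcurl \<Omega> (\<lambda>x. Ha t x - Hb t x) (\<lambda>x. cH1 t x - cH2 t x) \<and>
      H1_0v \<Omega> (\<lambda>x. u1 t x - u2 t x) (\<lambda>x. Du1 t x - Du2 t x) \<and>
      H1_0 \<Omega> (\<lambda>x. p1 t x - p2 t x) (\<lambda>x. Gp1 t x - Gp2 t x)"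
    using sp1 sp2
    by eventually_elim (use \<Omega> in \<open>auto intro: H0curl_diff Hcurl_diff H1_0v_diff H1_0_diff\<close>)
  have eq: "AE t in lebesgue. t \<in> {0<..<T} \<longrightarrow>
         (\<forall>D cD. H0curl \<Omega> D cD \<longrightarrow>
            eps * ip \<Omega> (\<lambda>x. E1t t x - E2t t x) D + sig * ip \<Omega> (\<lambda>x. E1 t x - E2 t x) D
              - ip \<Omega> (\<lambda>x. cH1 t x - cH2 t x) D - L * ip \<Omega> (\<lambda>x. Gp1 t x - Gp2 t x) D
              = ip \<Omega> (\<lambda>_. 0) D) \<and>
         (\<forall>B cB. Hcurl \<Omega> B cB \<longrightarrow>
            mu * ip \<Omega> (\<lambda>x. H1t t x - H2t t x) B + ip \<Omega> (\<lambda>x. cE1 t x - cE2 t x) B = 0) \<and>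
         (\<forall>v Dv. H1_0v \<Omega> v Dv \<longrightarrow>
            lam * ip \<Omega> (\<lambda>x. mdiv (Du1 t x - Du2 t x)) (\<lambda>x. mdiv (Dv x)) + G * ip \<Omega> (\<lambda>x. Du1 t x - Du2 t x) Dv
              - alpha * ip \<Omega> (\<lambda>x. p1 t x - p2 t x) (\<lambda>x. mdiv (Dv x)) = 0) \<and>
         (\<forall>q Gq. H1_0 \<Omega> q Gq \<longrightarrow>
            c0 * ip \<Omega> (\<lambda>x. p1t t x - p2t t x) q - alpha * ip \<Omega> (\<lambda>x. u1t t x - u2t t x) Gq
              + kappa * ip \<Omega> (\<lambda>x. Gp1 t x - Gp2 t x) Gq
              - L * ip \<Omega> (\<lambda>x. E1 t x - E2 t x) Gq = ip \<Omega> (\<lambda>_. 0) q)"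
    using eq1 eq2 ae[OF L1(1)] ae[OF L1(4)] ae[OF L1(5)] ae[OF L1(6)] ae[OF L1(7)] ae[OF L1(8)]
      ae[OF L1(9)] ae[OF L1(10)] ae[OF L1(11)] ae[OF L1(12)]
      ae[OF L2(1)] ae[OF L2(4)] ae[OF L2(5)] ae[OF L2(6)] ae[OF L2(7)] ae[OF L2(8)]
      ae[OF L2(9)] ae[OF L2(10)] ae[OF L2(11)] ae[OF L2(12)]
  proof eventually_elim
    case (elim t)
    show ?case
    proof (rule impI)
      assume t: "t \<in> {0<..<T}"
      \<comment> \<open>Positions k and k + 10 hold the same field of the two solutions, in the
        order \<open>E\<close>, \<open>p\<close>, \<open>cE\<close>, \<open>cH\<close>,
        \<open>Du\<close>, \<open>Gp\<close>, \<open>Et\<close>, \<open>Ht\<close>,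
        \<open>ut\<close>, \<open>pt\<close>; these are the fields occurring in the
        equations.\<close>
      note l = elim(3-22)[rule_format, OF t]
      note m = l(5,15)[THEN L2_bounded_linear[OF _ bounded_linear_mdiv]]
      note e1 = elim(1)[rule_format, OF t] and e2 = elim(2)[rule_format, OF t]
      note md = linear_diff[OF bounded_linear.linear[OF bounded_linear_mdiv]]
      have a: "eps * ip \<Omega> (\<lambda>x. E1t t x - E2t t x) D + sig * ip \<Omega> (\<lambda>x. E1 t x - E2 t x) D
              - ip \<Omega> (\<lambda>x. cH1 t x - cH2 t x) D - L * ip \<Omega> (\<lambda>x. Gp1 t x - Gp2 t x) D
              = ip \<Omega> (\<lambda>_. 0) D" if D: "H0curl \<Omega> D cD" for D cD
      proof -
        have d: "L2 \<Omega> D" using D by (simp add: H0curl_def Hcurl_def)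
        show ?thesis
          using e1[THEN conjunct1, rule_format, OF D] e2[THEN conjunct1, rule_format, OF D]
          unfolding ip_zero_left ip_diff_left[OF l(7) l(17) d] ip_diff_left[OF l(1) l(11) d]
            ip_diff_left[OF l(4) l(14) d] ip_diff_left[OF l(6) l(16) d]
          by (simp add: algebra_simps)
      qed
      have b: "mu * ip \<Omega> (\<lambda>x. H1t t x - H2t t x) B + ip \<Omega> (\<lambda>x. cE1 t x - cE2 t x) B = 0"
        if B: "Hcurl \<Omega> B cB" for B cB
      proof -
        have d: "L2 \<Omega> B" using B by (simp add: Hcurl_def)
        show ?thesis
          using e1[THEN conjunct2, THEN conjunct1, rule_format, OF B] e2[THEN conjunct2, THEN conjunct1, rule_format, OF B]
          unfolding ip_diff_left[OF l(8) l(18) d] ip_diff_left[OF l(3) l(13) d]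
          by (simp add: algebra_simps)
      qed
      have c: "lam * ip \<Omega> (\<lambda>x. mdiv (Du1 t x - Du2 t x)) (\<lambda>x. mdiv (Dv x)) + G * ip \<Omega> (\<lambda>x. Du1 t x - Du2 t x) Dv
              - alpha * ip \<Omega> (\<lambda>x. p1 t x - p2 t x) (\<lambda>x. mdiv (Dv x)) = 0"
        if v: "H1_0v \<Omega> v Dv" for v Dv
      proof -
        have d: "L2 \<Omega> Dv" using v by (rule H1_0v_L2)
        note d' = L2_bounded_linear[OF d bounded_linear_mdiv]
        show ?thesis
          using e1[THEN conjunct2, THEN conjunct2, THEN conjunct1, rule_format, OF v]
            e2[THEN conjunct2, THEN conjunct2, THEN conjunct1, rule_format, OF v]
          unfolding md ip_diff_left[OF m(1) m(2) d'] ip_diff_left[OF l(5) l(15) d] ip_diff_left[OF l(2) l(12) d']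
          by (simp add: algebra_simps)
      qed
      have d: "c0 * ip \<Omega> (\<lambda>x. p1t t x - p2t t x) q - alpha * ip \<Omega> (\<lambda>x. u1t t x - u2t t x) Gq
              + kappa * ip \<Omega> (\<lambda>x. Gp1 t x - Gp2 t x) Gq
              - L * ip \<Omega> (\<lambda>x. E1 t x - E2 t x) Gq = ip \<Omega> (\<lambda>_. 0) q"
        if q: "H1_0 \<Omega> q Gq" for q Gq
      proof -
        have d: "L2 \<Omega> q" "L2 \<Omega> Gq" using q by (auto simp: H1_0_def H1_def)
        show ?thesis
          using e1[THEN conjunct2, THEN conjunct2, THEN conjunct2, rule_format, OF q]
            e2[THEN conjunct2, THEN conjunct2, THEN conjunct2, rule_format, OF q]
          unfolding ip_zero_left ip_diff_left[OF l(10) l(20) d(1)] ip_diff_left[OF l(9) l(19) d(2)]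
            ip_diff_left[OF l(6) l(16) d(2)] ip_diff_left[OF l(1) l(11) d(2)]
          by (simp add: algebra_simps)
      qed
      show "(\<forall>D cD. H0curl \<Omega> D cD \<longrightarrow>
            eps * ip \<Omega> (\<lambda>x. E1t t x - E2t t x) D + sig * ip \<Omega> (\<lambda>x. E1 t x - E2 t x) D
              - ip \<Omega> (\<lambda>x. cH1 t x - cH2 t x) D - L * ip \<Omega> (\<lambda>x. Gp1 t x - Gp2 t x) D
              = ip \<Omega> (\<lambda>_. 0) D) \<and>
         (\<forall>B cB. Hcurl \<Omega> B cB \<longrightarrow>
            mu * ip \<Omega> (\<lambda>x. H1t t x - H2t t x) B + ip \<Omega> (\<lambda>x. cE1 t x - cE2 t x) B = 0) \<and>
         (\<forall>v Dv. H1_0v \<Omega> v Dv \<longrightarrow>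
            lam * ip \<Omega> (\<lambda>x. mdiv (Du1 t x - Du2 t x)) (\<lambda>x. mdiv (Dv x)) + G * ip \<Omega> (\<lambda>x. Du1 t x - Du2 t x) Dv
              - alpha * ip \<Omega> (\<lambda>x. p1 t x - p2 t x) (\<lambda>x. mdiv (Dv x)) = 0) \<and>
         (\<forall>q Gq. H1_0 \<Omega> q Gq \<longrightarrow>
            c0 * ip \<Omega> (\<lambda>x. p1t t x - p2t t x) q - alpha * ip \<Omega> (\<lambda>x. u1t t x - u2t t x) Gq
              + kappa * ip \<Omega> (\<lambda>x. Gp1 t x - Gp2 t x) Gq
              - L * ip \<Omega> (\<lambda>x. E1 t x - E2 t x) Gq = ip \<Omega> (\<lambda>_. 0) q)"
        by (intro conjI allI impI) (erule a b c d)+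
    qed
  qed
  note ld = L2T_diff[OF \<Omega>(1)] and td = time_prim_diff[OF \<Omega>(1)]
  show ?thesis
    unfolding weak_solution_def
    by (rule exI[of _ "\<lambda>t x. E1t t x - E2t t x"], rule exI[of _ "\<lambda>t x. H1t t x - H2t t x"],
        rule exI[of _ "\<lambda>t x. u1t t x - u2t t x"], rule exI[of _ "\<lambda>t x. p1t t x - p2t t x"],
        rule exI[of _ "\<lambda>t x. cE1 t x - cE2 t x"], rule exI[of _ "\<lambda>t x. cH1 t x - cH2 t x"],
        rule exI[of _ "\<lambda>t x. Du1 t x - Du2 t x"], rule exI[of _ "\<lambda>t x. Gp1 t x - Gp2 t x"],
        intro conjI ld[OF L1(1) L2(1)] ld[OF L1(2) L2(2)] ld[OF L1(3) L2(3)] ld[OF L1(4) L2(4)]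
          ld[OF L1(5) L2(5)] ld[OF L1(6) L2(6)] ld[OF L1(7) L2(7)] ld[OF L1(8) L2(8)]
          ld[OF L1(9) L2(9)] ld[OF L1(10) L2(10)] ld[OF L1(11) L2(11)] ld[OF L1(12) L2(12)]
          td[OF tp1(1) L1(9) tp2(1) L2(9)] td[OF tp1(2) L1(10) tp2(2) L2(10)]
          td[OF tp1(3) L1(11) tp2(3) L2(11)] td[OF tp1(4) L1(12) tp2(4) L2(12)] sp eq)
qed

lemma rep_eq_0:
  assumes F: "rep \<Omega> T f F" and 0: "AE t in lborel. AE x in lborel. F (t, x) = 0"
  shows "AE z in lebesgue. z \<in> {0<..<T} \<times> \<Omega> \<longrightarrow> f (fst z) (snd z) = 0"
proof -
  have [measurable]: "F \<in> borel_measurable (lborel \<Otimes>\<^sub>M lborel)"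
    using F by (auto simp: rep_def sqint_def)
  have "AE z in (lborel \<Otimes>\<^sub>M lborel). F z = 0"
    by (rule lborel_pair.AE_pair_measure[OF _ 0]) measurable
  then have "AE z in (lborel \<Otimes>\<^sub>M lborel). z \<in> {0<..<T} \<times> \<Omega> \<longrightarrow> f (fst z) (snd z) = 0"
    using F[unfolded rep_def, THEN conjunct2] by eventually_elim (auto simp: indicator_def)
  then show ?thesis unfolding lborel_prod by (rule AE_completion)
qed

text \<open>A vanishing squared norm kills each time integral almost everywhere in space. The
  criterion then gives zero time slices, and joint measurability allows the two variables to be
  exchanged.\<close>

lemma sqint_eq_0_if_integral_tint_eq_0:
  assumes F: "sqint T F"
    and z: "\<And>r. r \<in> {0<..T} \<Longrightarrow> (LINT x|lborel. inner (tint r F x) (tint r F x)) = 0"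
  shows "AE t in lborel. AE x in lborel. F (t, x) = 0"
proof -
  note [measurable] = sqint_measurable[OF F]
  have "AE x in lborel. tint r F x = 0" if "r \<in> {0<..T}" for r
    using z[OF that] by (subst (asm) integral_nonneg_eq_0_iff_AE[OF integrable_inner_tint[OF F F]]) auto
  then have "AE x in lborel. AE t in lborel. F (t, x) = 0"
    by (rule AE_eq_0_if_tint_eq_0[OF F])
  moreover have "{z \<in> space (lborel \<Otimes>\<^sub>M lborel). F (fst z, snd z) = 0} \<in> sets (lborel \<Otimes>\<^sub>M lborel)"
    by measurable
  ultimately show ?thesis using lborel_pair.AE_commute[of "\<lambda>t x. F (t, x) = 0"] by blast
qed

section \<open>Energy balance of the homogeneous problem\<close>

lemma integral_lincomb4:
  fixes a b c d :: "'a \<Rightarrow> real"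
  assumes "integrable M a" "integrable M b" "integrable M c" "integrable M d"
  shows "(LINT x|M. \<alpha> * a x + \<beta> * b x + \<gamma> * c x + \<delta> * d x) =
    \<alpha> * integral\<^sup>L M a + \<beta> * integral\<^sup>L M b + \<gamma> * integral\<^sup>L M c + \<delta> * integral\<^sup>L M d"
  using assms by simp

lemma integral_lincomb6:
  fixes a b c d e f :: "'a \<Rightarrow> real"
  assumes "integrable M a" "integrable M b" "integrable M c" "integrable M d" "integrable M e" "integrable M f"
  shows "(LINT x|M. \<alpha> * a x + \<beta> * b x + \<gamma> * c x + \<delta> * d x + \<epsilon> * e x + \<zeta> * f x) =
    \<alpha> * integral\<^sup>L M a + \<beta> * integral\<^sup>L M b + \<gamma> * integral\<^sup>L M c + \<delta> * integral\<^sup>L M d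
      + \<epsilon> * integral\<^sup>L M e + \<zeta> * integral\<^sup>L M f"
  using assms by simp

text \<open>The bound on \<open>L\<close> makes the electrokinetic coupling at most twice the
  product of \<open>sqrt kappa * norm g\<close> and \<open>sqrt sig * norm e\<close>, which the two
  dissipation terms absorb.\<close>

lemma dissipation_nonneg:
  fixes e g :: "'a::real_inner"
  assumes "L > 0" "sig > 0" "kappa > 0" "L < sqrt (sig * kappa)"
  shows "2 * L * inner g e \<le> sig * inner e e + kappa * inner g g"
proof -
  have "2 * L * inner g e \<le> 2 * L * (norm g * norm e)"
    using assms norm_cauchy_schwarz[of g e] by simp
  also have "\<dots> \<le> 2 * sqrt (sig * kappa) * (norm g * norm e)"
    using assms by (intro mult_right_mono) auto
  also have "\<dots> = 2 * (sqrt kappa * norm g) * (sqrt sig * norm e)"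
    by (simp add: real_sqrt_mult)
  also have "\<dots> \<le> (sqrt kappa * norm g)\<^sup>2 + (sqrt sig * norm e)\<^sup>2"
    by (rule sum_squares_bound)
  also have "\<dots> = sig * inner e e + kappa * inner g g"
    using assms by (simp add: power_mult_distrib power2_norm_eq_inner)
  finally show ?thesis .
qed

lemma homogeneous_solution_eq_0:
  assumes \<Omega>: "open \<Omega>" "bounded \<Omega>"
    and pos: "eps > 0" "sig > 0" "mu > 0" "L > 0" "lam > 0" "G > 0" "c0 > 0" "kappa > 0"
    and L: "L < sqrt (sig * kappa)"
    and sol: "weak_solution \<Omega> T eps sig mu L lam G alpha c0 kappa (\<lambda>_ _. 0) (\<lambda>_ _. 0)
      (\<lambda>_. 0) (\<lambda>_. 0) (\<lambda>_. 0) (\<lambda>_. 0) E H u p"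
  shows "AE z in lebesgue. z \<in> {0<..<T} \<times> \<Omega> \<longrightarrow>
    E (fst z) (snd z) = 0 \<and> H (fst z) (snd z) = 0 \<and> u (fst z) (snd z) = 0 \<and> p (fst z) (snd z) = 0"
proof -
  from sol obtain Et Ht ut pt cE cH Du Gp where
    L2T: "L2T \<Omega> T E" "L2T \<Omega> T H" "L2T \<Omega> T u" "L2T \<Omega> T p"
      "L2T \<Omega> T cE" "L2T \<Omega> T cH" "L2T \<Omega> T Du" "L2T \<Omega> T Gp"
      "L2T \<Omega> T Et" "L2T \<Omega> T Ht" "L2T \<Omega> T ut" "L2T \<Omega> T pt"
    and sp: "AE t in lebesgue. t \<in> {0<..<T} \<longrightarrow>
         H0curl \<Omega> (E t) (cE t) \<and> Hcurl \<Omega> (H t) (cH t) \<and>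
         H1_0v \<Omega> (u t) (Du t) \<and> H1_0 \<Omega> (p t) (Gp t)"
    and tp: "time_prim \<Omega> T E (\<lambda>_. 0) Et" "time_prim \<Omega> T H (\<lambda>_. 0) Ht"
      "time_prim \<Omega> T u (\<lambda>_. 0) ut" "time_prim \<Omega> T p (\<lambda>_. 0) pt"
    and eq: "AE t in lebesgue. t \<in> {0<..<T} \<longrightarrow>
         (\<forall>D cD. H0curl \<Omega> D cD \<longrightarrow>
            eps * ip \<Omega> (Et t) D + sig * ip \<Omega> (E t) D - ip \<Omega> (cH t) D - L * ip \<Omega> (Gp t) D
              = ip \<Omega> (\<lambda>_. 0) D) \<and>
         (\<forall>B cB. Hcurl \<Omega> B cB \<longrightarrow>
            mu * ip \<Omega> (Ht t) B + ip \<Omega> (cE t) B = 0) \<and>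
         (\<forall>v Dv. H1_0v \<Omega> v Dv \<longrightarrow>
            lam * ip \<Omega> (\<lambda>x. mdiv (Du t x)) (\<lambda>x. mdiv (Dv x)) + G * ip \<Omega> (Du t) Dv
              - alpha * ip \<Omega> (p t) (\<lambda>x. mdiv (Dv x)) = 0) \<and>
         (\<forall>q Gq. H1_0 \<Omega> q Gq \<longrightarrow>
            c0 * ip \<Omega> (pt t) q - alpha * ip \<Omega> (ut t) Gq + kappa * ip \<Omega> (Gp t) Gq
              - L * ip \<Omega> (E t) Gq = ip \<Omega> (\<lambda>_. 0) q)"
    unfolding weak_solution_def by (elim exE conjE) (rule that; assumption)
  note rp = L2T_iff_rep[OF \<Omega>(1), THEN iffD1]
  obtain FE FH Fu Fp where F1: "rep \<Omega> T E FE" "rep \<Omega> T H FH" "rep \<Omega> T u Fu" "rep \<Omega> T p Fp"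
    using L2T(1-4)[THEN rp] by (elim exE)
  obtain FcE FcH FD FG where F2: "rep \<Omega> T cE FcE" "rep \<Omega> T cH FcH" "rep \<Omega> T Du FD" "rep \<Omega> T Gp FG"
    using L2T(5-8)[THEN rp] by (elim exE)
  obtain FEt FHt Fut Fpt where F3: "rep \<Omega> T Et FEt" "rep \<Omega> T Ht FHt" "rep \<Omega> T ut Fut" "rep \<Omega> T pt Fpt"
    using L2T(9-12)[THEN rp] by (elim exE)
  define Fd where "Fd z = mdiv (FD z)" for z
  have F4: "rep \<Omega> T (\<lambda>t x. mdiv (Du t x)) Fd"
    unfolding Fd_def[abs_def] by (rule rep_mdiv[OF F2(3)])
  note s1 = F1[unfolded rep_def, THEN conjunct1] and s2 = F2[unfolded rep_def, THEN conjunct1]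
    and s3 = F3[unfolded rep_def, THEN conjunct1] and s4 = F4[unfolded rep_def, THEN conjunct1]
  \<comment> \<open>Everything that holds at almost every single time, gathered so that it can be
    used at two independent times.\<close>
  define P where "P t \<longleftrightarrow>
      (slice \<Omega> (E t) FE t \<and> slice \<Omega> (H t) FH t \<and> slice \<Omega> (u t) Fu t \<and> slice \<Omega> (p t) Fp t) \<and>
      (slice \<Omega> (cE t) FcE t \<and> slice \<Omega> (cH t) FcH t \<and> slice \<Omega> (Du t) FD t \<and> slice \<Omega> (Gp t) FG t) \<and>
      (slice \<Omega> (Et t) FEt t \<and> slice \<Omega> (Ht t) FHt t \<and> slice \<Omega> (ut t) Fut t \<and> slice \<Omega> (pt t) Fpt t) \<and>
      slice \<Omega> (\<lambda>x. mdiv (Du t x)) Fd t \<and>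
      (H0curl \<Omega> (E t) (cE t) \<and> Hcurl \<Omega> (H t) (cH t) \<and> H1_0v \<Omega> (u t) (Du t) \<and> H1_0 \<Omega> (p t) (Gp t)) \<and>
         (\<forall>D cD. H0curl \<Omega> D cD \<longrightarrow>
            eps * ip \<Omega> (Et t) D + sig * ip \<Omega> (E t) D - ip \<Omega> (cH t) D - L * ip \<Omega> (Gp t) D
              = ip \<Omega> (\<lambda>_. 0) D) \<and>
         (\<forall>B cB. Hcurl \<Omega> B cB \<longrightarrow>
            mu * ip \<Omega> (Ht t) B + ip \<Omega> (cE t) B = 0) \<and>
         (\<forall>v Dv. H1_0v \<Omega> v Dv \<longrightarrow>
            lam * ip \<Omega> (\<lambda>x. mdiv (Du t x)) (\<lambda>x. mdiv (Dv x)) + G * ip \<Omega> (Du t) Dv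
              - alpha * ip \<Omega> (p t) (\<lambda>x. mdiv (Dv x)) = 0) \<and>
         (\<forall>q Gq. H1_0 \<Omega> q Gq \<longrightarrow>
            c0 * ip \<Omega> (pt t) q - alpha * ip \<Omega> (ut t) Gq + kappa * ip \<Omega> (Gp t) Gq
              - L * ip \<Omega> (E t) Gq = ip \<Omega> (\<lambda>_. 0) q)" for t
  have P: "AE t in lborel. t \<in> {0<..<T} \<longrightarrow> P t"
    using sp[unfolded AE_completion_iff] eq[unfolded AE_completion_iff] F1[THEN rep_slice] F2[THEN rep_slice] F3[THEN rep_slice] F4[THEN rep_slice]
    unfolding P_def by eventually_elim (rule impI, (drule (1) mp)+, elim conjE, intro conjI, assumption+)
  have kern:
    "eps * ker FEt FE t s + sig * ker FE FE t s + (-1) * ker FH FcE t s + (- L) * ker FG FE t s = 0"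
    "mu * ker FHt FH t s + ker FcE FH t s = 0"
    "lam * ker Fd Fd t s + G * ker FD FD t s = alpha * ker Fp Fd t s"
    "ker Fu FG t s = - ker Fd Fp t s"
    "c0 * ker Fpt Fp t s + (- alpha) * ker Fut FG t s + kappa * ker FG FG t s + (- L) * ker FE FG t s = 0"
    if "P t" "P s" for t s
  proof -
    note t = \<open>P t\<close>[unfolded P_def] and s = \<open>P s\<close>[unfolded P_def]
    have spt: "H0curl \<Omega> (E t) (cE t)" "Hcurl \<Omega> (H t) (cH t)" "H1_0v \<Omega> (u t) (Du t)" "H1_0 \<Omega> (p t) (Gp t)"
      using t by blast+
    have sps: "H0curl \<Omega> (E s) (cE s)" "Hcurl \<Omega> (H s) (cH s)" "H1_0v \<Omega> (u s) (Du s)" "H1_0 \<Omega> (p s) (Gp s)"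
      using s by blast+
    \<comment> \<open>The curl of H(t) is moved onto E(s), which carries the boundary condition. The
      electric equation then contains the mirror image of the curl term in the magnetic one.\<close>
    have eqs:
      "eps * ip \<Omega> (Et t) (E s) + sig * ip \<Omega> (E t) (E s) - ip \<Omega> (H t) (cE s) - L * ip \<Omega> (Gp t) (E s) = 0"
      "mu * ip \<Omega> (Ht t) (H s) + ip \<Omega> (cE t) (H s) = 0"
      "lam * ip \<Omega> (\<lambda>x. mdiv (Du t x)) (\<lambda>x. mdiv (Du s x)) + G * ip \<Omega> (Du t) (Du s)
              - alpha * ip \<Omega> (p t) (\<lambda>x. mdiv (Du s x)) = 0"
      "c0 * ip \<Omega> (pt t) (p s) - alpha * ip \<Omega> (ut t) (Gp s) + kappa * ip \<Omega> (Gp t) (Gp s)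
              - L * ip \<Omega> (E t) (Gp s) = 0"
      using t sps ip_curl_commute[OF \<Omega> sps(1) spt(2)] unfolding ip_zero_left by metis+
    have sl: "slice \<Omega> (E t) FE t" "slice \<Omega> (H t) FH t" "slice \<Omega> (u t) Fu t" "slice \<Omega> (p t) Fp t"
      "slice \<Omega> (cE t) FcE t" "slice \<Omega> (Du t) FD t" "slice \<Omega> (Gp t) FG t"
      "slice \<Omega> (Et t) FEt t" "slice \<Omega> (Ht t) FHt t" "slice \<Omega> (ut t) Fut t" "slice \<Omega> (pt t) Fpt t"
      "slice \<Omega> (\<lambda>x. mdiv (Du t x)) Fd t"
      using t by blast+
    have sr: "slice \<Omega> (E s) FE s" "slice \<Omega> (H s) FH s" "slice \<Omega> (p s) Fp s"
      "slice \<Omega> (cE s) FcE s" "slice \<Omega> (Du s) FD s" "slice \<Omega> (Gp s) FG s"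
      "slice \<Omega> (\<lambda>x. mdiv (Du s x)) Fd s"
      using s by blast+
    show "eps * ker FEt FE t s + sig * ker FE FE t s + (-1) * ker FH FcE t s + (- L) * ker FG FE t s = 0"
      using eqs(1) by (simp add: ip_slice[OF s3(1) sl(8) s1(1) sr(1)] ip_slice[OF s1(1) sl(1) s1(1) sr(1)]
        ip_slice[OF s1(2) sl(2) s2(1) sr(4)] ip_slice[OF s2(4) sl(7) s1(1) sr(1)])
    show "mu * ker FHt FH t s + ker FcE FH t s = 0"
      using eqs(2) by (simp add: ip_slice[OF s3(2) sl(9) s1(2) sr(2)] ip_slice[OF s2(1) sl(5) s1(2) sr(2)])
    show "lam * ker Fd Fd t s + G * ker FD FD t s = alpha * ker Fp Fd t s"
      using eqs(3) by (simp add: ip_slice[OF s4 sl(12) s4 sr(7)] ip_slice[OF s2(3) sl(6) s2(3) sr(5)]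
        ip_slice[OF s1(4) sl(4) s4 sr(7)])
    show "ker Fu FG t s = - ker Fd Fp t s"
      using ip_div_grad[OF \<Omega> spt(3) sps(4)]
      by (simp add: ip_slice[OF s1(3) sl(3) s2(4) sr(6)] ip_slice[OF s4 sl(12) s1(4) sr(3)])
    show "c0 * ker Fpt Fp t s + (- alpha) * ker Fut FG t s + kappa * ker FG FG t s + (- L) * ker FE FG t s = 0"
      using eqs(4) by (simp add: ip_slice[OF s3(4) sl(11) s1(4) sr(3)] ip_slice[OF s3(3) sl(10) s2(4) sr(6)]
        ip_slice[OF s2(4) sl(7) s2(4) sr(6)] ip_slice[OF s1(1) sl(1) s2(4) sr(6)])
  qed
  \<comment> \<open>The sixth summand has coefficient 0 and fits the sum to
    \<open>integral_lincomb6\<close>.\<close>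
  define K where "K z = eps * ker FE FE (fst z) (snd z) + mu * ker FH FH (fst z) (snd z) + c0 * ker Fp Fp (fst z) (snd z)
      + lam * ker Fd Fd (fst z) (snd z) + G * ker FD FD (fst z) (snd z) + 0 * ker FE FE (fst z) (snd z)" for z
  \<comment> \<open>The terms without time derivative: dissipation, the two electrokinetic
    couplings, and the curl terms of the magnetic and of the electric equation with their opposite
    signs.\<close>
  define M where "M z = sig * ker FE FE (fst z) (snd z) + kappa * ker FG FG (fst z) (snd z)
      + (- L) * ker FG FE (fst z) (snd z) + (- L) * ker FE FG (fst z) (snd z)
      + 1 * ker FcE FH (fst z) (snd z) + (-1) * ker FH FcE (fst z) (snd z)" for z
  have K: "integrable (lborel \<Otimes>\<^sub>M lborel) K"
    unfolding K_def[abs_def]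
    by (intro Bochner_Integration.integrable_add integrable_mult_right integrable_ker[unfolded split_beta', of T]) (rule s1 s2 s4)+
  have M: "integrable (lborel \<Otimes>\<^sub>M lborel) M"
    unfolding M_def[abs_def]
    by (intro Bochner_Integration.integrable_add integrable_mult_right integrable_ker[unfolded split_beta', of T]) (rule s1 s2)+
  have rel: "AE r in lborel. r \<in> {0<..<T} \<longrightarrow> (AE s in lborel. s \<in> {0<..<T} \<longrightarrow>
      K (r, s) + (LINT t|lborel. indicator {0..r} t * M (t, s)) = 0)"
    using P rep_primitive[OF tp(1) F1(1) F3(1)] rep_primitive[OF tp(2) F1(2) F3(2)]
      rep_primitive[OF tp(3) F1(3) F3(3)] rep_primitive[OF tp(4) F1(4) F3(4)]
  proof eventually_elim
    case (elim r)
    show ?case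
    proof
      assume r: "r \<in> {0<..<T}"
      note Pr = elim(1)[rule_format, OF r] and prim = elim(2-5)[rule_format, OF r]
      note slc = lborel_pair.AE_integrable_snd[OF integrable_ker]
      \<comment> \<open>Besides \<open>P\<close>, such an s must have square-integrable slices of
        the test fields, for \<open>ker_primitive\<close>, and kernels integrable in t, so that
        integrals of sums split.\<close>
      show "AE s in lborel. s \<in> {0<..<T} \<longrightarrow> K (r, s) + (LINT t|lborel. indicator {0..r} t * M (t, s)) = 0"
        using P s1(1,2,4)[THEN AE_square_integrable_slice] s2(4)[THEN AE_square_integrable_slice]
          slc[OF s3(1) s1(1)] slc[OF s1(1) s1(1)] slc[OF s1(2) s2(1)] slc[OF s2(4) s1(1)]
          slc[OF s3(2) s1(2)] slc[OF s2(1) s1(2)]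
          slc[OF s3(4) s1(4)] slc[OF s3(3) s2(4)] slc[OF s2(4) s2(4)] slc[OF s1(1) s2(4)]
      proof eventually_elim
        case (elim s)
        show ?case
        proof
          assume s: "s \<in> {0<..<T}"
          note Ps = elim(1)[rule_format, OF s]
          define i where "i t = (indicator {0..r} t :: real)" for t :: real
          have I: "integrable lborel (\<lambda>t. i t * h t)" if "integrable lborel h" for h :: "real \<Rightarrow> real"
            using integrable_mult_indicator[of "{0..r}" lborel h] that by (simp add: i_def)
          note I' = elim(6-15)[THEN I]
          \<comment> \<open>As r < T, the closed interval exceeds (0,T) only by the point 0.\<close>
          have in_AE: "AE t in lborel. i t \<noteq> 0 \<longrightarrow> P t"
            using P AE_lborel_singleton[of 0]
            by eventually_elim (use r in \<open>auto simp: i_def indicator_def split: if_splits\<close>)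
          have a: "eps * (LINT t|lborel. i t * ker FEt FE t s) + sig * (LINT t|lborel. i t * ker FE FE t s)
              + (-1) * (LINT t|lborel. i t * ker FH FcE t s) + (- L) * (LINT t|lborel. i t * ker FG FE t s) = 0"
            unfolding integral_lincomb4[OF I'(1-4), symmetric]
          proof (rule integral_eq_zero_AE)
            show "AE t in lborel. eps * (i t * ker FEt FE t s) + sig * (i t * ker FE FE t s)
              + (-1) * (i t * ker FH FcE t s) + (- L) * (i t * ker FG FE t s) = 0"
              using in_AE
            proof eventually_elim
              case (elim t)
              show ?case
              proof (cases "i t = 0")
                case False
                have "i t * (eps * ker FEt FE t s + sig * ker FE FE t s + (-1) * ker FH FcE t s + (- L) * ker FG FE t s) = 0"
                  using kern(1)[of t s] elim False Ps by simp
                then show ?thesis by (simp add: algebra_simps)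
              qed simp
            qed
          qed
          have b: "mu * (LINT t|lborel. i t * ker FHt FH t s) + (LINT t|lborel. i t * ker FcE FH t s) = 0"
          proof -
            have "(LINT t|lborel. mu * (i t * ker FHt FH t s) + i t * ker FcE FH t s) = 0"
            proof (rule integral_eq_zero_AE)
              show "AE t in lborel. mu * (i t * ker FHt FH t s) + i t * ker FcE FH t s = 0"
                using in_AE
              proof eventually_elim
                case (elim t)
                show ?case
                proof (cases "i t = 0")
                  case False
                  have "i t * (mu * ker FHt FH t s + ker FcE FH t s) = 0"
                    using kern(2)[of t s] elim False Ps by simp
                  then show ?thesis by (simp add: algebra_simps)
                qed simp
              qed
            qed
            then show ?thesis using I'(5,6) by simp
          qed
          have d: "c0 * (LINT t|lborel. i t * ker Fpt Fp t s) + (- alpha) * (LINT t|lborel. i t * ker Fut FG t s)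
              + kappa * (LINT t|lborel. i t * ker FG FG t s) + (- L) * (LINT t|lborel. i t * ker FE FG t s) = 0"
            unfolding integral_lincomb4[OF I'(7-10), symmetric]
          proof (rule integral_eq_zero_AE)
            show "AE t in lborel. c0 * (i t * ker Fpt Fp t s) + (- alpha) * (i t * ker Fut FG t s)
              + kappa * (i t * ker FG FG t s) + (- L) * (i t * ker FE FG t s) = 0"
              using in_AE
            proof eventually_elim
              case (elim t)
              show ?case
              proof (cases "i t = 0")
                case False
                have "i t * (c0 * ker Fpt Fp t s + (- alpha) * ker Fut FG t s + kappa * ker FG FG t s + (- L) * ker FE FG t s) = 0"
                  using kern(5)[of t s] elim False Ps by simp
                then show ?thesis by (simp add: algebra_simps)
              qed simp
            qed
          qed
          have pr: "ker FE FE r s = (LINT t|lborel. i t * ker FEt FE t s)"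
            "ker FH FH r s = (LINT t|lborel. i t * ker FHt FH t s)"
            "ker Fu FG r s = (LINT t|lborel. i t * ker Fut FG t s)"
            "ker Fp Fp r s = (LINT t|lborel. i t * ker Fpt Fp t s)"
            unfolding i_def
            using ker_primitive[OF s1(1) s3(1) s1(1) prim(1) elim(2)] ker_primitive[OF s1(2) s3(2) s1(2) prim(2) elim(3)]
              ker_primitive[OF s1(3) s3(3) s2(4) prim(3) elim(5)] ker_primitive[OF s1(4) s3(4) s1(4) prim(4) elim(4)]
            by blast+
          \<comment> \<open>Elasticity enters at time s with test field u(r), the reverse of the
            other equations. Symmetry of the kernels and \<open>ip_div_grad\<close> match the result
            with the integrated coupling term.\<close>
          have u: "lam * ker Fd Fd r s + G * ker FD FD r s = (- alpha) * ker Fu FG r s"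
            using kern(3)[OF Ps Pr] kern(4)[OF Pr Ps]
            by (simp add: ker_commute[of Fp Fd s r] ker_commute[of Fd Fd s r] ker_commute[of FD FD s r])
          have "(LINT t|lborel. i t * M (t, s)) =
              (LINT t|lborel. sig * (i t * ker FE FE t s) + kappa * (i t * ker FG FG t s)
                + (- L) * (i t * ker FG FE t s) + (- L) * (i t * ker FE FG t s)
                + 1 * (i t * ker FcE FH t s) + (-1) * (i t * ker FH FcE t s))"
            by (intro Bochner_Integration.integral_cong refl) (simp add: M_def algebra_simps)
          also have "\<dots> = sig * (LINT t|lborel. i t * ker FE FE t s) + kappa * (LINT t|lborel. i t * ker FG FG t s)
                + (- L) * (LINT t|lborel. i t * ker FG FE t s) + (- L) * (LINT t|lborel. i t * ker FE FG t s)
                + 1 * (LINT t|lborel. i t * ker FcE FH t s) + (-1) * (LINT t|lborel. i t * ker FH FcE t s)"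
            by (rule integral_lincomb6[OF I'(2) I'(9) I'(4) I'(10) I'(6) I'(3)])
          finally have Mi: "(LINT t|lborel. i t * M (t, s)) = \<dots>" .
          have "K (r, s) + (LINT t|lborel. i t * M (t, s)) = 0"
            unfolding Mi K_def fst_conv snd_conv using a b d u unfolding pr by linarith
          then show "K (r, s) + (LINT t|lborel. indicator {0..r} t * M (t, s)) = 0"
            by (simp add: i_def)
        qed
      qed
    qed
  qed
  have Ki: "integrable (lborel \<Otimes>\<^sub>M lborel) (\<lambda>z. indicator ({0..r} \<times> {0..r}) z * h z)"
    if "integrable (lborel \<Otimes>\<^sub>M lborel) h" for h :: "real \<times> real \<Rightarrow> real" and r
    using integrable_mult_indicator[of "{0..r} \<times> {0..r}" "lborel \<Otimes>\<^sub>M lborel" h] that by simp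
  note Ki' = Ki[OF integrable_ker[unfolded split_beta']]
  have M_pos: "0 \<le> (LINT z|(lborel \<Otimes>\<^sub>M lborel). indicator ({0..r} \<times> {0..r}) z * M z)" for r
  proof -
    define q where "q = (\<lambda>z::real \<times> real. indicator ({0..r} \<times> {0..r}) z :: real)"
    have "(LINT z|(lborel \<Otimes>\<^sub>M lborel). q z * M z) =
        (LINT z|(lborel \<Otimes>\<^sub>M lborel). sig * (q z * ker FE FE (fst z) (snd z)) + kappa * (q z * ker FG FG (fst z) (snd z))
      + (- L) * (q z * ker FG FE (fst z) (snd z)) + (- L) * (q z * ker FE FG (fst z) (snd z))
      + 1 * (q z * ker FcE FH (fst z) (snd z)) + (-1) * (q z * ker FH FcE (fst z) (snd z)))"
      by (intro Bochner_Integration.integral_cong refl) (simp add: M_def algebra_simps)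
    also have "\<dots> = sig * (LINT x|lborel. inner (tint r FE x) (tint r FE x)) + kappa * (LINT x|lborel. inner (tint r FG x) (tint r FG x))
      + (- L) * (LINT x|lborel. inner (tint r FG x) (tint r FE x)) + (- L) * (LINT x|lborel. inner (tint r FE x) (tint r FG x))
      + 1 * (LINT x|lborel. inner (tint r FcE x) (tint r FH x)) + (-1) * (LINT x|lborel. inner (tint r FH x) (tint r FcE x))"
      unfolding q_def
        integral_lincomb6[OF Ki'[OF s1(1) s1(1)] Ki'[OF s2(4) s2(4)] Ki'[OF s2(4) s1(1)] Ki'[OF s1(1) s2(4)] Ki'[OF s2(1) s1(2)] Ki'[OF s1(2) s2(1)]]
        integral_square_ker[OF s1(1) s1(1)] integral_square_ker[OF s2(4) s2(4)] integral_square_ker[OF s2(4) s1(1)]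
        integral_square_ker[OF s1(1) s2(4)] integral_square_ker[OF s2(1) s1(2)] integral_square_ker[OF s1(2) s2(1)] ..
    \<comment> \<open>The two curl integrals pair the same time integrals in opposite order and
      cancel, so no sign of either is required.\<close>
    also have "\<dots> = (LINT x|lborel. sig * inner (tint r FE x) (tint r FE x) + kappa * inner (tint r FG x) (tint r FG x)
      + (- L) * inner (tint r FG x) (tint r FE x) + (- L) * inner (tint r FE x) (tint r FG x))"
      unfolding integral_lincomb4[OF integrable_inner_tint[OF s1(1) s1(1)] integrable_inner_tint[OF s2(4) s2(4)]
          integrable_inner_tint[OF s2(4) s1(1)] integrable_inner_tint[OF s1(1) s2(4)]]
      by (simp add: inner_commute)
    also have "\<dots> \<ge> 0"
    proof (intro integral_nonneg_AE AE_I2)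
      fix x
      show "0 \<le> sig * inner (tint r FE x) (tint r FE x) + kappa * inner (tint r FG x) (tint r FG x)
        + (- L) * inner (tint r FG x) (tint r FE x) + (- L) * inner (tint r FE x) (tint r FG x)"
        using dissipation_nonneg[OF pos(4) pos(2) pos(8) L, of "tint r FG x" "tint r FE x"]
        by (simp add: inner_commute)
    qed
    finally show ?thesis by (simp add: q_def)
  qed
  have sym: "K (r, s) = K (s, r)" for r s
    by (simp add: K_def ker_commute[of _ _ r s])
  have zero: "(LINT x|lborel. inner (tint r FE x) (tint r FE x)) = 0 \<and>
      (LINT x|lborel. inner (tint r FH x) (tint r FH x)) = 0 \<and>
      (LINT x|lborel. inner (tint r Fp x) (tint r Fp x)) = 0" if r: "r \<in> {0<..T}" for r
  proof -
    define q where "q = (\<lambda>z::real \<times> real. indicator ({0..r} \<times> {0..r}) z :: real)"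
    have "(LINT z|(lborel \<Otimes>\<^sub>M lborel). q z * K z) =
        (LINT z|(lborel \<Otimes>\<^sub>M lborel). eps * (q z * ker FE FE (fst z) (snd z)) + mu * (q z * ker FH FH (fst z) (snd z))
      + c0 * (q z * ker Fp Fp (fst z) (snd z)) + lam * (q z * ker Fd Fd (fst z) (snd z))
      + G * (q z * ker FD FD (fst z) (snd z)) + 0 * (q z * ker FE FE (fst z) (snd z)))"
      by (intro Bochner_Integration.integral_cong refl) (simp add: K_def algebra_simps)
    also have "\<dots> = eps * (LINT x|lborel. inner (tint r FE x) (tint r FE x)) + mu * (LINT x|lborel. inner (tint r FH x) (tint r FH x))
      + c0 * (LINT x|lborel. inner (tint r Fp x) (tint r Fp x)) + lam * (LINT x|lborel. inner (tint r Fd x) (tint r Fd x))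
      + G * (LINT x|lborel. inner (tint r FD x) (tint r FD x)) + 0 * (LINT x|lborel. inner (tint r FE x) (tint r FE x))"
      unfolding q_def
        integral_lincomb6[OF Ki'[OF s1(1) s1(1)] Ki'[OF s1(2) s1(2)] Ki'[OF s1(4) s1(4)] Ki'[OF s4 s4] Ki'[OF s2(3) s2(3)] Ki'[OF s1(1) s1(1)]]
        integral_square_ker[OF s1(1) s1(1)] integral_square_ker[OF s1(2) s1(2)] integral_square_ker[OF s1(4) s1(4)]
        integral_square_ker[OF s4 s4] integral_square_ker[OF s2(3) s2(3)] ..
    finally have sum: "\<dots> \<le> 0"
      using symmetric_kernel_energy[OF K M sym rel M_pos r] by (simp add: q_def)
    have nn: "0 \<le> eps * (LINT x|lborel. inner (tint r FE x) (tint r FE x))"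
      "0 \<le> mu * (LINT x|lborel. inner (tint r FH x) (tint r FH x))"
      "0 \<le> c0 * (LINT x|lborel. inner (tint r Fp x) (tint r Fp x))"
      "0 \<le> lam * (LINT x|lborel. inner (tint r Fd x) (tint r Fd x))"
      "0 \<le> G * (LINT x|lborel. inner (tint r FD x) (tint r FD x))"
      using pos by (intro mult_nonneg_nonneg integral_nonneg_AE AE_I2; simp)+
    \<comment> \<open>All five terms are nonnegative with sum at most 0. Only the squares that
      determine \<open>E\<close>, \<open>H\<close> and \<open>p\<close> are kept; the displacement
      is recovered from the pressure.\<close>
    have "eps * (LINT x|lborel. inner (tint r FE x) (tint r FE x)) = 0"
      "mu * (LINT x|lborel. inner (tint r FH x) (tint r FH x)) = 0"
      "c0 * (LINT x|lborel. inner (tint r Fp x) (tint r Fp x)) = 0"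
      using sum nn by linarith+
    then show ?thesis using pos by simp
  qed
  have E0: "AE t in lborel. AE x in lborel. FE (t, x) = 0"
    and H0: "AE t in lborel. AE x in lborel. FH (t, x) = 0"
    and p0: "AE t in lborel. AE x in lborel. Fp (t, x) = 0"
    using zero by (auto intro!: sqint_eq_0_if_integral_tint_eq_0 s1)
  \<comment> \<open>Where p(t) = 0, elasticity tested with u(t) itself says that two nonnegative
    terms add up to 0. Each component of u(t) then has zero gradient and falls under
    \<open>H1_0_gradient_zero\<close>.\<close>
  have u0: "AE t in lborel. AE x in lborel. Fu (t, x) = 0"
    using P p0
  proof eventually_elim
    case (elim t)
    show ?case
    proof (cases "t \<in> {0<..<T}")
      case False
      then show ?thesis using s1(3) by (simp add: sqint_def)
    next
      case True
      note t = elim(1)[rule_format, OF True, unfolded P_def]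
      have sl: "slice \<Omega> (p t) Fp t" "slice \<Omega> (u t) Fu t" and v: "H1_0v \<Omega> (u t) (Du t)"
        using t by blast+
      have "AE x in lborel. x \<in> \<Omega> \<longrightarrow> p t x = 0"
        using elim(2) sl(1)[unfolded slice_def] by eventually_elim auto
      then have "ip \<Omega> (p t) (\<lambda>x. mdiv (Du t x)) = 0"
        by (intro ip_AE_0 AE_completion)
      moreover have "lam * ip \<Omega> (\<lambda>x. mdiv (Du t x)) (\<lambda>x. mdiv (Du t x)) + G * ip \<Omega> (Du t) (Du t)
              - alpha * ip \<Omega> (p t) (\<lambda>x. mdiv (Du t x)) = 0"
        using t v by blast
      moreover have "0 \<le> lam * ip \<Omega> (\<lambda>x. mdiv (Du t x)) (\<lambda>x. mdiv (Du t x))" "0 \<le> G * ip \<Omega> (Du t) (Du t)"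
        using pos by (simp_all add: ip_self_nonneg)
      ultimately have "G * ip \<Omega> (Du t) (Du t) = 0" by (simp only: mult_zero_right)
      then have "ip \<Omega> (Du t) (Du t) = 0" using pos by simp
      then have D0: "AE x in lebesgue. x \<in> \<Omega> \<longrightarrow> Du t x = 0"
        using ip_self_eq_0_iff[OF H1_0v_L2(2)[OF v]] by simp
      have "AE x in lebesgue. x \<in> \<Omega> \<longrightarrow> u t x $ i = 0" for i
      proof (rule H1_0_gradient_zero[OF \<Omega>])
        show "H1_0 \<Omega> (\<lambda>x. u t x $ i) (\<lambda>x. Du t x $ i)" using v by (simp add: H1_0v_def)
        show "AE x in lebesgue. x \<in> \<Omega> \<longrightarrow> Du t x $ i = 0" using D0 by eventually_elim simp
      qed
      then have "AE x in lebesgue. \<forall>i\<in>UNIV. x \<in> \<Omega> \<longrightarrow> u t x $ i = 0"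
        by (intro AE_finite_allI) auto
      then show ?thesis
        unfolding AE_completion_iff using sl(2)[unfolded slice_def]
      proof eventually_elim
        case (elim x)
        show ?case
        proof (cases "x \<in> \<Omega>")
          case True
          then have "u t x = 0" using elim(1) by (simp add: vec_eq_iff)
          then show ?thesis using elim(2) by simp
        next
          case False
          then show ?thesis using elim(2) by simp
        qed
      qed
    qed
  qed
  show ?thesis
    using rep_eq_0[OF F1(1) E0] rep_eq_0[OF F1(2) H0] rep_eq_0[OF F1(3) u0] rep_eq_0[OF F1(4) p0]
    by eventually_elim simp
qed

theorem theorem3p2:
  fixes \<Omega> :: "(real^3) set" and T eps sig mu L lam G alpha c0 kappa :: real
    and j :: "real \<Rightarrow> real^3 \<Rightarrow> real^3" and g :: "real \<Rightarrow> real^3 \<Rightarrow> real"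
    and E0 H0 u0 :: "real^3 \<Rightarrow> real^3" and p0 :: "real^3 \<Rightarrow> real"
    and E1 Hf1 u1 E2 Hf2 u2 :: "real \<Rightarrow> real^3 \<Rightarrow> real^3" and p1 p2 :: "real \<Rightarrow> real^3 \<Rightarrow> real"
  assumes dom: "open \<Omega>" "bounded \<Omega>" "simply_connected \<Omega>" "convex \<Omega>" "lipschitz_boundary \<Omega>"
    and T: "T > 0"
    and pos: "eps > 0" "sig > 0" "mu > 0" "L > 0" "lam > 0" "G > 0" "alpha > 0" "c0 > 0" "kappa > 0"
    and hyp1: "L < sqrt (sig * kappa)"
    and hyp2: "H1T \<Omega> T j" "H1T \<Omega> T g"
    and hyp3: "\<exists>cE0. H0curl \<Omega> E0 cE0" "Hdiv \<Omega> E0" "\<exists>cH0. Hcurl \<Omega> H0 cH0"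
            "H2 \<Omega> p0" "\<exists>Gp0. H1_0 \<Omega> p0 Gp0"
    and sol1: "weak_solution \<Omega> T eps sig mu L lam G alpha c0 kappa j g E0 H0 u0 p0 E1 Hf1 u1 p1"
    and sol2: "weak_solution \<Omega> T eps sig mu L lam G alpha c0 kappa j g E0 H0 u0 p0 E2 Hf2 u2 p2"
  shows "AE z in lebesgue. z \<in> {0<..<T} \<times> \<Omega> \<longrightarrow>
           E1 (fst z) (snd z) = E2 (fst z) (snd z) \<and> Hf1 (fst z) (snd z) = Hf2 (fst z) (snd z) \<and>
           u1 (fst z) (snd z) = u2 (fst z) (snd z) \<and> p1 (fst z) (snd z) = p2 (fst z) (snd z)"
proof -
  have "AE z in lebesgue. z \<in> {0<..<T} \<times> \<Omega> \<longrightarrow>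
      E1 (fst z) (snd z) - E2 (fst z) (snd z) = 0 \<and> Hf1 (fst z) (snd z) - Hf2 (fst z) (snd z) = 0 \<and>
      u1 (fst z) (snd z) - u2 (fst z) (snd z) = 0 \<and> p1 (fst z) (snd z) - p2 (fst z) (snd z) = 0"
    by (rule homogeneous_solution_eq_0[OF dom(1,2) pos(1-6,8,9) hyp1
          weak_solution_diff[OF dom(1,2) sol1 sol2]])
  then show ?thesis
    by (simp only: right_minus_eq)
qed

end
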